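(* Let $W$ be a step-graphon with partition $\sigma=(\sigma_0,\ldots,\sigma_q)$, concentration vector $x^*$, skeleton graph $S$ and edge cone $\mathsf{X}$ of $S$, and assume that $S$ is connected. For $n\ge 1$ let $P_n(W)$ be the probability that the random graph $G_n\sim W$ on $n$ nodes has a cycle cover. Consider the conditions: (A) $S$ has an odd cycle (a self-loop counts as an odd cycle of length $1$); (B) $x^*\in \operatorname{int}\mathsf{X}$, the relative interior of $\mathsf{X}$; (B') $x^*\in \mathsf{X}$. Then the following hold. 1. If $W$ satisfies (A) and (B), then there exist constants $c>0$ and $\lambda>0$ such that $1-P_n(W)\le c\,e^{-\lambda n}$ for all $n\ge 1$. 2. If $W$ does not satisfy (B'), then there exist constants $c>0$ and $\lambda>0$ such that $P_n(W)\le c\,e^{-\lambda n}$ for all $n\ge 1$. 3. If $W$ satisfies (B') but not (A), then there exists a constant $c>0$ such that $P_n(W)\le \dfrac{c}{\sqrt n}$ for all $n\ge 1$. 4. If $W$ satisfies (A) and (B') but not (B), then there exist $p^*\in(0,1)$ and a constant $c>0$ such that $|P_n(W)-p^*|\le \dfrac{c}{\sqrt n}$ for all $n\ge 1$.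
   Context: A graphon is a symmetric measurable function $W:[0,1]^2\to[0,1]$. A graphon $W$ is a step-graphon if there is a sequence $0=\sigma_0<\sigma_1<\cdots<\sigma_q=1$ such that $W$ is constant on each rectangle $[\sigma_i,\sigma_{i+1})\times[\sigma_j,\sigma_{j+1})$, $0\le i,j\le q-1$; then $\sigma=(\sigma_0,\ldots,\sigma_q)$ is called a partition for $W$. Sampling $G_n\sim W$: draw $r_1,\ldots,r_n$ i.i.d. uniformly from $[0,1]$ ($r_i$ is the coordinate of node $v_i$); then, given these coordinates, for each pair of distinct nodes $v_i,v_j$ independently, place an undirected edge $(v_i,v_j)$ with probability $W(r_i,r_j)$. Thus $G_n$ is a simple undirected graph on $n$ nodes (no self-loops, no multiple edges). A cycle cover of a simple undirected graph $G$ is a node-wise disjoint union of cycles of $G$ that visits every node of $G$ (cycles in the usual sense for simple graphs, i.e. with at least $3$ nodes). Concentration vector: $x^*=(x_1^*,\ldots,x_q^* )$ with $x_i^*=\sigma_i-\sigma_{i-1}$. Skeleton graph: the undirected graph $S$ with node set $\{u_1,\ldots,u_q\}$, possibly with self-loops, in which there is an edge $(u_i,u_j)$ (including the case $i=j$, a self-loop) if and only if $W$ is nonzero on $[\sigma_{i-1},\sigma_i)\times[\sigma_{j-1},\sigma_j)$. Edge cone: let $e_1,\ldots,e_q$ be the standard basis of $\mathbb{R}^q$. To each edge $f_j=(u_{i_1},u_{i_2})$ of $S$ assign $z_j=\frac12(e_{i_1}+e_{i_2})\in\mathbb{R}^q$ (so a self-loop at $u_i$ gives $e_i$). If $z_1,\ldots,z_k$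 are the vectors of all edges of $S$, the edge cone is $\mathsf{X}=\{\sum_{j=1}^k c_jz_j : c_j\ge 0 \text{ for all } j\}$. A cycle of $S$ is odd if its length is odd. *)

theory Defs
  imports "HOL-Probability.Probability"
begin

section \<open>Undirected graphs\<close>

text \<open>
  A graph is given by a set of nodes and a set of edges. The edge between \<open>u\<close> and \<open>v\<close> is the
  set \<open>{u, v}\<close>, so that a self-loop at \<open>u\<close> is the singleton \<open>{u}\<close>.
\<close>

definition graph_connected :: "'v set \<Rightarrow> 'v set set \<Rightarrow> bool" where
  "graph_connected V E \<longleftrightarrow>
     (\<forall>u\<in>V. \<forall>v\<in>V. (u, v) \<in> {(x, y). x \<in> V \<and> y \<in> V \<and> {x, y} \<in> E}\<^sup>*)"

definition is_cycle :: "'v set set \<Rightarrow> 'v list \<Rightarrow> bool" where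
  "is_cycle E vs \<longleftrightarrow>
     3 \<le> length vs \<and> distinct vs \<and>
     (\<forall>i<length vs. {vs ! i, vs ! (Suc i mod length vs)} \<in> E)"

definition has_odd_cycle :: "'v set set \<Rightarrow> bool" where
  "has_odd_cycle E \<longleftrightarrow> (\<exists>v. {v} \<in> E) \<or> (\<exists>vs. is_cycle E vs \<and> odd (length vs))"

text \<open>Distinctness of the concatenation expresses that the cycles are pairwise node-disjoint.\<close>

definition has_cycle_cover :: "'v set \<Rightarrow> 'v set set \<Rightarrow> bool" where
  "has_cycle_cover V E \<longleftrightarrow>
     (\<exists>C. (\<forall>vs\<in>set C. is_cycle E vs) \<and> distinct (concat C) \<and> set (concat C) = V)"


section \<open>Step-graphons\<close>

definition is_graphon :: "(real \<Rightarrow> real \<Rightarrow> real) \<Rightarrow> bool" where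
  "is_graphon W \<longleftrightarrow>
     (\<forall>x\<in>{0..1}. \<forall>y\<in>{0..1}. W x y \<in> {0..1} \<and> W x y = W y x) \<and>
     case_prod W \<in> borel_measurable (lebesgue_on ({0..1} \<times> {0..1}))"

definition is_partition :: "(real \<Rightarrow> real \<Rightarrow> real) \<Rightarrow> nat \<Rightarrow> (nat \<Rightarrow> real) \<Rightarrow> bool" where
  "is_partition W q \<sigma> \<longleftrightarrow>
     \<sigma> 0 = 0 \<and> \<sigma> q = 1 \<and> (\<forall>i<q. \<sigma> i < \<sigma> (Suc i)) \<and>
     (\<forall>i<q. \<forall>j<q.
        case_prod W constant_on ({\<sigma> i..<\<sigma> (Suc i)} \<times> {\<sigma> j..<\<sigma> (Suc j)}))"

text \<open>
  The \<open>q\<close> nodes of the skeleton graph, and the coordinates of \<open>\<real>\<^sup>q\<close>, are indexed by a finite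
  linearly ordered type \<open>'q\<close> with \<open>CARD('q) = q\<close>. The function \<open>pos\<close> is the order isomorphism from
  \<open>'q\<close> to \<open>{0..<q}\<close>.
\<close>

definition pos :: "'q::{finite,linorder} \<Rightarrow> nat" where
  "pos k = card {j. j < k}"

definition part_interval :: "(nat \<Rightarrow> real) \<Rightarrow> 'q::{finite,linorder} \<Rightarrow> real set" where
  "part_interval \<sigma> k = {\<sigma> (pos k)..<\<sigma> (Suc (pos k))}"

definition concentration :: "(nat \<Rightarrow> real) \<Rightarrow> real ^ ('q::{finite,linorder})" where
  "concentration \<sigma> = (\<chi> k. \<sigma> (Suc (pos k)) - \<sigma> (pos k))"

definition skeleton ::
  "(real \<Rightarrow> real \<Rightarrow> real) \<Rightarrow> (nat \<Rightarrow> real) \<Rightarrow> 'q::{finite,linorder} set set" where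
  "skeleton W \<sigma> =
     {{k, l} | k l. \<forall>x\<in>part_interval \<sigma> k. \<forall>y\<in>part_interval \<sigma> l. W x y \<noteq> 0}"

text \<open>
  The end points of an edge are its minimum and its maximum, which coincide for a self-loop.
\<close>

definition edge_vector :: "'q::{finite,linorder} set \<Rightarrow> real ^ ('q::{finite,linorder})" where
  "edge_vector f = (1/2) *\<^sub>R (axis (Min f) 1 + axis (Max f) 1)"

lemma edge_vector_doubleton:
  "edge_vector {k, l} = (1/2) *\<^sub>R (axis k 1 + axis l 1)"
  by (cases "k \<le> l") (auto simp: edge_vector_def min_def max_def)

definition edge_cone :: "'q::{finite,linorder} set set \<Rightarrow> (real ^ ('q::{finite,linorder})) set" where
  "edge_cone E = {\<Sum>f\<in>E. c f *\<^sub>R edge_vector f | c. \<forall>f\<in>E. c f \<ge> 0}"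


section \<open>Sampling from a graphon\<close>

text \<open>The random edge set on the nodes \<open>{..<n}\<close>, given their coordinates \<open>r\<close>.\<close>

definition edges_given ::
  "(real \<Rightarrow> real \<Rightarrow> real) \<Rightarrow> nat \<Rightarrow> (nat \<Rightarrow> real) \<Rightarrow> nat set set pmf" where
  "edges_given W n r =
     map_pmf (\<lambda>b. {{i, j} | i j. i < j \<and> j < n \<and> b (i, j)})
       (Pi_pmf {(i, j). i < j \<and> j < n} False (\<lambda>(i, j). bernoulli_pmf (W (r i) (r j))))"

text \<open>
  The product measure is completed because \<open>W\<close> is only assumed to be Lebesgue measurable on the
  unit square: in general \<open>r \<mapsto> W (r i) (r j)\<close> is measurable for the completion only.
\<close>

definition sample_graph :: "(real \<Rightarrow> real \<Rightarrow> real) \<Rightarrow> nat \<Rightarrow> nat set set measure" where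
  "sample_graph W n =
     completion (Pi\<^sub>M {..<n} (\<lambda>_. uniform_measure lborel {0..1::real}))
       \<bind> (\<lambda>r. measure_pmf (edges_given W n r))"

definition cycle_cover_prob :: "(real \<Rightarrow> real \<Rightarrow> real) \<Rightarrow> nat \<Rightarrow> real" where
  "cycle_cover_prob W n = measure (sample_graph W n) {E. has_cycle_cover {..<n} E}"

end

theory Submission
  imports Defs "HOL-Combinatorics.Cycles"
begin

text \<open>
  Why the theorem holds. Only the types of the sampled nodes matter, that is, the parts of the
  partition that contain their coordinates; they are independent with law \<open>x\<close>. Let \<open>N\<close> be the
  vector that counts the nodes of each type, and let \<open>\<Gamma> T\<close> be the set of neighbours in the skeleton
  graph \<open>S\<close> of a set \<open>T\<close> of types.

  Every node lies on exactly two edges of a cycle cover. Giving half of each edge to either end point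
  shows that \<open>N\<close> lies in the edge cone \<open>X\<close> (\<open>type_counts_in_edge_cone\<close>), so \<open>N(\<Gamma> T) \<ge> N(T)\<close> for all
  \<open>T\<close>. Conversely, let \<open>x \<in> X\<close>, let \<open>N/n\<close> be close to \<open>x\<close>, and let \<open>N(\<Gamma> T) \<ge> N(T)\<close> hold for each
  \<^emph>\<open>tight\<close> \<open>T\<close>, one with \<open>x(\<Gamma> T) = x(T)\<close>. Then a cycle cover exists up to an exponentially small
  probability (\<open>cycle_cover_whp_of_types\<close>). To see this, orient each edge by a fair coin. A
  permutation that maps each node to one of its out-neighbours is a cycle cover, because it has no
  fixed points and an edge that is oriented one way only cannot form a cycle of length two. By Hall's
  theorem the permutation exists unless some set of nodes has too few out-neighbours. The oriented
  graph is pseudo-random: degrees are linear and arcs run between all large sets of adjacent types.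
  Hence only unions of types can be deficient, and these are excluded by the assumption on \<open>N\<close>.

  So for \<open>x \<in> X\<close> the probability of a cycle cover is, up to an exponentially small error, the
  probability that \<open>N\<close> satisfies the tight inequalities. The four claims follow.
  \<^item> If \<open>x\<close> is in the relative interior, then the functional \<open>y \<mapsto> y(\<Gamma> T) - y(T)\<close> of a tight \<open>T\<close> vanishes
    on all of \<open>X\<close>; as \<open>S\<close> is connected with an odd cycle, it is zero, and there is no condition.
  \<^item> If \<open>x \<notin> X\<close>, then \<open>N/n\<close> stays outside the closed cone \<open>X\<close> by Hoeffding's inequality.
  \<^item> Without odd cycle \<open>S\<close> is bipartite, and a cycle cover has equally many nodes on both sides. As
    \<open>x \<in> X\<close>, this is the event that a symmetric binomial variable equals its mean.
  \<^item> On the boundary, write \<open>x\<close> as a nonnegative combination of edge vectors with coefficients \<open>c\<^sub>f\<close>. A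
    type with law \<open>x\<close> arises by choosing an edge \<open>f\<close> with probability \<open>c\<^sub>f\<close> and then one of its end
    points by a fair coin. Tight functionals change sign along these edges, so that the tight
    inequalities become homogeneous linear inequalities between the sums of the fair signs of the
    edges. Given the chosen edges, these sums are independent. The set cut out by the inequalities is
    convex, so its sections along a coordinate are intervals, and the sums can be replaced by Gaussian
    variables one after the other; each replacement costs the error \<open>O(1/\<surd>n)\<close> of the
    normal approximation on intervals (\<open>binomial_normal_interval\<close>). The limit \<open>p\<close> is the Gaussian
    measure of a proper cone with nonempty interior.
\<close>

text \<open>Labels of nodes are types and, for the Gaussian limit, edges of the skeleton graph.\<close>

abbreviation nodes_of :: "nat \<Rightarrow> (nat \<Rightarrow> 'k) \<Rightarrow> 'k \<Rightarrow> nat set" where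
  "nodes_of n b k \<equiv> {v\<in>{..<n}. b v = k}"


section \<open>Normal approximation of the symmetric binomial distribution\<close>

text \<open>
  The binomial coefficients are compared with Gaussian weights through the ratio of consecutive
  terms. With \<open>a = m + 1\<close>, \<open>y = 2 j - m\<close> and \<open>u = (y + 1) / a\<close> it is \<open>(1 - u) / (1 + u)\<close> for
  \<open>binomial m j\<close> and \<open>exp (- 2 u)\<close> for \<open>exp (- y\<^sup>2 / (2 a))\<close>. The next two lemmas compare both.
\<close>

lemma ratio_upper:
  fixes u :: real assumes "0 \<le> u" "u \<le> 1"
  shows "(1 - u) \<le> (1 + u) * exp (- 2 * u)"
proof (cases "u = 1")
  case False
  with assms have u: "u < 1" by simp
  define \<phi> where "\<phi> = (\<lambda>t::real. ln (1 + t) - ln (1 - t) - 2 * t)"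
  have "\<phi> 0 \<le> \<phi> u"
  proof (rule DERIV_nonneg_imp_nondecreasing[OF assms(1)])
    fix t assume t: "0 \<le> t" "t \<le> u"
    have t01: "1 + t > 0" "1 - t > 0" using t u by auto
    have "(\<phi> has_real_derivative (1 / (1 + t) + 1 / (1 - t) - 2)) (at t)"
      unfolding \<phi>_def using t01 by (auto intro!: derivative_eq_intros simp: inverse_eq_divide)
    moreover have "1 / (1 + t) + 1 / (1 - t) - 2 \<ge> 0"
    proof -
      have "1 / (1 + t) + 1 / (1 - t) = 2 / ((1 + t) * (1 - t))"
        using t01 by (simp add: add_frac_eq)
      moreover have "(1 + t) * (1 - t) \<le> 1" by (simp add: algebra_simps)
      moreover have "(1 + t) * (1 - t) > 0" using t01 by simp
      ultimately show ?thesis by (simp add: le_divide_eq)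
    qed
    ultimately show "\<exists>y. (\<phi> has_real_derivative y) (at t) \<and> 0 \<le> y" by auto
  qed
  then have "ln (1 - u) \<le> ln (1 + u) - 2 * u" by (simp add: \<phi>_def)
  then have "exp (ln (1 - u)) \<le> exp (ln (1 + u) - 2 * u)" by simp
  then show ?thesis using u assms by (simp add: exp_diff exp_minus field_simps)
qed auto

lemma ratio_lower:
  fixes u :: real assumes "0 \<le> u" "u \<le> 1"
  shows "(1 - u) \<ge> (1 + u) * exp (- 2 * u) * (1 - u\<^sup>2)"
proof -
  have "(1 + u)\<^sup>2 \<le> (exp u)\<^sup>2" using assms by (intro power_mono exp_ge_add_one_self) auto
  also have "\<dots> = exp (2 * u)" by (simp add: exp_double)
  finally have "(1 + u)\<^sup>2 * exp (- 2 * u) \<le> 1"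
    by (simp add: exp_minus field_simps)
  then have "(1 - u) * ((1 + u)\<^sup>2 * exp (- 2 * u)) \<le> (1 - u) * 1"
    using assms by (intro mult_left_mono) auto
  then show ?thesis by (simp add: power2_eq_square algebra_simps)
qed

text \<open>
  The value at \<open>j\<close> of the binomial weights relative to the Gaussian weights
  \<open>exp (- y\<^sup>2 / (2 (m + 1)))\<close>, where \<open>y = 2 j - m\<close>. The variance \<open>m + 1\<close> instead of \<open>m\<close> makes this ratio
  monotone on either side of the centre.
\<close>

definition binom_gauss_ratio :: "nat \<Rightarrow> nat \<Rightarrow> real" where
  "binom_gauss_ratio m j = real (m choose j) * exp ((2 * real j - real m)\<^sup>2 / (2 * (real m + 1)))"

lemma binom_gauss_ratio_step:
  assumes "m \<le> 2 * j + 1" "j \<le> m"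
  defines "u \<equiv> (2 * real j + 1 - real m) / (real m + 1)"
  shows "binom_gauss_ratio m (Suc j) \<le> binom_gauss_ratio m j"
    and "binom_gauss_ratio m (Suc j) \<ge> (1 - u\<^sup>2) * binom_gauss_ratio m j"
proof -
  define a where "a = real m + 1"
  have a: "a > 0" by (simp add: a_def)
  have u: "0 \<le> u" "u \<le> 1" using assms by (auto simp: u_def field_simps)
  have ua: "a * u = 2 * real j + 1 - real m" using a by (simp add: u_def a_def)
  have "Suc j * (m choose Suc j) = (m - j) * (m choose j)"
    by (metis Suc_times_binomial_eq mult.commute binomial_absorb_comp binomial_absorption
        diff_Suc_Suc binomial_Suc_Suc_eq_times mult.assoc)
  then have "real (Suc j * (m choose Suc j)) = real ((m - j) * (m choose j))" by simp
  then have 1: "(real j + 1) * real (m choose Suc j) = (real m - real j) * real (m choose j)"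
    using assms(2) by (simp add: of_nat_diff algebra_simps)
  have j1: "2 * (real j + 1) = a * (1 + u)" "2 * (real m - real j) = a * (1 - u)"
    using ua by (simp_all add: a_def algebra_simps)
  have "a * (1 + u) * real (m choose Suc j) = a * (1 - u) * real (m choose j)"
    unfolding j1[symmetric] mult.assoc using 1 by simp
  then have 2: "(1 + u) * real (m choose Suc j) = (1 - u) * real (m choose j)" using a by simp
  have e: "(2 * real (Suc j) - real m)\<^sup>2 / (2 * (real m + 1)) =
     (2 * real j - real m)\<^sup>2 / (2 * (real m + 1)) + 2 * u"
  proof -
    have "(2 * real (Suc j) - real m)\<^sup>2 = (2 * real j - real m)\<^sup>2 + 4 * (a * u)"
      unfolding ua by (simp add: power2_eq_square algebra_simps)
    then show ?thesis unfolding a_def[symmetric] using a by (simp add: add_divide_distrib)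
  qed
  define E where "E = exp ((2 * real j - real m)\<^sup>2 / (2 * (real m + 1)))"
  have r1: "binom_gauss_ratio m j = real (m choose j) * E"
    by (simp add: binom_gauss_ratio_def E_def)
  have r2: "binom_gauss_ratio m (Suc j) = real (m choose Suc j) * (E * exp (2 * u))"
    unfolding binom_gauss_ratio_def e exp_add E_def ..
  have E0: "E > 0" by (simp add: E_def)
  have up: "(1 - u) * exp (2 * u) \<le> (1 + u)"
    using ratio_upper[OF u] by (simp add: exp_minus field_simps)
  have lo: "(1 - u) * exp (2 * u) \<ge> (1 + u) * (1 - u\<^sup>2)"
    using ratio_lower[OF u] by (simp add: exp_minus field_simps)
  have eq: "(1 + u) * binom_gauss_ratio m (Suc j) = ((1 - u) * exp (2 * u)) * binom_gauss_ratio m j"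
    unfolding r1 r2 using 2 by (simp add: mult.assoc mult.left_commute)
  have nn: "binom_gauss_ratio m j \<ge> 0" by (simp add: binom_gauss_ratio_def)
  have "(1 + u) * binom_gauss_ratio m (Suc j) \<le> (1 + u) * binom_gauss_ratio m j"
    unfolding eq by (intro mult_right_mono up nn)
  then show "binom_gauss_ratio m (Suc j) \<le> binom_gauss_ratio m j" using u by simp
  have "(1 + u) * binom_gauss_ratio m (Suc j) \<ge> (1 + u) * (1 - u\<^sup>2) * binom_gauss_ratio m j"
    unfolding eq by (intro mult_right_mono lo nn)
  then have "(1 + u) * ((1 - u\<^sup>2) * binom_gauss_ratio m j) \<le> (1 + u) * binom_gauss_ratio m (Suc j)"
    by (simp add: mult.assoc)
  then show "binom_gauss_ratio m (Suc j) \<ge> (1 - u\<^sup>2) * binom_gauss_ratio m j"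
    using u by (subst (asm) mult_le_cancel_left_pos) auto
qed

text \<open>
  By the step lemma each step multiplies the ratio by at least \<open>1 - ((y + 1) / a)\<^sup>2\<close>; adding up these
  losses from the centre to \<open>y\<close> gives at most \<open>y\<^sup>3 / a\<^sup>2\<close>.
\<close>

lemma binom_gauss_ratio_bounds_upper_half:
  fixes m i :: nat
  defines "c \<equiv> (m + 1) div 2"
  assumes "c + i \<le> m"
  shows "binom_gauss_ratio m (c + i) \<le> binom_gauss_ratio m c \<and>
   binom_gauss_ratio m (c + i) \<ge> (1 - (2 * real (c + i) - real m) ^ 3 / (real m + 1)\<^sup>2) * binom_gauss_ratio m c"
  using assms(2)
proof (induction i)
  case 0
  have y: "2 * real c - real m \<ge> 0" "2 * real c - real m \<le> 1" unfolding c_def by linarith+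
  then have "(2 * real c - real m) ^ 3 \<le> 1" by (rule power_le_one)
  moreover have "(1::real) \<le> (real m + 1)\<^sup>2" by (simp add: one_le_power)
  ultimately have "(2 * real c - real m) ^ 3 \<le> (real m + 1)\<^sup>2" by linarith
  then show ?case using y by (auto intro!: mult_left_le_one_le simp: binom_gauss_ratio_def divide_le_eq)
next
  case (Suc i)
  define j where "j = c + i"
  have mc: "m \<le> 2 * c" unfolding c_def by linarith
  then have j: "m \<le> 2 * j + 1" "j \<le> m" using Suc.prems unfolding j_def by simp_all
  define y where "y = 2 * real j - real m"
  have y0: "y \<ge> 0" using mc unfolding y_def j_def by simp
  define a where "a = real m + 1"
  have a: "a \<ge> 1" by (simp add: a_def)
  define R where "R = binom_gauss_ratio m c"
  have R0: "R \<ge> 0" by (simp add: R_def binom_gauss_ratio_def)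
  have IH: "binom_gauss_ratio m j \<le> R" "binom_gauss_ratio m j \<ge> (1 - y ^ 3 / a\<^sup>2) * R"
    using Suc unfolding j_def y_def a_def R_def by auto
  have s: "binom_gauss_ratio m (Suc j) \<le> binom_gauss_ratio m j"
    "binom_gauss_ratio m (Suc j) \<ge> (1 - ((y + 1) / a)\<^sup>2) * binom_gauss_ratio m j"
    using binom_gauss_ratio_step[OF j] by (simp_all add: y_def a_def algebra_simps)
  have "binom_gauss_ratio m (Suc j) \<ge> binom_gauss_ratio m j - ((y + 1) / a)\<^sup>2 * binom_gauss_ratio m j"
    using s(2) by (simp add: algebra_simps)
  moreover have "((y + 1) / a)\<^sup>2 * binom_gauss_ratio m j \<le> ((y + 1) / a)\<^sup>2 * R"
    using IH(1) by (intro mult_left_mono) auto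
  ultimately have "binom_gauss_ratio m (Suc j) \<ge> (1 - (y ^ 3 / a\<^sup>2 + ((y + 1) / a)\<^sup>2)) * R"
    using IH(2) by (simp add: algebra_simps)
  moreover have "y ^ 3 / a\<^sup>2 + ((y + 1) / a)\<^sup>2 \<le> (y + 2) ^ 3 / a\<^sup>2"
  proof -
    have "y ^ 3 + (y + 1)\<^sup>2 \<le> (y + 2) ^ 3" using y0
      by (simp add: power3_eq_cube power2_eq_square algebra_simps)
    then show ?thesis by (simp add: power_divide flip: add_divide_distrib) (auto intro: divide_right_mono)
  qed
  then have "(1 - (y ^ 3 / a\<^sup>2 + ((y + 1) / a)\<^sup>2)) * R \<ge> (1 - (y + 2) ^ 3 / a\<^sup>2) * R"
    using R0 by (intro mult_right_mono) auto
  ultimately have A: "(1 - (y + 2) ^ 3 / a\<^sup>2) * R \<le> binom_gauss_ratio m (Suc j)" by linarith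
  have e: "c + Suc i = Suc j" "2 * real (Suc j) - real m = y + 2" by (simp_all add: y_def j_def)
  show ?case unfolding e a_def[symmetric] R_def[symmetric] using A s(1) IH(1) by simp
qed

lemma binom_gauss_ratio_bounds:
  fixes m j :: nat
  defines "c \<equiv> (m + 1) div 2"
  assumes "j \<le> m"
  shows "binom_gauss_ratio m j \<le> binom_gauss_ratio m c"
   "binom_gauss_ratio m j \<ge> (1 - \<bar>2 * real j - real m\<bar> ^ 3 / (real m + 1)\<^sup>2) * binom_gauss_ratio m c"
proof -
  have *: "binom_gauss_ratio m j \<le> binom_gauss_ratio m c \<and>
   binom_gauss_ratio m j \<ge> (1 - \<bar>2 * real j - real m\<bar> ^ 3 / (real m + 1)\<^sup>2) * binom_gauss_ratio m c"
    if "j \<ge> c" "j \<le> m" for j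
  proof -
    have "2 * real j - real m \<ge> 0" using that unfolding c_def by linarith
    then show ?thesis using binom_gauss_ratio_bounds_upper_half[of m "j - c"] that by (auto simp: c_def)
  qed
  have "binom_gauss_ratio m j \<le> binom_gauss_ratio m c \<and>
   binom_gauss_ratio m j \<ge> (1 - \<bar>2 * real j - real m\<bar> ^ 3 / (real m + 1)\<^sup>2) * binom_gauss_ratio m c"
  proof (cases "j \<ge> c")
    case False
    have "binom_gauss_ratio m (m - j) = binom_gauss_ratio m j"
      using assms(2) unfolding binom_gauss_ratio_def
      by (subst binomial_symmetric[OF assms(2)]) (simp add: of_nat_diff power2_eq_square algebra_simps)
    moreover have "\<bar>2 * real (m - j) - real m\<bar> = \<bar>2 * real j - real m\<bar>" using assms(2)
      by (simp add: of_nat_diff)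
    moreover have "m - j \<ge> c" using False assms(2) unfolding c_def by linarith
    ultimately show ?thesis using *[of "m - j"] diff_le_self[of m j] by metis
  qed (use * assms in auto)
  then show "binom_gauss_ratio m j \<le> binom_gauss_ratio m c"
   "binom_gauss_ratio m j \<ge> (1 - \<bar>2 * real j - real m\<bar> ^ 3 / (real m + 1)\<^sup>2) * binom_gauss_ratio m c" by auto
qed


text \<open>
  The constant is \<open>8\<^sup>4\<close>, from \<open>1 + q \<le> 8 * exp (q / 8)\<close>.
\<close>

lemma poly4_exp_bound:
  fixes q :: real assumes "q \<ge> 0" shows "(1 + q) ^ 4 * exp (- q / 2) \<le> 4096"
proof -
  have "1 + q \<le> 8 * exp (q / 8)" using assms exp_ge_add_one_self[of "q / 8"] by linarith
  then have "(1 + q) ^ 4 \<le> (8 * exp (q / 8)) ^ 4"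
    using assms by (intro power_mono) auto
  also have "\<dots> = 4096 * exp (q / 2)" by (simp add: power_mult_distrib flip: exp_of_nat_mult)
  finally show ?thesis by (simp add: exp_minus field_simps)
qed

text \<open>
  All error terms are bounded by multiples of \<open>sqrt a / (a + y\<^sup>2)\<close>, whose integral over the line is
  \<open>\<pi>\<close> whatever \<open>a\<close> is.
\<close>

lemma gauss_kernel_bounds:
  fixes a y :: real assumes "a > 0"
  shows "\<bar>y\<bar> ^ 3 * exp (- y\<^sup>2 / (2 * a)) \<le> 4096 * a\<^sup>2 * (sqrt a / (a + y\<^sup>2))"
    and "\<bar>y\<bar> / a * exp (- y\<^sup>2 / (2 * a)) \<le> 4096 * (sqrt a / (a + y\<^sup>2))"
    and "y\<^sup>2 * exp (- y\<^sup>2 / (2 * a)) \<le> 4096 * a\<^sup>2 / (a + y\<^sup>2)"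
proof -
  define r where "r = \<bar>y\<bar> / sqrt a"
  define q where "q = r\<^sup>2"
  define e where "e = exp (- q / 2)"
  have r0: "r \<ge> 0" using assms by (simp add: r_def)
  have q0: "q \<ge> 0" by (simp add: q_def)
  have y: "\<bar>y\<bar> = r * sqrt a" using assms by (simp add: r_def)
  have y2: "y\<^sup>2 = q * a" using assms by (simp add: q_def r_def power_divide)
  have e: "exp (- y\<^sup>2 / (2 * a)) = e" using assms by (simp add: e_def y2)
  have ay: "a + y\<^sup>2 = a * (1 + q)" by (simp add: y2 algebra_simps)
  have q1: "1 + q > 0" using q0 by simp
  have e0: "e > 0" by (simp add: e_def)
  have P: "(1 + q) ^ 4 * e \<le> 4096" using poly4_exp_bound[OF q0] by (simp add: e_def)
  have rq: "r \<le> 1 + q"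
    using zero_le_power2[of "r - 1"] r0 by (simp add: q_def power2_eq_square algebra_simps)
  have B: "x * (1 + q) * e \<le> 4096" if "x \<le> (1 + q) ^ 3" for x
  proof -
    have "x * (1 + q) * e \<le> (1 + q) ^ 3 * (1 + q) * e"
      using that q0 e0 by (intro mult_right_mono) auto
    also have "\<dots> = (1 + q) ^ 4 * e" by (simp add: power_numeral_reduce)
    finally show ?thesis using P by linarith
  qed
  have sa: "sqrt a > 0" "sqrt a * sqrt a = a" using assms by auto
  have "r ^ 3 = r * q" by (simp add: q_def power3_eq_cube power2_eq_square)
  also have "\<dots> \<le> (1 + q) * (1 + q)" using rq q0 r0 by (intro mult_mono) auto
  also have "\<dots> \<le> (1 + q) * (1 + q) * (1 + q)" using q0 by (simp add: mult_le_cancel_left1)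
  finally have "r ^ 3 \<le> (1 + q) ^ 3" by (simp add: power3_eq_cube)
  from B[OF this] have "sqrt a ^ 3 * (r ^ 3 * (1 + q) * e) \<le> sqrt a ^ 3 * 4096"
    using sa by (intro mult_left_mono) auto
  moreover have "sqrt a ^ 3 = sqrt a * a" using sa by (simp add: power3_eq_cube)
  ultimately show "\<bar>y\<bar> ^ 3 * exp (- y\<^sup>2 / (2 * a)) \<le> 4096 * a\<^sup>2 * (sqrt a / (a + y\<^sup>2))"
    unfolding e ay y using assms q1
    by (simp add: power_mult_distrib power2_eq_square pos_le_divide_eq) (simp add: algebra_simps)
  have "r \<le> (1 + q) ^ 3"
    using q0 by (intro order_trans[OF rq] self_le_power) auto
  from B[OF this] have "sqrt a * (r * (1 + q) * e) \<le> sqrt a * 4096"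
    using sa by (intro mult_left_mono) auto
  then show "\<bar>y\<bar> / a * exp (- y\<^sup>2 / (2 * a)) \<le> 4096 * (sqrt a / (a + y\<^sup>2))"
    unfolding e ay y using assms q1 sa by (simp add: pos_le_divide_eq pos_divide_le_eq) (simp add: field_simps)
  have "q \<le> (1 + q) ^ 3" using q0 self_le_power[of "1 + q" 3] by simp
  from B[OF this] have "a * (q * (1 + q) * e) \<le> a * 4096" using assms by (intro mult_left_mono) auto
  then show "y\<^sup>2 * exp (- y\<^sup>2 / (2 * a)) \<le> 4096 * a\<^sup>2 / (a + y\<^sup>2)"
    unfolding e ay unfolding y2 using assms q1
    by (simp add: power2_eq_square pos_le_divide_eq) (simp add: algebra_simps)
qed

lemma kernel_shift:
  fixes a s t :: real assumes "a \<ge> 1" "\<bar>s - t\<bar> \<le> 1"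
  shows "sqrt a / (a + s\<^sup>2) \<le> 3 * (sqrt a / (a + t\<^sup>2))"
proof -
  have "(s - t)\<^sup>2 \<le> 1" using assms(2) by (simp add: abs_square_le_1)
  moreover have "t\<^sup>2 \<le> 2 * s\<^sup>2 + 2 * (s - t)\<^sup>2"
    using zero_le_power2[of "2 * s - t"] by (simp add: power2_eq_square algebra_simps)
  ultimately have "t\<^sup>2 \<le> 2 * s\<^sup>2 + 2" by linarith
  then have "a + t\<^sup>2 \<le> 3 * (a + s\<^sup>2)"
    using assms(1) zero_le_power2[of s] unfolding distrib_left by linarith
  moreover have "a + t\<^sup>2 > 0" "a + s\<^sup>2 > 0" using assms(1) by (auto intro: add_pos_nonneg)
  ultimately have "1 / (a + s\<^sup>2) \<le> 3 / (a + t\<^sup>2)" by (simp add: field_simps)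
  from mult_left_mono[OF this, of "sqrt a"] assms show ?thesis by (simp add: mult.commute)
qed

lemma gauss_lipschitz:
  fixes a y t :: real assumes "a \<ge> 1" "\<bar>y - t\<bar> \<le> 1"
  shows "\<bar>exp (- y\<^sup>2 / (2 * a)) - exp (- t\<^sup>2 / (2 * a))\<bar> \<le> 12288 * (sqrt a / (a + t\<^sup>2))"
proof -
  let ?g = "\<lambda>t::real. exp (- t\<^sup>2 / (2 * a))"
  have d: "(?g has_real_derivative (- s / a * ?g s)) (at s within S)" for s S
    using assms by (auto intro!: derivative_eq_intros simp: field_simps)
  have "\<bar>?g y - ?g t\<bar> \<le> 12288 * (sqrt a / (a + t\<^sup>2)) * \<bar>y - t\<bar>"
  proof (rule field_differentiable_bound[where S = "{min y t..max y t}" and f = ?g and f' = "\<lambda>s. - s / a * ?g s", unfolded real_norm_def])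
    fix s assume "s \<in> {min y t..max y t}"
    then have s: "\<bar>s - t\<bar> \<le> 1" using assms(2) by auto
    have "\<bar>- s / a * ?g s\<bar> = \<bar>s\<bar> / a * ?g s" using assms by (simp add: abs_mult)
    also have "\<dots> \<le> 4096 * (sqrt a / (a + s\<^sup>2))" using assms by (intro gauss_kernel_bounds) auto
    also have "\<dots> \<le> 4096 * (3 * (sqrt a / (a + t\<^sup>2)))"
      using kernel_shift[OF assms(1) s] by (intro mult_left_mono) auto
    finally show "\<bar>- s / a * ?g s\<bar> \<le> 12288 * (sqrt a / (a + t\<^sup>2))" by simp
  qed (use d in auto)
  also have "\<dots> \<le> 12288 * (sqrt a / (a + t\<^sup>2)) * 1"
    using assms by (intro mult_left_mono) auto
  finally show ?thesis by simp
qed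

lemma gauss_variance_change:
  fixes a b t :: real assumes "b > 0" "b / 2 \<le> a" "a \<le> 2 * b"
  shows "\<bar>exp (- t\<^sup>2 / (2 * a)) - exp (- t\<^sup>2 / (2 * b))\<bar> \<le> 16384 * (\<bar>a - b\<bar> / (b + t\<^sup>2))"
proof -
  have a: "a > 0" using assms by linarith
  have *: "\<bar>exp (- u) - exp (- v)\<bar> \<le> \<bar>u - v\<bar> * exp (- w)" if "w \<le> u" "w \<le> v" for u v w :: real
  proof -
    have **: "exp (- u) - exp (- v) \<le> (v - u) * exp (- w)" if "w \<le> u" "u \<le> v" for u v :: real
    proof -
      have "exp (- v) = exp (- u) * exp (u - v)" by (simp flip: exp_add)
      also have "\<dots> \<ge> exp (- u) * (1 + (u - v))" by (intro mult_left_mono exp_ge_add_one_self) auto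
      finally have "exp (- u) - exp (- v) \<le> (v - u) * exp (- u)" by (simp add: algebra_simps)
      also have "\<dots> \<le> (v - u) * exp (- w)" using that by (intro mult_left_mono) auto
      finally show ?thesis .
    qed
    show ?thesis using **[of u v] **[of v u] that by (cases "u \<le> v") auto
  qed
  define M where "M = 2 * b"
  have M: "M > 0" "a \<le> M" "b \<le> M" using assms by (auto simp: M_def)
  have "\<bar>exp (- (t\<^sup>2 / (2 * a))) - exp (- (t\<^sup>2 / (2 * b)))\<bar> \<le> \<bar>t\<^sup>2 / (2 * a) - t\<^sup>2 / (2 * b)\<bar> * exp (- (t\<^sup>2 / (2 * M)))"
    using a assms M by (intro *) (auto intro!: divide_left_mono)
  also have "t\<^sup>2 / (2 * a) - t\<^sup>2 / (2 * b) = t\<^sup>2 * (b - a) / (2 * a * b)"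
    using a assms by (simp add: field_simps)
  also have "\<bar>t\<^sup>2 * (b - a) / (2 * a * b)\<bar> = t\<^sup>2 * \<bar>a - b\<bar> / (2 * a * b)"
    using a assms by (simp add: abs_mult abs_minus_commute)
  also have "\<dots> \<le> t\<^sup>2 * \<bar>a - b\<bar> / (b * b)"
    using a assms by (intro divide_left_mono mult_right_mono) auto
  also have "t\<^sup>2 * \<bar>a - b\<bar> / (b * b) * exp (- (t\<^sup>2 / (2 * M))) = \<bar>a - b\<bar> / (b * b) * (t\<^sup>2 * exp (- t\<^sup>2 / (2 * M)))"
    by simp
  also have "\<dots> \<le> \<bar>a - b\<bar> / (b * b) * (4096 * M\<^sup>2 / (M + t\<^sup>2))"
    using M assms by (intro mult_left_mono gauss_kernel_bounds) auto
  also have "\<dots> = 16384 * (\<bar>a - b\<bar> / (M + t\<^sup>2))" using assms by (simp add: M_def power2_eq_square)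
  also have "\<dots> \<le> 16384 * (\<bar>a - b\<bar> / (b + t\<^sup>2))"
    using M assms by (intro mult_left_mono divide_left_mono mult_pos_pos add_pos_nonneg) auto
  finally show ?thesis using assms a by (simp add: mult_right_mono)
qed


text \<open>
  The step function \<open>f\<close> spreads each binomial weight in \<open>H\<close> evenly over the interval of length two
  around \<open>2 j - m\<close>. It is compared with \<open>\<kappa>\<close> times the Gaussian kernel of variance
  \<open>b\<close>, where \<open>\<kappa>\<close> makes the kernel of variance \<open>m + 1\<close> agree with the central binomial weight. The indicator function accounts for the cell that contains the end
  point \<open>t0\<close> of \<open>H\<close>. The variance \<open>b\<close> is left free because it will be the expected number of steps of
  a walk whose number of steps \<open>m\<close> is random.
\<close>

lemma binomial_gauss_pointwise:
  fixes m :: nat and b t0 t :: real and H :: "real set"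
  assumes H: "H = {..t0} \<or> H = {..<t0} \<or> H = UNIV"
  assumes b: "b > 0" "b / 2 \<le> real m + 1" "real m + 1 \<le> 2 * b"
  defines "\<kappa> \<equiv> binom_gauss_ratio m ((m + 1) div 2)"
  defines "f \<equiv> \<lambda>t. \<Sum>j\<in>{j. j \<le> m \<and> 2 * real j - real m \<in> H}.
      real (m choose j) * indicator {2 * real j - real m - 1..<2 * real j - real m + 1} t"
  shows "\<bar>f t - \<kappa> * (indicator H t * exp (- t\<^sup>2 / (2 * b)))\<bar> \<le>
     \<kappa> * (100000 * (sqrt b + \<bar>real m + 1 - b\<bar>) / (b + t\<^sup>2) + indicator {t0 - 1..t0 + 1} t)"
proof -
  define a where "a = real m + 1"
  define \<gamma> where "\<gamma> = (\<lambda>t. exp (- t\<^sup>2 / (2 * a)))"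
  have a: "a \<ge> 1" "a > 0" by (simp_all add: a_def)
  have \<kappa>0: "\<kappa> \<ge> 0" by (simp add: \<kappa>_def binom_gauss_ratio_def)
  \<comment> \<open>the index of the cell that contains \<open>t\<close>, and its centre\<close>
  define i where "i = \<lfloor>(t + a) / 2\<rfloor>"
  define y where "y = 2 * real_of_int i - real m"
  define \<beta> where "\<beta> = (if 0 \<le> i \<and> i \<le> int m then real (m choose nat i) else 0)"
  have yt: "y - 1 \<le> t" "t < y + 1"
    using of_int_floor_le[of "(t + a) / 2"] real_of_int_floor_add_one_gt[of "(t + a) / 2"]
    unfolding y_def i_def a_def by argo+
  have ft: "f t = (if y \<in> H then \<beta> else 0)"
  proof -
    have cell: "t \<in> {2 * real j - real m - 1..<2 * real j - real m + 1} \<longleftrightarrow> int j = i" for j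
    proof -
      have "int j = i \<longleftrightarrow> real j \<le> (t + a) / 2 \<and> (t + a) / 2 < real j + 1"
        unfolding i_def by (auto simp: eq_commute[of "int j"] floor_eq_iff)
      then show ?thesis unfolding a_def by auto
    qed
    have "f t = (\<Sum>j\<in>{j. j \<le> m \<and> 2 * real j - real m \<in> H}. if int j = i then \<beta> else 0)"
      unfolding f_def by (intro sum.cong refl) (auto simp: indicator_def cell \<beta>_def simp del: atLeastLessThan_iff)
    also have "\<dots> = (if y \<in> H then \<beta> else 0)"
    proof (cases "0 \<le> i \<and> i \<le> int m")
      case True
      then obtain j where j: "i = int j" "j \<le> m" using nonneg_int_cases[of i] by auto
      then show ?thesis by (auto simp: y_def)
    next
      case False
      then show ?thesis by (auto simp: \<beta>_def intro: sum.neutral)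
    qed
    finally show ?thesis .
  qed
  have \<beta>: "\<beta> \<le> \<kappa> * \<gamma> y" "\<beta> \<ge> \<kappa> * \<gamma> y - \<kappa> * (\<bar>y\<bar> ^ 3 / a\<^sup>2 * \<gamma> y)" "\<beta> \<ge> 0"
  proof -
    show "\<beta> \<ge> 0" by (simp add: \<beta>_def)
    have "\<beta> \<le> \<kappa> * \<gamma> y \<and> \<beta> \<ge> \<kappa> * \<gamma> y - \<kappa> * (\<bar>y\<bar> ^ 3 / a\<^sup>2 * \<gamma> y)"
    proof (cases "0 \<le> i \<and> i \<le> int m")
      case True
      then obtain j where j: "i = int j" "j \<le> m" using nonneg_int_cases[of i] by auto
      have yj: "y = 2 * real j - real m" by (simp add: y_def j)
      have \<beta>: "\<beta> = binom_gauss_ratio m j * \<gamma> y"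
        unfolding \<beta>_def binom_gauss_ratio_def \<gamma>_def yj a_def using j by (simp flip: exp_add)
      have "binom_gauss_ratio m j \<le> \<kappa>" "binom_gauss_ratio m j \<ge> (1 - \<bar>y\<bar> ^ 3 / a\<^sup>2) * \<kappa>"
        using binom_gauss_ratio_bounds[OF j(2)] unfolding \<kappa>_def yj a_def by auto
      then have "binom_gauss_ratio m j * \<gamma> y \<le> \<kappa> * \<gamma> y"
        "binom_gauss_ratio m j * \<gamma> y \<ge> (1 - \<bar>y\<bar> ^ 3 / a\<^sup>2) * \<kappa> * \<gamma> y"
        by (auto intro!: mult_right_mono simp: \<gamma>_def)
      then show ?thesis unfolding \<beta> by (simp add: algebra_simps)
    next
      case False
      then have "i \<le> -1 \<or> i \<ge> int m + 1" by linarith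
      then have "\<bar>y\<bar> \<ge> a" unfolding y_def a_def by linarith
      then have "a ^ 3 \<le> \<bar>y\<bar> ^ 3" using a by (intro power_mono) auto
      moreover have "a\<^sup>2 \<le> a ^ 3" using a by (intro power_increasing) auto
      ultimately have "a\<^sup>2 \<le> \<bar>y\<bar> ^ 3" by linarith
      then have "1 \<le> \<bar>y\<bar> ^ 3 / a\<^sup>2" using a by simp
      then have "1 * (\<kappa> * \<gamma> y) \<le> \<bar>y\<bar> ^ 3 / a\<^sup>2 * (\<kappa> * \<gamma> y)" using \<kappa>0
        by (intro mult_right_mono) (auto simp: \<gamma>_def)
      then show ?thesis using False \<kappa>0 by (auto simp: \<beta>_def \<gamma>_def algebra_simps)
    qed
    then show "\<beta> \<le> \<kappa> * \<gamma> y" "\<beta> \<ge> \<kappa> * \<gamma> y - \<kappa> * (\<bar>y\<bar> ^ 3 / a\<^sup>2 * \<gamma> y)" by auto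
  qed
  define g where "g = exp (- t\<^sup>2 / (2 * b))"
  have g: "0 \<le> g" "g \<le> 1" using b by (auto simp: g_def)
  have ty: "\<bar>y - t\<bar> \<le> 1" using yt by auto
  have t0: "b + t\<^sup>2 > 0" "a + t\<^sup>2 > 0" using b a by (auto intro: add_pos_nonneg)
  have sab: "sqrt a / (a + t\<^sup>2) \<le> 4 * (sqrt b / (b + t\<^sup>2))"
  proof -
    have "sqrt a \<le> sqrt (4 * b)" using b by (simp add: a_def)
    then have "sqrt a \<le> 2 * sqrt b" by (simp add: real_sqrt_mult)
    moreover have "1 / (a + t\<^sup>2) \<le> 2 / (b + t\<^sup>2)"
      using t0 b by (simp add: field_simps a_def) (smt (verit) zero_le_power2)
    ultimately have "sqrt a * (1 / (a + t\<^sup>2)) \<le> 2 * sqrt b * (2 / (b + t\<^sup>2))"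
      using t0 b by (intro mult_mono) auto
    then show ?thesis by simp
  qed
  have main: "\<bar>\<beta> - \<kappa> * g\<bar> \<le> \<kappa> * (100000 * (sqrt b + \<bar>a - b\<bar>) / (b + t\<^sup>2))"
  proof -
    have "\<bar>y\<bar> ^ 3 / a\<^sup>2 * \<gamma> y = (\<bar>y\<bar> ^ 3 * \<gamma> y) / a\<^sup>2" by simp
    also have "\<dots> \<le> (4096 * a\<^sup>2 * (sqrt a / (a + y\<^sup>2))) / a\<^sup>2"
      unfolding \<gamma>_def using a by (intro divide_right_mono gauss_kernel_bounds) auto
    also have "\<dots> = 4096 * (sqrt a / (a + y\<^sup>2))" using a by simp
    also have "\<dots> \<le> 4096 * (3 * (sqrt a / (a + t\<^sup>2)))"
      using a ty by (intro mult_left_mono kernel_shift) auto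
    finally have 1: "\<bar>y\<bar> ^ 3 / a\<^sup>2 * \<gamma> y \<le> 12288 * (sqrt a / (a + t\<^sup>2))" by simp
    have 2: "\<bar>\<gamma> y - \<gamma> t\<bar> \<le> 12288 * (sqrt a / (a + t\<^sup>2))"
      unfolding \<gamma>_def using a ty by (intro gauss_lipschitz) auto
    have 3: "\<bar>\<gamma> t - g\<bar> \<le> 16384 * (\<bar>a - b\<bar> / (b + t\<^sup>2))"
      unfolding \<gamma>_def g_def using b unfolding a_def by (intro gauss_variance_change) auto
    have "\<bar>\<beta> - \<kappa> * g\<bar> \<le> \<bar>\<beta> - \<kappa> * \<gamma> y\<bar> + \<bar>\<kappa> * (\<gamma> y - g)\<bar>" unfolding right_diff_distrib by linarith
    also have "\<bar>\<beta> - \<kappa> * \<gamma> y\<bar> \<le> \<kappa> * (\<bar>y\<bar> ^ 3 / a\<^sup>2 * \<gamma> y)" using \<beta> by linarith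
    also have "\<bar>\<kappa> * (\<gamma> y - g)\<bar> = \<kappa> * \<bar>\<gamma> y - g\<bar>" using \<kappa>0 by (simp add: abs_mult)
    finally have "\<bar>\<beta> - \<kappa> * g\<bar> \<le> \<kappa> * (\<bar>y\<bar> ^ 3 / a\<^sup>2 * \<gamma> y + \<bar>\<gamma> y - g\<bar>)"
      by (simp add: distrib_left)
    also have "\<dots> \<le> \<kappa> * (100000 * (sqrt b / (b + t\<^sup>2)) + 100000 * (\<bar>a - b\<bar> / (b + t\<^sup>2)))"
    proof (rule mult_left_mono[OF _ \<kappa>0])
      have "0 \<le> \<bar>a - b\<bar> / (b + t\<^sup>2)" "0 \<le> sqrt b / (b + t\<^sup>2)" using t0 b by auto
      then show "\<bar>y\<bar> ^ 3 / a\<^sup>2 * \<gamma> y + \<bar>\<gamma> y - g\<bar> \<le> 100000 * (sqrt b / (b + t\<^sup>2)) + 100000 * (\<bar>a - b\<bar> / (b + t\<^sup>2))"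
        using 1 2 3 sab by linarith
    qed
    finally show ?thesis by (simp add: add_divide_distrib distrib_left)
  qed
  have nn: "0 \<le> 100000 * (sqrt b + \<bar>a - b\<bar>) / (b + t\<^sup>2)" using t0 b by auto
  have "\<gamma> y \<le> 1" using a by (simp add: \<gamma>_def)
  then have "\<beta> \<le> \<kappa>" using \<beta>(1) \<kappa>0 by (meson mult_left_le order_trans)
  have "\<kappa> * g \<le> \<kappa>" using g \<kappa>0 by (simp add: mult_left_le)
  show ?thesis
  proof (cases "y \<in> H \<longleftrightarrow> t \<in> H")
    case True
    have "\<bar>f t - \<kappa> * (indicator H t * g)\<bar> \<le> \<kappa> * (100000 * (sqrt b + \<bar>a - b\<bar>) / (b + t\<^sup>2))"
      using main True nn \<kappa>0 by (auto simp: ft indicator_def)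
    also have "\<dots> \<le> \<kappa> * (100000 * (sqrt b + \<bar>a - b\<bar>) / (b + t\<^sup>2) + indicator {t0 - 1..t0 + 1} t)"
      using \<kappa>0 by (intro mult_left_mono) auto
    finally show ?thesis unfolding g_def a_def .
  next
    case False
    then have "t \<in> {t0 - 1..t0 + 1}" using H ty by auto
    moreover have "\<bar>f t - \<kappa> * (indicator H t * g)\<bar> \<le> \<kappa> * 1"
      using False \<open>\<beta> \<le> \<kappa>\<close> \<open>\<kappa> * g \<le> \<kappa>\<close> \<beta>(3) \<kappa>0 g by (auto simp: ft indicator_def)
    moreover have "\<kappa> * 1 \<le> \<kappa> * (100000 * (sqrt b + \<bar>a - b\<bar>) / (b + t\<^sup>2) + 1)"
      using \<kappa>0 nn by (intro mult_left_mono) auto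
    ultimately show ?thesis unfolding g_def a_def by simp
  qed
qed


lemma has_integral_cauchy_kernel:
  fixes b :: real assumes "b > 0"
  shows "has_bochner_integral lborel (\<lambda>t. 1 / (b + t\<^sup>2)) (pi / sqrt b)"
proof -
  have "has_bochner_integral lborel (\<lambda>x::real. inverse (1 + x^2)) pi"
    using integrable_inverse_1_plus_square LBINT_inverse_1_plus_square
    by (simp add: has_bochner_integral_iff set_integrable_def interval_lebesgue_integral_def set_lebesgue_integral_def)
  from lborel_has_bochner_integral_real_affine_iff[THEN iffD1, OF _ this, of "1 / sqrt b" 0]
  have "has_bochner_integral lborel (\<lambda>x::real. inverse (1 + (x / sqrt b)^2)) (pi * sqrt b)"
    using assms by (simp add: mult.commute)
  from has_bochner_integral_mult_right[OF this, of "1 / b"]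
  have "has_bochner_integral lborel (\<lambda>x::real. 1 / b * inverse (1 + (x / sqrt b)^2)) (1 / b * (pi * sqrt b))"
    by simp
  moreover have "1 / b * inverse (1 + (x / sqrt b)^2) = 1 / (b + x\<^sup>2)" for x
    using assms by (simp add: power_divide divide_simps)
  moreover have "1 / b * (pi * sqrt b) = pi / sqrt b" using assms
    by (simp add: divide_simps)
  ultimately show ?thesis by simp
qed

lemma prob_binomial_half:
  "measure_pmf.prob (binomial_pmf m (1/2)) A = (\<Sum>j\<in>{j. j \<le> m \<and> j \<in> A}. real (m choose j)) / 2 ^ m"
proof -
  have "measure_pmf.prob (binomial_pmf m (1/2)) A = measure_pmf.prob (binomial_pmf m (1/2)) {j. j \<le> m \<and> j \<in> A}"
    by (intro measure_prob_cong_0) (auto simp: pmf_binomial)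
  also have "\<dots> = (\<Sum>j\<in>{j. j \<le> m \<and> j \<in> A}. pmf (binomial_pmf m (1/2)) j)"
    by (intro measure_measure_pmf_finite) auto
  also have "\<dots> = (\<Sum>j\<in>{j. j \<le> m \<and> j \<in> A}. real (m choose j) / 2 ^ m)"
    by (intro sum.cong refl) (auto simp: power_one_over simp flip: power_add)
  finally show ?thesis by (simp add: sum_divide_distrib)
qed

text \<open>
  Integrating the pointwise bound over the line shows that the two sides agree up to the factor \<open>\<kappa>\<close>
  and an error of order \<open>\<kappa>\<close>. The normalisation need not be known: the case \<open>H = UNIV\<close> determines it,
  since both measures have total mass one.
\<close>

lemma binomial_normal_halfline:
  fixes m :: nat and b t0 :: real and H :: "real set"
  assumes H: "H = {..t0} \<or> H = {..<t0} \<or> H = UNIV" and b: "b > 0"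
  defines "P \<equiv> measure_pmf.prob (binomial_pmf m (1/2)) {j. 2 * real j - real m \<in> H}"
    and "Q \<equiv> measure (density lborel (normal_density 0 (sqrt b))) H"
  shows "\<bar>P - Q\<bar> \<le> 10^6 * (1 / sqrt b + \<bar>real m + 1 - b\<bar> / b)"
proof (cases "b / 2 \<le> real m + 1 \<and> real m + 1 \<le> 2 * b")
  case False
  have "0 \<le> P" "P \<le> 1" by (auto simp: P_def)
  moreover have "0 \<le> Q" "Q \<le> 1"
    using prob_space.prob_le_1[OF prob_space_normal_density[of "sqrt b" 0]] b by (auto simp: Q_def)
  ultimately have PQ: "\<bar>P - Q\<bar> \<le> 1" by linarith
  define D where "D = 1 / sqrt b + \<bar>real m + 1 - b\<bar> / b"
  have h: "1 / 2 \<le> \<bar>real m + 1 - b\<bar> / b" using False b by (simp add: field_simps) argo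
  have "0 \<le> 1 / sqrt b" using b by simp
  then have "0 + 1 / 2 \<le> D" unfolding D_def using h by (rule add_mono)
  then have D: "1 / 2 \<le> D" by simp
  then have "2 * D \<le> 10^6 * D" by (intro mult_right_mono) auto
  then have "\<bar>P - Q\<bar> \<le> 10^6 * D" using PQ D by simp
  then show ?thesis unfolding D_def .
next
  case True
  define \<kappa> where "\<kappa> = binom_gauss_ratio m ((m + 1) div 2)"
  have \<kappa>: "\<kappa> > 0" unfolding \<kappa>_def binom_gauss_ratio_def by simp
  define G where "G = (\<lambda>t. exp (- t\<^sup>2 / (2 * b)))"
  define Z where "Z = sqrt (2 * pi * b)"
  have Z: "Z > 0" using b by (simp add: Z_def)
  \<comment> \<open>the integral of the pointwise error, divided by \<open>\<kappa>\<close>\<close>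
  define \<Delta> where "\<Delta> = 100000 * (sqrt b + \<bar>real m + 1 - b\<bar>) * (pi / sqrt b) + 2"
  have \<Delta>: "\<Delta> \<ge> 0" using b by (simp add: \<Delta>_def)
  have GZ: "normal_density 0 (sqrt b) t = G t / Z" for t
    using b by (simp add: normal_density_def G_def Z_def)
  have intG: "integrable lborel (\<lambda>t. indicator A t * G t)" if "A \<in> sets borel" for A
  proof -
    have "integrable lborel (\<lambda>t. normal_density 0 (sqrt b) t * indicator A t)"
      using that b by (intro integrable_real_mult_indicator integrable_normal_density) auto
    from integrable_mult_right[OF this, of Z] show ?thesis using Z by (simp add: GZ mult.commute)
  qed
  have measQ: "measure (density lborel (normal_density 0 (sqrt b))) A = (\<integral>t. indicator A t * G t \<partial>lborel) / Z"
    if "A \<in> sets borel" for A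
  proof -
    have "measure (density lborel (normal_density 0 (sqrt b))) A = (\<integral>t. indicator A t \<partial>density lborel (normal_density 0 (sqrt b)))"
      using that by simp
    also have "\<dots> = (\<integral>t. normal_density 0 (sqrt b) t * indicator A t \<partial>lborel)"
      using that by (subst integral_density) auto
    also have "\<dots> = (\<integral>t. indicator A t * G t / Z \<partial>lborel)"
      by (intro Bochner_Integration.integral_cong) (auto simp: GZ)
    finally show ?thesis by simp
  qed
  define \<Phi> where "\<Phi> = (\<lambda>A. (\<integral>t. indicator A t * G t \<partial>lborel))"
  define S where "S = (\<lambda>A. \<Sum>j\<in>{j. j \<le> m \<and> 2 * real j - real m \<in> A}. real (m choose j))"
  have key: "\<bar>2 * S A - \<kappa> * \<Phi> A\<bar> \<le> \<kappa> * \<Delta>" if A: "A = {..t0} \<or> A = {..<t0} \<or> A = UNIV" for A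
  proof -
    have Ab: "A \<in> sets borel" using A by auto
    define f where "f = (\<lambda>t. \<Sum>j\<in>{j. j \<le> m \<and> 2 * real j - real m \<in> A}.
      real (m choose j) * indicator {2 * real j - real m - 1..<2 * real j - real m + 1} t :: real)"
    have hf: "has_bochner_integral lborel f (\<Sum>j\<in>{j. j \<le> m \<and> 2 * real j - real m \<in> A}. real (m choose j) * 2)"
      unfolding f_def
    proof (intro has_bochner_integral_sum has_bochner_integral_mult_right)
      fix j
      show "has_bochner_integral lborel (indicator {2 * real j - real m - 1..<2 * real j - real m + 1} :: real \<Rightarrow> real) 2"
        using has_bochner_integral_real_indicator[of "{2 * real j - real m - 1..<2 * real j - real m + 1}" lborel] by simp
    qed
    have "(\<Sum>j\<in>{j. j \<le> m \<and> 2 * real j - real m \<in> A}. real (m choose j) * 2) = 2 * S A"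
      by (simp add: S_def sum_distrib_left mult.commute)
    with hf have hf: "has_bochner_integral lborel f (2 * S A)" by simp
    have hG: "has_bochner_integral lborel (\<lambda>t. \<kappa> * (indicator A t * G t)) (\<kappa> * \<Phi> A)"
      unfolding \<Phi>_def using intG[OF Ab] by (intro has_bochner_integral_mult_right has_bochner_integral_integrable)
    have hE: "has_bochner_integral lborel (\<lambda>t. \<kappa> * (100000 * (sqrt b + \<bar>real m + 1 - b\<bar>) * (1 / (b + t\<^sup>2)) + indicator {t0 - 1..t0 + 1} t)) (\<kappa> * \<Delta>)"
      unfolding \<Delta>_def
    proof (intro has_bochner_integral_add has_bochner_integral_mult_right has_integral_cauchy_kernel b)
      show "has_bochner_integral lborel (indicator {t0 - 1..t0 + 1} :: real \<Rightarrow> real) 2"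
        using has_bochner_integral_real_indicator[of "{t0 - 1..t0 + 1}" lborel] by simp
    qed
    have "\<bar>2 * S A - \<kappa> * \<Phi> A\<bar> = \<bar>\<integral>t. f t - \<kappa> * (indicator A t * G t) \<partial>lborel\<bar>"
      using has_bochner_integral_integral_eq[OF has_bochner_integral_diff[OF hf hG]] by simp
    also have "\<dots> \<le> (\<integral>t. \<bar>f t - \<kappa> * (indicator A t * G t)\<bar> \<partial>lborel)"
      by (rule integral_abs_bound)
    also have "\<dots> \<le> (\<integral>t. \<kappa> * (100000 * (sqrt b + \<bar>real m + 1 - b\<bar>) * (1 / (b + t\<^sup>2)) + indicator {t0 - 1..t0 + 1} t) \<partial>lborel)"
    proof (rule integral_mono)
      show "integrable lborel (\<lambda>t. \<bar>f t - \<kappa> * (indicator A t * G t)\<bar>)"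
        using hf hG by (auto simp: has_bochner_integral_iff)
      show "integrable lborel (\<lambda>t. \<kappa> * (100000 * (sqrt b + \<bar>real m + 1 - b\<bar>) * (1 / (b + t\<^sup>2)) + indicator {t0 - 1..t0 + 1} t))"
        using hE by (simp add: has_bochner_integral_iff)
      show "\<bar>f t - \<kappa> * (indicator A t * G t)\<bar> \<le> \<kappa> * (100000 * (sqrt b + \<bar>real m + 1 - b\<bar>) * (1 / (b + t\<^sup>2)) + indicator {t0 - 1..t0 + 1} t)" for t
        using binomial_gauss_pointwise[OF A b, of m t] True unfolding f_def G_def \<kappa>_def by simp
    qed
    also have "\<dots> = \<kappa> * \<Delta>" using hE by (simp add: has_bochner_integral_iff)
    finally show ?thesis .
  qed
  have SU: "S UNIV = 2 ^ m"
  proof -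
    have "{j. j \<le> m \<and> 2 * real j - real m \<in> UNIV} = {..m}" by auto
    then have "S UNIV = real (\<Sum>j\<le>m. m choose j)" by (simp only: S_def of_nat_sum)
    also have "\<dots> = 2 ^ m" by (subst choose_row_sum) simp
    finally show ?thesis .
  qed
  have "measure (density lborel (normal_density 0 (sqrt b))) (UNIV :: real set) = 1"
    using prob_space.prob_space[OF prob_space_normal_density[of "sqrt b" 0]] b by simp
  then have \<Phi>U: "\<Phi> UNIV = Z" using measQ[of UNIV] Z by (simp add: \<Phi>_def)
  have kU: "\<bar>2 * 2 ^ m - \<kappa> * Z\<bar> \<le> \<kappa> * \<Delta>" using key[of UNIV] by (simp add: SU \<Phi>U)
  have Hb: "H \<in> sets borel" using H by auto
  have Q: "Q = \<Phi> H / Z" unfolding Q_def \<Phi>_def by (rule measQ[OF Hb])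
  have P: "P = S H / 2 ^ m" unfolding P_def S_def prob_binomial_half by simp
  have PQ: "0 \<le> P" "P \<le> 1" "0 \<le> Q" "Q \<le> 1"
    using prob_space.prob_le_1[OF prob_space_normal_density[of "sqrt b" 0]] b by (auto simp: P_def Q_def)
  have "\<bar>P - Q\<bar> \<le> 4 * \<Delta> / Z"
  proof (cases "\<Delta> \<le> Z / 2")
    case False
    then have "4 * \<Delta> / Z \<ge> 2" using Z by (simp add: field_simps)
    then show ?thesis using PQ by linarith
  next
    case small: True
    have "\<kappa> * \<Delta> \<le> \<kappa> * (Z / 2)" using small \<kappa> by simp
    with kU have up: "\<kappa> * Z \<le> 4 * 2 ^ m" by linarith
    have "2 * 2 ^ m * (P - Q) = (2 * S H - \<kappa> * \<Phi> H) - Q * (2 * 2 ^ m - \<kappa> * Z)"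
      unfolding P Q using Z by (simp add: field_simps)
    then have "\<bar>2 * 2 ^ m * (P - Q)\<bar> \<le> \<bar>2 * S H - \<kappa> * \<Phi> H\<bar> + Q * \<bar>2 * 2 ^ m - \<kappa> * Z\<bar>"
      using abs_triangle_ineq4[of "2 * S H - \<kappa> * \<Phi> H" "Q * (2 * 2 ^ m - \<kappa> * Z)"] PQ by (simp add: abs_mult)
    also have "\<dots> \<le> \<kappa> * \<Delta> + 1 * (\<kappa> * \<Delta>)"
      using key[OF H] kU PQ by (intro add_mono mult_mono) auto
    finally have "2 * 2 ^ m * \<bar>P - Q\<bar> \<le> 2 * (\<kappa> * \<Delta>)" by (simp add: abs_mult mult_ac)
    then have "Z * (2 ^ m * \<bar>P - Q\<bar>) \<le> Z * (\<kappa> * \<Delta>)" using Z by simp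
    also have "\<dots> = \<kappa> * Z * \<Delta>" by simp
    also have "\<dots> \<le> 4 * 2 ^ m * \<Delta>" using up \<Delta> by (rule mult_right_mono)
    finally have "2 ^ m * (Z * \<bar>P - Q\<bar>) \<le> 2 ^ m * (4 * \<Delta>)" by (simp add: mult_ac)
    then have "Z * \<bar>P - Q\<bar> \<le> 4 * \<Delta>" by simp
    then show ?thesis using Z by (simp add: pos_le_divide_eq mult.commute)
  qed
  also have "\<dots> \<le> 10^6 * (1 / sqrt b + \<bar>real m + 1 - b\<bar> / b)"
  proof -
    define s where "s = sqrt b"
    have s: "s > 0" "b = s * s" using b by (auto simp: s_def)
    have "2 * s \<le> Z"
      unfolding Z_def s_def using b pi_gt3 by (intro real_le_rsqrt) (auto simp: power_mult_distrib)
    then have "4 * \<Delta> / Z \<le> 4 * \<Delta> / (2 * s)" using s \<Delta> by (intro divide_left_mono) auto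
    also have "\<dots> = 200000 * pi * (1 / s + \<bar>real m + 1 - b\<bar> / b) + 4 / s"
      using s unfolding \<Delta>_def s_def[symmetric] by (simp add: field_simps)
    also have "\<dots> \<le> 200000 * 4 * (1 / s + \<bar>real m + 1 - b\<bar> / b) + 4 * (1 / s + \<bar>real m + 1 - b\<bar> / b)"
      using s pi_less_4 b by (intro add_mono mult_mono mult_right_mono) (auto simp: field_simps)
    also have "\<dots> = 800004 * (1 / s + \<bar>real m + 1 - b\<bar> / b)" by simp
    also have "\<dots> \<le> 10^6 * (1 / s + \<bar>real m + 1 - b\<bar> / b)"
      using s b by (intro mult_right_mono add_nonneg_nonneg) auto
    finally show ?thesis unfolding s_def .
  qed
  finally show ?thesis .
qed

lemma down_closed_real_cases:
  fixes H :: "real set"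
  assumes d: "\<And>s t. t \<in> H \<Longrightarrow> s \<le> t \<Longrightarrow> s \<in> H"
  shows "H = {} \<or> H = UNIV \<or> (\<exists>t0. H = {..t0} \<or> H = {..<t0})"
proof (cases "H = {} \<or> H = UNIV")
  case False
  then obtain u where u: "u \<notin> H" by auto
  have bd: "bdd_above H" using u d by (intro bdd_aboveI[of _ u]) (meson linorder_le_cases)
  have "H = {..Sup H} \<or> H = {..<Sup H}"
  proof (cases "Sup H \<in> H")
    case True
    then have "H = {..Sup H}" using d cSup_upper[OF _ bd] by auto
    then show ?thesis ..
  next
    case F: False
    have "H = {..<Sup H}"
    proof (intro set_eqI iffI)
      fix s assume "s \<in> H" then show "s \<in> {..<Sup H}"
        using cSup_upper[OF _ bd, of s] F by (cases "s = Sup H") auto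
    next
      fix s assume "s \<in> {..<Sup H}" then show "s \<in> H"
        using less_cSupD[of H s] False d by (metis lessThan_iff less_imp_le)
    qed
    then show ?thesis ..
  qed
  then show ?thesis by blast
qed blast

lemma interval_borel: "is_interval I \<Longrightarrow> I \<in> sets borel" for I :: "real set"
proof -
  assume I: "is_interval I"
  define U where "U = {t. \<exists>s\<in>I. t \<le> s}"
  define L where "L = {t\<in>U. t \<notin> I}"
  have *: "H \<in> sets borel" if "\<And>s t. t \<in> H \<Longrightarrow> s \<le> t \<Longrightarrow> s \<in> H" for H :: "real set"
    using down_closed_real_cases[of H] that by auto
  have "U \<in> sets borel" by (rule *) (auto simp: U_def intro: order_trans)
  moreover have "L \<in> sets borel"
    using I unfolding is_interval_1 by (intro *) (auto simp: L_def U_def intro: order_trans)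
  moreover have "I = U - L" by (auto simp: U_def L_def)
  ultimately show ?thesis by auto
qed

text \<open>
  An interval is the difference of two down-closed sets, and these are half-lines unless they are trivial.
\<close>

lemma binomial_normal_interval:
  fixes m :: nat and b :: real and I :: "real set"
  assumes I: "is_interval I" and b: "b > 0"
  shows "\<bar>measure_pmf.prob (binomial_pmf m (1/2)) {j. 2 * real j - real m \<in> I} -
      measure (density lborel (normal_density 0 (sqrt b))) I\<bar> \<le> 2 * 10^6 * (1 / sqrt b + \<bar>real m + 1 - b\<bar> / b)"
proof -
  define \<mu> where "\<mu> = (\<lambda>A. measure_pmf.prob (binomial_pmf m (1/2)) {j. 2 * real j - real m \<in> A})"
  define N where "N = density lborel (normal_density 0 (sqrt b))"
  interpret N: prob_space N unfolding N_def using b by (intro prob_space_normal_density) auto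
  define \<epsilon> where "\<epsilon> = 10^6 * (1 / sqrt b + \<bar>real m + 1 - b\<bar> / b)"
  have \<epsilon>0: "\<epsilon> \<ge> 0" using b by (simp add: \<epsilon>_def)
  have down: "H \<in> sets borel \<and> \<bar>\<mu> H - measure N H\<bar> \<le> \<epsilon>" if d: "\<And>s t. t \<in> H \<Longrightarrow> s \<le> t \<Longrightarrow> s \<in> H" for H
  proof -
    have "H = {} \<or> H = UNIV \<or> (\<exists>t0. H = {..t0} \<or> H = {..<t0})" by (rule down_closed_real_cases) (fact d)
    then consider "H = {}" | "H = UNIV" | t0 where "H = {..t0} \<or> H = {..<t0}" by blast
    then show ?thesis
    proof cases
      case 1 then show ?thesis using \<epsilon>0 by (simp add: \<mu>_def)
    next
      case 2 then show ?thesis using binomial_normal_halfline[of H 0 b m] b by (simp add: \<mu>_def \<epsilon>_def N_def)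
    next
      case (3 t0) then show ?thesis using binomial_normal_halfline[of H t0 b m] b
        by (auto simp: \<mu>_def \<epsilon>_def N_def)
    qed
  qed
  define U where "U = {t. \<exists>s\<in>I. t \<le> s}"
  define L where "L = {t\<in>U. t \<notin> I}"
  have U: "U \<in> sets borel \<and> \<bar>\<mu> U - measure N U\<bar> \<le> \<epsilon>"
    by (rule down) (auto simp: U_def intro: order_trans)
  have L: "L \<in> sets borel \<and> \<bar>\<mu> L - measure N L\<bar> \<le> \<epsilon>"
  proof (rule down)
    fix s t assume "t \<in> L" "s \<le> t"
    then show "s \<in> L" using I unfolding L_def U_def is_interval_1 by (auto intro: order_trans)
  qed
  have IU: "I = U - L" "L \<subseteq> U" unfolding U_def L_def by auto
  have "measure N I = measure N U - measure N L"
    unfolding IU(1) using U L IU(2) by (intro N.finite_measure_Diff) (auto simp: N_def)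
  moreover have "\<mu> I = \<mu> U - \<mu> L"
  proof -
    have "{j. 2 * real j - real m \<in> I} = {j. 2 * real j - real m \<in> U} - {j. 2 * real j - real m \<in> L}"
      unfolding IU(1) by auto
    then show ?thesis unfolding \<mu>_def using IU(2) by (simp, intro measure_pmf.finite_measure_Diff) auto
  qed
  ultimately have "\<bar>\<mu> I - measure N I\<bar> \<le> 2 * \<epsilon>" using U L by linarith
  then show ?thesis by (simp add: \<mu>_def N_def \<epsilon>_def)
qed


section \<open>Permutations along the arcs of a pseudo-random digraph\<close>

text \<open>
  Hall's theorem, by the induction of Halmos and Vaughan: if some proper nonempty subset is tight, match it and
  its complement separately; otherwise any single choice leaves Hall's condition intact.
\<close>

lemma hall_marriage:
  fixes R :: "'a \<Rightarrow> 'b set"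
  assumes "finite A" "\<And>a. a \<in> A \<Longrightarrow> finite (R a)" "\<And>U. U \<subseteq> A \<Longrightarrow> card U \<le> card (\<Union>(R ` U))"
  shows "\<exists>f. inj_on f A \<and> (\<forall>a\<in>A. f a \<in> R a)"
  using assms
proof (induction "card A" arbitrary: A R rule: less_induct)
  case less
  show ?case
  proof (cases "A = {}")
    case False
    show ?thesis
    proof (cases "\<exists>U. U \<subset> A \<and> U \<noteq> {} \<and> card U = card (\<Union>(R ` U))")
      case True
      then obtain U where U: "U \<subset> A" "U \<noteq> {}" "card U = card (\<Union>(R ` U))" by auto
      define N where "N = \<Union>(R ` U)"
      have fU: "finite U" using U less.prems(1) finite_subset by blast
      have fN: "finite N" unfolding N_def using U fU less.prems(2) by auto
      have "\<exists>f. inj_on f U \<and> (\<forall>a\<in>U. f a \<in> R a)"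
      proof (rule less.hyps)
        show "card U < card A" using U less.prems(1) by (intro psubset_card_mono)
        show "finite U" by fact
        show "finite (R a)" if "a \<in> U" for a using that U less.prems(2) by auto
        show "card V \<le> card (\<Union>(R ` V))" if "V \<subseteq> U" for V using that U less.prems(3)[of V] by auto
      qed
      then obtain f where f: "inj_on f U" "\<And>a. a \<in> U \<Longrightarrow> f a \<in> R a" by auto
      have "\<exists>g. inj_on g (A - U) \<and> (\<forall>a\<in>A - U. g a \<in> R a - N)"
      proof (rule less.hyps)
        show "card (A - U) < card A" using U less.prems(1) by (intro psubset_card_mono) auto
        fix V assume V: "V \<subseteq> A - U"
        then have fV: "finite V" using less.prems(1) finite_subset by blast
        have "card U + card V = card (U \<union> V)" using V fU fV by (subst card_Un_disjoint) auto
        also have "\<dots> \<le> card (\<Union>(R ` (U \<union> V)))" using U V by (intro less.prems(3)) auto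
        also have "\<Union>(R ` (U \<union> V)) = N \<union> \<Union>((\<lambda>a. R a - N) ` V)" unfolding N_def by auto
        also have "card \<dots> \<le> card N + card (\<Union>((\<lambda>a. R a - N) ` V))" by (rule card_Un_le)
        finally show "card V \<le> card (\<Union>((\<lambda>a. R a - N) ` V))" using U(3) unfolding N_def by linarith
      qed (use less.prems in auto)
      then obtain g where g: "inj_on g (A - U)" "\<And>a. a \<in> A - U \<Longrightarrow> g a \<in> R a - N" by auto
      define h where "h = (\<lambda>a. if a \<in> U then f a else g a)"
      have "f ` U \<inter> g ` (A - U) = {}" using f(2) g(2) unfolding N_def by fastforce
      then have "inj_on h (U \<union> (A - U))" unfolding h_def by (rule inj_on_disjoint_Un[OF f(1) g(1)])
      moreover have "U \<union> (A - U) = A" using U by auto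
      ultimately have "inj_on h A" by simp
      moreover have "\<forall>a\<in>A. h a \<in> R a" using f(2) g(2) by (auto simp: h_def)
      ultimately show ?thesis by blast
    next
      case noTight: False
      obtain a where a: "a \<in> A" using False by auto
      have "card {a} \<le> card (\<Union>(R ` {a}))" using a by (intro less.prems(3)) auto
      then have "R a \<noteq> {}" by auto
      then obtain y where y: "y \<in> R a" by auto
      have "\<exists>g. inj_on g (A - {a}) \<and> (\<forall>b\<in>A - {a}. g b \<in> R b - {y})"
      proof (rule less.hyps)
        show "card (A - {a}) < card A" using a less.prems(1) by (intro psubset_card_mono) auto
        fix V assume V: "V \<subseteq> A - {a}"
        show "card V \<le> card (\<Union>((\<lambda>b. R b - {y}) ` V))"
        proof (cases "V = {}")
          case False
          have fin: "finite (\<Union>(R ` V))" using V less.prems(1,2) by (auto intro: finite_subset)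
          have "card V < card (\<Union>(R ` V))"
          proof -
            have "V \<subset> A" using V a by auto
            then have "card V \<noteq> card (\<Union>(R ` V))" using noTight False by blast
            moreover have "card V \<le> card (\<Union>(R ` V))" using V by (intro less.prems(3)) auto
            ultimately show ?thesis by simp
          qed
          moreover have "\<Union>((\<lambda>b. R b - {y}) ` V) = \<Union>(R ` V) - {y}" by auto
          moreover have "card (\<Union>(R ` V)) - 1 \<le> card (\<Union>(R ` V) - {y})" using fin
            by (simp add: card_Diff_singleton_if)
          ultimately show ?thesis by simp
        qed simp
      qed (use less.prems in auto)
      then obtain g where g: "inj_on g (A - {a})" "\<And>b. b \<in> A - {a} \<Longrightarrow> g b \<in> R b - {y}" by auto
      have "inj_on (g(a := y)) (A - {a})" using g(1) by (auto simp: inj_on_def)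
      moreover have "y \<notin> g ` (A - {a})" using g(2) by auto
      moreover have "insert a (A - {a}) = A" using a by auto
      ultimately have "inj_on (g(a := y)) A"
        using inj_on_insert[of "g(a := y)" a "A - {a}"] by simp
      moreover have "\<forall>b\<in>A. (g(a := y)) b \<in> R b" using g(2) y by auto
      ultimately show ?thesis by blast
    qed
  qed simp
qed

text \<open>
  The cycle decomposition of a permutation, in the form of lists that \<open>has_cycle_cover\<close> uses. Cycles of
  length one and two are still possible here.
\<close>

lemma permutation_in_cycle_lists:
  assumes "finite V" "bij_betw \<pi> V V"
  shows "\<exists>C. (\<forall>vs\<in>set C. vs \<noteq> [] \<and> (\<forall>i<length vs. vs ! (Suc i mod length vs) = \<pi> (vs ! i))) \<and>
     distinct (concat C) \<and> set (concat C) = V"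
proof -
  define p where "p = (\<lambda>v. if v \<in> V then \<pi> v else v)"
  have p: "p permutes V" using assms(2) unfolding p_def
    by (intro bij_imp_permutes) (auto simp: bij_betw_def inj_on_def)
  then have perm: "permutation p" using assms(1) by (auto simp: permutation_permutes)
  have *: "\<exists>C. (\<forall>vs\<in>set C. vs \<noteq> [] \<and> (\<forall>i<length vs. vs ! (Suc i mod length vs) = p (vs ! i))) \<and>
     distinct (concat C) \<and> set (concat C) = U" if "U \<subseteq> V" "p ` U = U" for U
    using finite_subset[OF that(1) assms(1)] that
  proof (induction U rule: finite_psubset_induct)
    case (psubset U)
    show ?case
    proof (cases "U = {}")
      case True
      then show ?thesis by (intro exI[of _ "[]"]) auto
    next
      case False
      then obtain v where v: "v \<in> U" by auto
      define k where "k = least_power p v"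
      define vs where "vs = map (\<lambda>i. (p ^^ i) v) [0..<k]"
      have k: "(p ^^ k) v = v" "k > 0" using least_power_of_permutation[OF perm] by (auto simp: k_def)
      have dvs: "distinct vs" using cycle_of_permutation[OF perm, of v] by (simp add: vs_def k_def)
      have nth: "vs ! (Suc i mod length vs) = p (vs ! i)" if "i < length vs" for i
      proof (cases "Suc i = k")
        case True
        have "vs ! i = (p ^^ i) v" using that by (simp add: vs_def)
        then have "p (vs ! i) = (p ^^ Suc i) v" by simp
        then have "p (vs ! i) = v" unfolding True using k by simp
        moreover have "vs ! 0 = v" "length vs = k" using k by (simp_all add: vs_def)
        ultimately show ?thesis using True by simp
      next
        case False
        then show ?thesis using that by (simp add: vs_def)
      qed
      have it: "(p ^^ i) v \<in> U" for i using v psubset.prems(2) by (induction i) auto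
      have sub: "set vs \<subseteq> U" using it by (auto simp: vs_def)
      have vvs: "v \<in> set vs" using k by (auto simp: vs_def intro!: image_eqI[of _ _ 0])
      have "p ` set vs \<subseteq> set vs"
      proof
        fix y assume "y \<in> p ` set vs"
        then obtain i where "i < length vs" "y = p (vs ! i)" by (auto simp: in_set_conv_nth)
        then show "y \<in> set vs"
            using nth[of i] nth_mem[of "Suc i mod length vs" vs] length_pos_if_in_set[OF vvs] by simp
      qed
      then have pvs: "p ` set vs = set vs"
        using permutes_inj_on[OF p] by (intro card_subset_eq) (auto simp: card_image)
      have "p ` (U - set vs) = p ` U - p ` set vs"
        using permutes_inj[OF p] by (rule image_set_diff)
      then have "p ` (U - set vs) = U - set vs" using psubset.prems(2) pvs by simp
      moreover have "U - set vs \<subset> U" using v vvs by auto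
      ultimately obtain C where C: "\<forall>vs\<in>set C. vs \<noteq> [] \<and> (\<forall>i<length vs. vs ! (Suc i mod length vs) = p (vs ! i))"
        "distinct (concat C)" "set (concat C) = U - set vs"
        using psubset.IH[of "U - set vs"] psubset.prems(1) by blast
      show ?thesis
        using C dvs nth vvs sub by (intro exI[of _ "vs # C"]) auto
    qed
  qed
  have "p ` V = V" using p by (rule permutes_image)
  then obtain C where C: "\<forall>vs\<in>set C. vs \<noteq> [] \<and> (\<forall>i<length vs. vs ! (Suc i mod length vs) = p (vs ! i))"
     "distinct (concat C)" "set (concat C) = V" using *[of V] by auto
  have "p (vs ! i) = \<pi> (vs ! i)" if "vs \<in> set C" "i < length vs" for vs i
    using C(3) that nth_mem[of i vs] by (auto simp: p_def)
  then show ?thesis using C by (intro exI[of _ C]) auto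
qed

text \<open>
  Hall's condition for the out-neighbourhoods. Suppose that no arc runs from \<open>U\<close> to \<open>W\<close>, the set of nodes
  that are not out-neighbours of \<open>U\<close>; the claim is \<open>card U + card W \<le> card V\<close>. Let \<open>T\<close> be the set of
  types with a large share in \<open>U\<close>. By the expansion property the types in \<open>\<Gamma> T\<close> have small shares in \<open>W\<close>,
  so up to small errors \<open>U\<close> lives on \<open>T\<close> and \<open>W\<close> outside \<open>\<Gamma> T\<close>. If \<open>\<Gamma> T\<close> has many more nodes than
  \<open>T\<close>, this suffices. In the tight case there is no room for errors, but if \<open>U\<close> or \<open>W\<close> has a single node
  of a wrong type, then the neighbours of that node form a linear gap in the other set, which outweighs all
  errors; and if there is none, \<open>U\<close> and \<open>W\<close> are bounded by whole types.
\<close>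

lemma pseudo_random_permutation:
  fixes b :: "'v \<Rightarrow> 'q::finite" and arc :: "'v \<Rightarrow> 'v \<Rightarrow> bool" and adj :: "'q \<Rightarrow> 'q \<Rightarrow> bool"
    and n d \<delta> :: real
  assumes V: "finite V"
  defines "\<Gamma> \<equiv> \<lambda>T. {l. \<exists>k\<in>T. adj k l}"
  assumes outdeg: "\<And>v l. v \<in> V \<Longrightarrow> adj (b v) l \<Longrightarrow> d * n \<le> card {w \<in> V. b w = l \<and> arc v w}"
    and indeg: "\<And>v k. v \<in> V \<Longrightarrow> adj k (b v) \<Longrightarrow> d * n \<le> card {w \<in> V. b w = k \<and> arc w v}"
    and expand: "\<And>U W k l. U \<subseteq> {v\<in>V. b v = k} \<Longrightarrow> W \<subseteq> {v\<in>V. b v = l} \<Longrightarrow> adj k l \<Longrightarrow>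
        \<delta> * n \<le> card U \<Longrightarrow> \<delta> * n \<le> card W \<Longrightarrow> \<exists>u\<in>U. \<exists>w\<in>W. arc u w"
    and slack: "\<And>T. card {v\<in>V. b v \<in> T} + 2 * CARD('q) * \<delta> * n \<le> card {v\<in>V. b v \<in> \<Gamma> T} \<or>
      card {v\<in>V. b v \<in> T} \<le> card {v\<in>V. b v \<in> \<Gamma> T} \<and> (\<forall>k. k \<notin> T \<longrightarrow> (\<exists>l. adj k l \<and> l \<notin> \<Gamma> T))"
    and \<delta>: "0 \<le> \<delta>" "2 * CARD('q) * \<delta> \<le> d" "n \<ge> 0"
  shows "\<exists>\<pi>. bij_betw \<pi> V V \<and> (\<forall>v\<in>V. arc v (\<pi> v))"
proof -
  define R where "R = (\<lambda>v. {w\<in>V. arc v w})"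
  have "\<exists>f. inj_on f V \<and> (\<forall>a\<in>V. f a \<in> R a)"
  proof (rule hall_marriage[OF V])
    show "finite (R a)" for a using V by (simp add: R_def)
    fix U assume U: "U \<subseteq> V"
    define W where "W = V - \<Union>(R ` U)"
    have W: "W \<subseteq> V" by (auto simp: W_def)
    have fin: "finite U" "finite W" using U W V finite_subset by auto
    have no: "\<not> arc u w" if "u \<in> U" "w \<in> W" for u w using that U by (auto simp: W_def R_def)
    define N where "N = (\<lambda>T. card {v\<in>V. b v \<in> T})"
    define T where "T = {k. \<delta> * n \<le> card {u\<in>U. b u = k}}"
    have small: "real (card {u\<in>A. b u \<in> S}) \<le> CARD('q) * (\<delta> * n)"
      if "finite A" "\<And>k. k \<in> S \<Longrightarrow> real (card {u\<in>A. b u = k}) \<le> \<delta> * n" for A S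
    proof -
      have "{u\<in>A. b u \<in> S} = (\<Union>k\<in>S. {u\<in>A. b u = k})" by auto
      then have "card {u\<in>A. b u \<in> S} \<le> (\<Sum>k\<in>S. card {u\<in>A. b u = k})"
        by (simp add: card_UN_le)
      then have "real (card {u\<in>A. b u \<in> S}) \<le> (\<Sum>k\<in>S. real (card {u\<in>A. b u = k}))"
        unfolding of_nat_sum[symmetric] of_nat_le_iff .
      also have "\<dots> \<le> (\<Sum>k\<in>S. \<delta> * n)" by (intro sum_mono that)
      also have "\<dots> = card S * (\<delta> * n)" by simp
      also have "\<dots> \<le> CARD('q) * (\<delta> * n)" using \<delta> by (intro mult_right_mono) (auto intro: card_mono)
      finally show ?thesis .
    qed
    have split: "card A = card {u\<in>A. b u \<in> S} + card {u\<in>A. b u \<notin> S}" if "finite A" for A S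
    proof -
      have "card ({u\<in>A. b u \<in> S} \<union> {u\<in>A. b u \<notin> S}) = card {u\<in>A. b u \<in> S} + card {u\<in>A. b u \<notin> S}"
        using that by (intro card_Un_disjoint) auto
      moreover have "{u\<in>A. b u \<in> S} \<union> {u\<in>A. b u \<notin> S} = A" by auto
      ultimately show ?thesis by simp
    qed
    have Uout: "real (card {u\<in>U. b u \<notin> T}) \<le> CARD('q) * (\<delta> * n)"
      using small[OF fin(1), of "- T"] by (auto simp: T_def)
    have Win: "real (card {w\<in>W. b w \<in> \<Gamma> T}) \<le> CARD('q) * (\<delta> * n)"
    proof (rule small[OF fin(2)])
      fix l assume "l \<in> \<Gamma> T"
      then obtain k where k: "k \<in> T" "adj k l" by (auto simp: \<Gamma>_def)
      show "real (card {w\<in>W. b w = l}) \<le> \<delta> * n"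
      proof (rule ccontr)
        assume "\<not> ?thesis"
        then have "\<exists>u\<in>{u\<in>U. b u = k}. \<exists>w\<in>{w\<in>W. b w = l}. arc u w"
          using k U W by (intro expand[of _ k _ l]) (auto simp: T_def)
        then show False using no by auto
      qed
    qed
    have UT: "card {u\<in>U. b u \<in> T} \<le> N T" unfolding N_def using U V by (intro card_mono) auto
    have NV: "card {v\<in>V. b v \<notin> \<Gamma> T} + N (\<Gamma> T) = card V" using split[OF V, of "\<Gamma> T"] by (simp add: N_def)
    have WT: "card {w\<in>W. b w \<notin> \<Gamma> T} \<le> card {v\<in>V. b v \<notin> \<Gamma> T}" using W V by (intro card_mono) auto
    have cU: "card U = card {u\<in>U. b u \<in> T} + card {u\<in>U. b u \<notin> T}" by (rule split[OF fin(1)])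
    have cW: "card W = card {w\<in>W. b w \<in> \<Gamma> T} + card {w\<in>W. b w \<notin> \<Gamma> T}" by (rule split[OF fin(2)])
    have dn: "2 * CARD('q) * \<delta> * n \<le> d * n" using \<delta> by (intro mult_right_mono) auto
    have "real (card U) + real (card W) \<le> real (card V)"
    proof (cases "N T + 2 * CARD('q) * \<delta> * n \<le> N (\<Gamma> T)")
      case True
      then show ?thesis using Uout Win UT NV WT cU cW by linarith
    next
      case False
      then have tight: "N T \<le> N (\<Gamma> T)" "\<And>k. k \<notin> T \<Longrightarrow> \<exists>l. adj k l \<and> l \<notin> \<Gamma> T"
        using slack[of T] unfolding N_def by auto
      consider u where "u \<in> U" "b u \<notin> T" | w where "w \<in> W" "b w \<in> \<Gamma> T"
        | "{u\<in>U. b u \<notin> T} = {}" "{w\<in>W. b w \<in> \<Gamma> T} = {}" by blast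
      then show ?thesis
      proof cases
        case 1
        \<comment> \<open>the out-neighbours of \<open>u\<close> of type \<open>l\<close> are missing in \<open>W\<close>\<close>
        obtain l where l: "adj (b u) l" "l \<notin> \<Gamma> T" using tight(2)[OF 1(2)] by auto
        have "d * n \<le> card {w \<in> V. b w = l \<and> arc u w}" using 1 U l by (intro outdeg) auto
        moreover have "card {w\<in>W. b w \<notin> \<Gamma> T} + card {w \<in> V. b w = l \<and> arc u w} \<le> card {v\<in>V. b v \<notin> \<Gamma> T}"
          using 1 no l W V fin by (subst card_Un_disjoint[symmetric]) (auto intro!: card_mono)
        ultimately show ?thesis using Uout Win UT NV cU cW tight(1) dn by linarith
      next
        case 2
        \<comment> \<open>the in-neighbours of \<open>w\<close> of type \<open>k\<close> are missing in \<open>U\<close>\<close>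
        obtain k where k: "k \<in> T" "adj k (b w)" using 2(2) by (auto simp: \<Gamma>_def)
        have "d * n \<le> card {v \<in> V. b v = k \<and> arc v w}" using 2 W k by (intro indeg) auto
        moreover have "card {u\<in>U. b u \<in> T} + card {v \<in> V. b v = k \<and> arc v w} \<le> N T"
          unfolding N_def
          using 2 no k U V fin by (subst card_Un_disjoint[symmetric]) (auto intro!: card_mono)
        ultimately show ?thesis using Uout Win WT NV cU cW tight(1) dn by linarith
      next
        case 3
        have "card {u\<in>U. b u \<notin> T} = 0" "card {w\<in>W. b w \<in> \<Gamma> T} = 0" unfolding 3 by simp_all
        then show ?thesis using UT NV WT cU cW tight(1) by linarith
      qed
    qed
    moreover have "card W + card (\<Union>(R ` U)) = card V"
    proof -
      have "\<Union>(R ` U) \<subseteq> V" by (auto simp: R_def)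
      then show ?thesis using V unfolding W_def by (simp add: card_Diff_subset finite_subset card_mono)
    qed
    ultimately show "card U \<le> card (\<Union>(R ` U))" by linarith
  qed
  then obtain f where f: "inj_on f V" "\<forall>a\<in>V. f a \<in> R a" by auto
  then have "f ` V = V" using V by (intro endo_inj_surj) (auto simp: R_def)
  then show ?thesis using f by (intro exI[of _ f]) (auto simp: bij_betw_def R_def)
qed


section \<open>Randomly oriented random graphs are pseudo-random\<close>

text \<open>
  To each pair \<open>(i, j)\<close> with \<open>i < j\<close> belong two bits: whether the edge is present, and a fair coin
  that orients it, where \<open>True\<close> means from \<open>i\<close> to \<open>j\<close>.
\<close>

definition oriented_edges ::
  "(real \<Rightarrow> real \<Rightarrow> real) \<Rightarrow> nat \<Rightarrow> (nat \<Rightarrow> real) \<Rightarrow> (nat \<times> nat \<Rightarrow> bool \<times> bool) pmf" where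
  "oriented_edges W n r = Pi_pmf {(i, j). i < j \<and> j < n} (False, False)
     (\<lambda>(i, j). pair_pmf (bernoulli_pmf (W (r i) (r j))) (bernoulli_pmf (1/2)))"

definition has_arc :: "(nat \<times> nat \<Rightarrow> bool \<times> bool) \<Rightarrow> nat \<Rightarrow> nat \<Rightarrow> bool" where
  "has_arc h u v \<longleftrightarrow> u \<noteq> v \<and> h (min u v, max u v) = (True, u < v)"

lemma finite_pairs_below: "finite {(i, j). i < j \<and> j < (n::nat)}"
  by (rule finite_subset[of _ "{..<n} \<times> {..<n}"]) auto

lemma edges_given_eq_oriented:
  "edges_given W n r =
     map_pmf (\<lambda>h. {{i, j} | i j. i < j \<and> j < n \<and> fst (h (i, j))}) (oriented_edges W n r)"
proof -
  have "Pi_pmf {(i, j). i < j \<and> j < n} False (\<lambda>(i, j). bernoulli_pmf (W (r i) (r j))) =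
     Pi_pmf {(i, j). i < j \<and> j < n} False (\<lambda>e. map_pmf fst ((\<lambda>(i, j). pair_pmf (bernoulli_pmf (W (r i) (r j))) (bernoulli_pmf (1/2))) e))"
    by (intro Pi_pmf_cong) (auto simp: map_fst_pair_pmf)
  also have "\<dots> = map_pmf (\<lambda>h. fst \<circ> h) (oriented_edges W n r)"
    unfolding oriented_edges_def by (intro Pi_pmf_map finite_pairs_below) auto
  finally show ?thesis unfolding edges_given_def by (simp add: pmf.map_comp o_def)
qed

text \<open>
  Pairs of \<open>A\<close> are never opposite to each other, so the corresponding arcs are independent, and each of
  them is present with probability at least \<open>p / 2\<close>.
\<close>

lemma expectation_half_power_arcs:
  fixes W r n A
  assumes A: "finite A" "\<And>u v. (u, v) \<in> A \<Longrightarrow> u < n \<and> v < n \<and> u \<noteq> v \<and> (v, u) \<notin> A"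
    and W: "\<And>u v. (u, v) \<in> A \<Longrightarrow> p \<le> W (r (min u v)) (r (max u v)) \<and> W (r (min u v)) (r (max u v)) \<le> 1"
    and p: "0 \<le> p"
  shows "measure_pmf.expectation (oriented_edges W n r) (\<lambda>h. (1/2) ^ card {a\<in>A. has_arc h (fst a) (snd a)})
     \<le> exp (- p * card A / 4)"
proof -
  define E where "E = {(i, j). i < j \<and> j < (n::nat)}"
  define key where "key = (\<lambda>(u, v). (min u v, max u v) :: nat \<times> nat)"
  define c where "c = (\<lambda>e. fst e < (snd e :: nat))"
  define \<psi> where "\<psi> = (\<lambda>a s. if s = (True, c a) then 1 / 2 else (1::real))"
  define P where "P = (\<lambda>(i, j). pair_pmf (bernoulli_pmf (W (r i) (r j))) (bernoulli_pmf (1/2)))"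
  have fE: "finite E" unfolding E_def by (rule finite_pairs_below)
  have inj: "inj_on key A"
  proof (rule inj_onI)
    fix a a' assume "a \<in> A" "a' \<in> A" "key a = key a'"
    then show "a = a'" using A(2)[of "fst a" "snd a"] A(2)[of "fst a'" "snd a'"]
      by (cases a; cases a') (auto simp: key_def min_def max_def split: if_splits)
  qed
  have K: "key ` A \<subseteq> E" using A(2) by (fastforce simp: key_def E_def)
  \<comment> \<open>the factor that the unordered pair \<open>e\<close> contributes to the product\<close>
  define f where "f = (\<lambda>e s. if e \<in> key ` A then \<psi> (inv_into A key e) s else 1)"
  have pr: "(1/2) ^ card {a\<in>A. has_arc h (fst a) (snd a)} = (\<Prod>e\<in>E. f e (h e))" for h :: "nat \<times> nat \<Rightarrow> bool \<times> bool"
  proof -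
    have "(1/2) ^ card {a\<in>A. has_arc h (fst a) (snd a)} = (\<Prod>a\<in>{a\<in>A. has_arc h (fst a) (snd a)}. 1/2 :: real)"
      by simp
    also have "\<dots> = (\<Prod>a\<in>A. if has_arc h (fst a) (snd a) then 1/2 else 1)"
      using A(1) by (subst prod.inter_filter) auto
    also have "\<dots> = (\<Prod>a\<in>A. f (key a) (h (key a)))"
    proof (rule prod.cong[OF refl])
      fix a assume a: "a \<in> A"
      then have "f (key a) = \<psi> a" by (simp add: f_def inv_into_f_f[OF inj])
      then show "(if has_arc h (fst a) (snd a) then 1/2 else 1) = f (key a) (h (key a))"
        using A(2)[of "fst a" "snd a"] a by (cases a) (auto simp: \<psi>_def has_arc_def key_def c_def)
    qed
    also have "\<dots> = (\<Prod>e\<in>key ` A. f e (h e))" by (simp add: prod.reindex[OF inj])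
    also have "\<dots> = (\<Prod>e\<in>E. f e (h e))"
      using fE K by (intro prod.mono_neutral_left) (auto simp: f_def)
    finally show ?thesis .
  qed
  have fin: "finite (set_pmf (P e))" for e by (rule finite_subset[of _ UNIV]) auto
  have "measure_pmf.expectation (oriented_edges W n r) (\<lambda>h. (1/2) ^ card {a\<in>A. has_arc h (fst a) (snd a)})
    = measure_pmf.expectation (Pi_pmf E (False, False) P) (\<lambda>h. \<Prod>e\<in>E. f e (h e))"
    unfolding pr oriented_edges_def E_def P_def ..
  also have "\<dots> = (\<Prod>e\<in>E. measure_pmf.expectation (P e) (f e))"
    using fE fin by (intro expectation_prod_Pi_pmf integrable_measure_pmf_finite) (auto simp: f_def \<psi>_def)
  also have "\<dots> = (\<Prod>e\<in>key ` A. measure_pmf.expectation (P e) (f e))"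
    using fE K by (intro prod.mono_neutral_right) (auto simp: f_def)
  also have "\<dots> = (\<Prod>a\<in>A. measure_pmf.expectation (P (key a)) (f (key a)))"
    by (simp add: prod.reindex[OF inj])
  also have "\<dots> \<le> (\<Prod>a\<in>A. exp (- p / 4))"
  proof (intro prod_mono conjI)
    fix a assume a: "a \<in> A"
    obtain u v where uv: "a = (u, v)" by (cases a)
    define w where "w = W (r (min u v)) (r (max u v))"
    have w: "p \<le> w" "w \<le> 1" using W a unfolding w_def uv by auto
    have "f (key a) = \<psi> a" using a by (simp add: f_def inv_into_f_f[OF inj])
    moreover have "\<psi> a s = 1 - 1/2 * indicator {(True, c a)} s" for s by (auto simp: \<psi>_def)
    ultimately have "measure_pmf.expectation (P (key a)) (f (key a)) =
      measure_pmf.expectation (P (key a)) (\<lambda>s. 1 - 1/2 * indicator {(True, c a)} s)" by presburger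
    also have "\<dots> = 1 - 1/2 * measure_pmf.prob (P (key a)) {(True, c a)}"
      by (subst Bochner_Integration.integral_diff) (auto intro: integrable_measure_pmf_finite fin)
    also have "measure_pmf.prob (P (key a)) {(True, c a)} = w * (1 / 2)"
    proof -
      have "P (key a) = pair_pmf (bernoulli_pmf w) (bernoulli_pmf (1/2))"
        by (simp add: P_def key_def uv w_def)
      then show ?thesis using w p by (simp add: measure_pmf_single pmf_pair pmf_bernoulli_True pmf_bernoulli_half)
    qed
    finally have e: "measure_pmf.expectation (P (key a)) (f (key a)) = 1 - w / 4" by simp
    show "0 \<le> measure_pmf.expectation (P (key a)) (f (key a))" unfolding e using w by simp
    have "1 - w / 4 \<le> 1 + (- p / 4)" using w by simp
    also have "\<dots> \<le> exp (- p / 4)" by (rule exp_ge_add_one_self)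
    finally show "measure_pmf.expectation (P (key a)) (f (key a)) \<le> exp (- p / 4)" unfolding e .
  qed
  also have "\<dots> = exp (- p * card A / 4)" by (simp flip: exp_of_nat_mult)
  finally show ?thesis .
qed

text \<open>
  Markov's inequality for \<open>2\<close> to the power of minus the number of arcs.
\<close>

lemma prob_few_arcs:
  fixes W r n A and t p :: real
  assumes A: "finite A" "\<And>u v. (u, v) \<in> A \<Longrightarrow> u < n \<and> v < n \<and> u \<noteq> v \<and> (v, u) \<notin> A"
    and W: "\<And>u v. (u, v) \<in> A \<Longrightarrow> p \<le> W (r (min u v)) (r (max u v)) \<and> W (r (min u v)) (r (max u v)) \<le> 1"
    and p: "0 \<le> p" and t: "t \<ge> 0"
  shows "measure_pmf.prob (oriented_edges W n r) {h. card {a\<in>A. has_arc h (fst a) (snd a)} \<le> t}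
     \<le> exp (t - p * card A / 4)"
proof -
  let ?M = "oriented_edges W n r"
  let ?N = "\<lambda>h. card {a\<in>A. has_arc h (fst a) (snd a)}"
  have int: "integrable ?M (\<lambda>h. exp t * (1/2) ^ ?N h)"
    by (intro measure_pmf.integrable_const_bound[of _ "exp t"]) (auto simp: power_le_one)
  have "measure_pmf.prob ?M {h. ?N h \<le> t} = measure_pmf.expectation ?M (indicator {h. ?N h \<le> t})" by simp
  also have "\<dots> \<le> measure_pmf.expectation ?M (\<lambda>h. exp t * (1/2) ^ ?N h)"
  proof (rule integral_mono[OF _ int])
    show "indicator {h. ?N h \<le> t} h \<le> exp t * (1/2) ^ ?N h" for h
    proof (cases "?N h \<le> t")
      case True
      have "(2::real) \<le> exp 1" using exp_ge_add_one_self[of 1] by simp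
      then have "2 ^ ?N h \<le> (exp 1 ^ ?N h :: real)" by (intro power_mono) auto
      also have "\<dots> = exp (?N h)" by (simp flip: exp_of_nat_mult)
      also have "\<dots> \<le> exp t" using True by simp
      finally show ?thesis using True by (simp add: power_one_over field_simps)
    qed simp
  qed (auto simp: measure_pmf.emeasure_eq_measure)
  also have "\<dots> = exp t * measure_pmf.expectation ?M (\<lambda>h. (1/2) ^ ?N h)" by simp
  also have "\<dots> \<le> exp t * exp (- p * card A / 4)"
    using expectation_half_power_arcs[where A = A and W = W and r = r and n = n and p = p, OF A W p] by (intro mult_left_mono) auto
  finally show ?thesis by (simp flip: exp_add)
qed

text \<open>
  As \<open>U\<close> and \<open>U'\<close> may overlap, the pairs in \<open>U \<times> U'\<close> are split into the increasing and the decreasing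
  ones; one of the two families contains almost half of all pairs, and it contains no two opposite pairs.
\<close>

lemma prob_no_arcs_between:
  fixes p \<delta> :: real
  assumes U: "U \<subseteq> {..<n}" "U' \<subseteq> {..<n}"
    and W: "\<And>u v. u \<in> U \<Longrightarrow> v \<in> U' \<Longrightarrow> u \<noteq> v \<Longrightarrow> p \<le> W (r (min u v)) (r (max u v)) \<and> W (r (min u v)) (r (max u v)) \<le> 1"
    and p: "0 \<le> p"
    and size: "\<delta> * real n \<le> card U" "\<delta> * real n \<le> card U'" "\<delta> \<ge> 0"
  shows "measure_pmf.prob (oriented_edges W n r) {h. \<forall>u\<in>U. \<forall>v\<in>U'. \<not> has_arc h u v}
     \<le> exp (- p * (\<delta>\<^sup>2 * real n ^ 2 - real n) / 8)"
proof -
  define A1 where "A1 = {a\<in>U \<times> U'. fst a < snd a}"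
  define A2 where "A2 = {a\<in>U \<times> U'. snd a < fst a}"
  define D where "D = {a\<in>U \<times> U'. fst a = snd a}"
  have fU: "finite U" "finite U'" using U finite_subset by auto
  have fA: "finite A1" "finite A2" "finite D" using fU by (auto simp: A1_def A2_def D_def)
  have "card (A1 \<union> A2 \<union> D) \<le> card A1 + card A2 + card D"
    using card_Un_le[of "A1 \<union> A2" D] card_Un_le[of A1 A2] by linarith
  moreover have "A1 \<union> A2 \<union> D = U \<times> U'" by (auto simp: A1_def A2_def D_def)
  moreover have "card D \<le> n"
  proof -
    have "card D = card (fst ` D)" by (rule card_image[symmetric]) (auto simp: inj_on_def D_def)
    also have "\<dots> \<le> card {..<n}" using U by (intro card_mono) (auto simp: D_def)
    finally show ?thesis by simp
  qed
  ultimately have "card U * card U' \<le> card A1 + card A2 + n" by (simp add: card_cartesian_product)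
  then have "real (card U) * real (card U') \<le> real (card A1) + real (card A2) + real n"
    by (metis of_nat_add of_nat_le_iff of_nat_mult)
  moreover have "(\<delta> * real n) * (\<delta> * real n) \<le> real (card U) * real (card U')"
    using size by (intro mult_mono) auto
  ultimately have sum: "\<delta>\<^sup>2 * real n ^ 2 - real n \<le> real (card A1) + real (card A2)"
    by (simp add: power2_eq_square algebra_simps)
  have *: "measure_pmf.prob (oriented_edges W n r) {h. \<forall>u\<in>U. \<forall>v\<in>U'. \<not> has_arc h u v}
     \<le> exp (- p * (\<delta>\<^sup>2 * real n ^ 2 - real n) / 8)"
    if A: "A = A1 \<or> A = A2" and c: "real (card A) \<ge> (\<delta>\<^sup>2 * real n ^ 2 - real n) / 2" for A
  proof -
    have "measure_pmf.prob (oriented_edges W n r) {h. \<forall>u\<in>U. \<forall>v\<in>U'. \<not> has_arc h u v}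
      \<le> measure_pmf.prob (oriented_edges W n r) {h. real (card {a\<in>A. has_arc h (fst a) (snd a)}) \<le> 0}"
    proof (rule measure_pmf.finite_measure_mono)
      show "{h. \<forall>u\<in>U. \<forall>v\<in>U'. \<not> has_arc h u v} \<subseteq> {h. real (card {a\<in>A. has_arc h (fst a) (snd a)}) \<le> 0}"
      proof safe
        fix h assume "\<forall>u\<in>U. \<forall>v\<in>U'. \<not> has_arc h u v"
        then have "{a\<in>A. has_arc h (fst a) (snd a)} = {}" using A by (auto simp: A1_def A2_def)
        then show "real (card {a\<in>A. has_arc h (fst a) (snd a)}) \<le> 0" by (simp only: card.empty)
      qed
    qed simp
    also have "\<dots> \<le> exp (0 - p * card A / 4)"
    proof (rule prob_few_arcs)
      show "finite A" using A fA by auto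
      show "u < n \<and> v < n \<and> u \<noteq> v \<and> (v, u) \<notin> A" if "(u, v) \<in> A" for u v
        using that A U by (auto simp: A1_def A2_def)
      show "p \<le> W (r (min u v)) (r (max u v)) \<and> W (r (min u v)) (r (max u v)) \<le> 1" if "(u, v) \<in> A" for u v
        using that A by (intro W) (auto simp: A1_def A2_def)
    qed (use p in auto)
    also have "\<dots> \<le> exp (- p * (\<delta>\<^sup>2 * real n ^ 2 - real n) / 8)"
      using mult_left_mono[OF c p] by (simp add: algebra_simps)
    finally show ?thesis .
  qed
  have "real (card A1) \<ge> (\<delta>\<^sup>2 * real n ^ 2 - real n) / 2 \<or> real (card A2) \<ge> (\<delta>\<^sup>2 * real n ^ 2 - real n) / 2"
    using sum by argo
  then show ?thesis using * by blast
qed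

text \<open>
  All degrees into adjacent types are linear, and any two large sets of adjacent nodes are joined by an
  arc in either direction. The last clause allows \<open>U\<close> and \<open>U'\<close> of mixed types,
  so that a union bound over sets of nodes suffices.
\<close>

definition pseudo_random :: "('q \<Rightarrow> 'q \<Rightarrow> bool) \<Rightarrow> nat \<Rightarrow> (nat \<Rightarrow> 'q) \<Rightarrow> real \<Rightarrow> real \<Rightarrow> (nat \<times> nat \<Rightarrow> bool \<times> bool) \<Rightarrow> bool" where
  "pseudo_random adj n b d \<delta> h \<longleftrightarrow>
     (\<forall>v<n. \<forall>l. adj (b v) l \<longrightarrow> d * n \<le> card {w \<in> {..<n}. b w = l \<and> has_arc h v w}) \<and>
     (\<forall>v<n. \<forall>k. adj k (b v) \<longrightarrow> d * n \<le> card {w \<in> {..<n}. b w = k \<and> has_arc h w v}) \<and>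
     (\<forall>U U'. U \<subseteq> {..<n} \<longrightarrow> U' \<subseteq> {..<n} \<longrightarrow> (\<forall>u\<in>U. \<forall>v\<in>U'. adj (b u) (b v)) \<longrightarrow>
        \<delta> * n \<le> card U \<longrightarrow> \<delta> * n \<le> card U' \<longrightarrow> (\<exists>u\<in>U. \<exists>v\<in>U'. has_arc h u v))"

text \<open>
  A union bound over \<open>2 n CARD('q)\<close> degree conditions and at most \<open>4\<^sup>n\<close> pairs of sets. The latter is
  affordable because the number of potential arcs between large sets is quadratic in \<open>n\<close>.
\<close>

lemma prob_not_pseudo_random:
  fixes adj :: "'q::finite \<Rightarrow> 'q \<Rightarrow> bool" and n :: nat and b :: "nat \<Rightarrow> 'q" and p \<xi> \<delta> :: real
  assumes W: "\<And>u v. u < n \<Longrightarrow> v < n \<Longrightarrow> u \<noteq> v \<Longrightarrow> adj (b u) (b v) \<Longrightarrow>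
        p \<le> W (r (min u v)) (r (max u v)) \<and> W (r (min u v)) (r (max u v)) \<le> 1"
    and p: "0 < p" and \<delta>: "\<delta> > 0"
    and class_size: "\<And>k. \<xi> * n \<le> card (nodes_of n b k)" and \<xi>: "\<xi> > 0"
  shows "measure_pmf.prob (oriented_edges W n r) {h. \<not> pseudo_random adj n b (p * \<xi> / 8) \<delta> h}
    \<le> 2 * n * CARD('q) * exp (p / 4 - p * \<xi> / 8 * n) + 4 ^ n * exp (- p * (\<delta>\<^sup>2 * real n ^ 2 - real n) / 8)"
proof -
  let ?M = "oriented_edges W n r"
  define d where "d = p * \<xi> / 8"
  have d: "d > 0" using p \<xi> by (simp add: d_def)
  define O1 where "O1 = (\<lambda>(v, l). {h. adj (b v) l \<and> card {w \<in> {..<n}. b w = l \<and> has_arc h v w} \<le> d * n})"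
  define O2 where "O2 = (\<lambda>(v, k). {h. adj k (b v) \<and> card {w \<in> {..<n}. b w = k \<and> has_arc h w v} \<le> d * n})"
  define X where "X = {(U, U'). U \<subseteq> {..<n} \<and> U' \<subseteq> {..<n} \<and> (\<forall>u\<in>U. \<forall>v\<in>U'. adj (b u) (b v)) \<and>
        \<delta> * n \<le> card U \<and> \<delta> * n \<le> card U'}"
  define O3 where "O3 = (\<lambda>(U, U'). {h. \<forall>u\<in>U. \<forall>v\<in>U'. \<not> has_arc h u v})"
  let ?I = "{..<n} \<times> (UNIV :: 'q set)"
  have fX: "finite X" and cX: "card X \<le> 4 ^ n"
  proof -
    have X: "X \<subseteq> Pow {..<n} \<times> Pow {..<n}" by (auto simp: X_def)
    then show "finite X" by (rule finite_subset) auto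
    have "card X \<le> card (Pow {..<n} \<times> Pow {..<n})" using X by (intro card_mono) auto
    also have "\<dots> = 4 ^ n" by (simp add: card_cartesian_product card_Pow flip: power_mult_distrib)
    finally show "card X \<le> 4 ^ n" .
  qed
  have star: "measure_pmf.prob ?M {h. card {a\<in>A. has_arc h (fst a) (snd a)} \<le> d * n} \<le> exp (p / 4 - p * \<xi> / 8 * n)"
    if v: "v < n" and A: "A = {v} \<times> ((nodes_of n b l) - {v}) \<and> adj (b v) l \<or> A = ((nodes_of n b l) - {v}) \<times> {v} \<and> adj l (b v)"
    for v l A
  proof -
    have cA: "card A = card ((nodes_of n b l) - {v})"
      using A by (elim disjE conjE) (simp_all add: card_cartesian_product)
    have "card (nodes_of n b l) - 1 \<le> card ((nodes_of n b l) - {v})"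
      by (simp add: card_Diff_singleton_if)
    then have cA': "\<xi> * n - 1 \<le> card A" using class_size[of l] unfolding cA by linarith
    have "measure_pmf.prob ?M {h. card {a\<in>A. has_arc h (fst a) (snd a)} \<le> d * n} \<le> exp (d * n - p * card A / 4)"
      using A v W p d by (intro prob_few_arcs) auto
    also have "\<dots> \<le> exp (p / 4 - p * \<xi> / 8 * n)"
      using mult_left_mono[OF cA', of p] p by (simp add: d_def algebra_simps)
    finally show ?thesis .
  qed
  have b1: "measure_pmf.prob ?M (O1 i) \<le> exp (p / 4 - p * \<xi> / 8 * n)" if "i \<in> ?I" for i
  proof -
    obtain v l where i: "i = (v, l)" "v < n" using \<open>i \<in> ?I\<close> by auto
    show ?thesis
    proof (cases "adj (b v) l")
      case True
      let ?A = "{v} \<times> ((nodes_of n b l) - {v})"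
      have "O1 i \<subseteq> {h. card {a\<in>?A. has_arc h (fst a) (snd a)} \<le> d * n}"
      proof
        fix h assume h: "h \<in> O1 i"
        have "card {a\<in>?A. has_arc h (fst a) (snd a)} = card {w \<in> {..<n}. b w = l \<and> has_arc h v w}"
          by (rule bij_betw_same_card[of snd], rule bij_betwI[where g = "\<lambda>w. (v, w)"]) (auto simp: has_arc_def)
        then show "h \<in> {h. card {a\<in>?A. has_arc h (fst a) (snd a)} \<le> d * n}" using h by (simp add: O1_def i)
      qed
      then have "measure_pmf.prob ?M (O1 i) \<le> measure_pmf.prob ?M {h. card {a\<in>?A. has_arc h (fst a) (snd a)} \<le> d * n}"
        by (intro measure_pmf.finite_measure_mono) auto
      then show ?thesis using star[OF i(2), of ?A l] True by force
    qed (simp add: O1_def i)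
  qed
  have b2: "measure_pmf.prob ?M (O2 i) \<le> exp (p / 4 - p * \<xi> / 8 * n)" if "i \<in> ?I" for i
  proof -
    obtain v l where i: "i = (v, l)" "v < n" using \<open>i \<in> ?I\<close> by auto
    show ?thesis
    proof (cases "adj l (b v)")
      case True
      let ?A = "((nodes_of n b l) - {v}) \<times> {v}"
      have "O2 i \<subseteq> {h. card {a\<in>?A. has_arc h (fst a) (snd a)} \<le> d * n}"
      proof
        fix h assume h: "h \<in> O2 i"
        have "card {a\<in>?A. has_arc h (fst a) (snd a)} = card {w \<in> {..<n}. b w = l \<and> has_arc h w v}"
          by (rule bij_betw_same_card[of fst], rule bij_betwI[where g = "\<lambda>w. (w, v)"]) (auto simp: has_arc_def)
        then show "h \<in> {h. card {a\<in>?A. has_arc h (fst a) (snd a)} \<le> d * n}" using h by (simp add: O2_def i)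
      qed
      then have "measure_pmf.prob ?M (O2 i) \<le> measure_pmf.prob ?M {h. card {a\<in>?A. has_arc h (fst a) (snd a)} \<le> d * n}"
        by (intro measure_pmf.finite_measure_mono) auto
      then show ?thesis using star[OF i(2), of ?A l] True by force
    qed (simp add: O2_def i)
  qed
  have b3: "measure_pmf.prob ?M (O3 i) \<le> exp (- p * (\<delta>\<^sup>2 * real n ^ 2 - real n) / 8)" if iX: "i \<in> X" for i
  proof -
    obtain U U' where i: "i = (U, U')" by (cases i)
    have UU: "U \<subseteq> {..<n}" "U' \<subseteq> {..<n}" "\<And>u v. u \<in> U \<Longrightarrow> v \<in> U' \<Longrightarrow> adj (b u) (b v)"
        "\<delta> * n \<le> card U" "\<delta> * n \<le> card U'"
      using iX unfolding i X_def by auto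
    have "p \<le> W (r (min u v)) (r (max u v)) \<and> W (r (min u v)) (r (max u v)) \<le> 1"
      if "u \<in> U" "v \<in> U'" "u \<noteq> v" for u v
      using W[of u v] UU(1,2) UU(3)[OF that(1,2)] that by blast
    then show ?thesis unfolding i O3_def prod.case using UU p \<delta> by (intro prob_no_arcs_between) auto
  qed
  have sub: "{h. \<not> pseudo_random adj n b d \<delta> h} \<subseteq> (\<Union>i\<in>?I. O1 i) \<union> (\<Union>i\<in>?I. O2 i) \<union> (\<Union>i\<in>X. O3 i)"
  proof
    fix h assume "h \<in> {h. \<not> pseudo_random adj n b d \<delta> h}"
    then have "\<not> pseudo_random adj n b d \<delta> h" by simp
    then consider v l where "v < n" "adj (b v) l" "\<not> d * n \<le> card {w \<in> {..<n}. b w = l \<and> has_arc h v w}"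
      | v k where "v < n" "adj k (b v)" "\<not> d * n \<le> card {w \<in> {..<n}. b w = k \<and> has_arc h w v}"
      | U U' where "(U, U') \<in> X" "\<not> (\<exists>u\<in>U. \<exists>v\<in>U'. has_arc h u v)"
      unfolding pseudo_random_def X_def by blast
    then show "h \<in> (\<Union>i\<in>?I. O1 i) \<union> (\<Union>i\<in>?I. O2 i) \<union> (\<Union>i\<in>X. O3 i)"
    proof cases
      case (1 v l)
      then have "h \<in> O1 (v, l)" by (simp add: O1_def)
      then show ?thesis using 1(1) by blast
    next
      case (2 v l)
      then have "h \<in> O2 (v, l)" by (simp add: O2_def)
      then show ?thesis using 2(1) by blast
    next
      case (3 U U')
      then have "h \<in> O3 (U, U')" by (simp add: O3_def)
      then show ?thesis using 3(1) by blast
    qed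
  qed
  have un: "measure_pmf.prob ?M (\<Union>i\<in>I. B i) \<le> card I * e" if "finite I" "\<And>i. i \<in> I \<Longrightarrow> measure_pmf.prob ?M (B i) \<le> e"
    for I :: "'z set" and B and e :: real
  proof -
    have "measure_pmf.prob ?M (\<Union>i\<in>I. B i) \<le> (\<Sum>i\<in>I. measure_pmf.prob ?M (B i))"
      using that(1) by (intro measure_pmf.finite_measure_subadditive_finite) auto
    also have "\<dots> \<le> (\<Sum>i\<in>I. e)" by (intro sum_mono that)
    finally show ?thesis by simp
  qed
  define e1 where "e1 = exp (p / 4 - p * \<xi> / 8 * n)"
  define e3 where "e3 = exp (- p * (\<delta>\<^sup>2 * real n ^ 2 - real n) / 8)"
  have "measure_pmf.prob ?M {h. \<not> pseudo_random adj n b d \<delta> h} \<le>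
    measure_pmf.prob ?M ((\<Union>i\<in>?I. O1 i) \<union> (\<Union>i\<in>?I. O2 i) \<union> (\<Union>i\<in>X. O3 i))"
    by (intro measure_pmf.finite_measure_mono sub) auto
  also have "\<dots> \<le> measure_pmf.prob ?M (\<Union>i\<in>?I. O1 i) + measure_pmf.prob ?M (\<Union>i\<in>?I. O2 i) + measure_pmf.prob ?M (\<Union>i\<in>X. O3 i)"
    using measure_Un_le[of "(\<Union>i\<in>?I. O1 i) \<union> (\<Union>i\<in>?I. O2 i)" "measure_pmf ?M" "\<Union>i\<in>X. O3 i"]
      measure_Un_le[of "\<Union>i\<in>?I. O1 i" "measure_pmf ?M" "\<Union>i\<in>?I. O2 i"] by simp
  also have "\<dots> \<le> card ?I * e1 + card ?I * e1 + card X * e3"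
    unfolding e1_def e3_def using b1 b2 b3 fX by (intro add_mono un) auto
  also have "\<dots> \<le> 2 * n * CARD('q) * e1 + 4 ^ n * e3"
  proof -
    have "real (card X) \<le> 4 ^ n" using cX by (metis of_nat_le_iff of_nat_numeral of_nat_power)
    then have "card X * e3 \<le> 4 ^ n * e3" by (intro mult_right_mono) (auto simp: e3_def)
    then show ?thesis by (simp add: card_cartesian_product)
  qed
  finally show ?thesis unfolding d_def e1_def e3_def .
qed

lemma pseudo_random_whp_bound:
  fixes p \<xi> \<delta> :: real and q :: nat
  assumes "p > 0" "\<xi> > 0" "\<delta> > 0"
  shows "\<exists>c>0. \<exists>\<mu>>0. \<forall>n::nat. 2 * n * q * exp (p / 4 - p * \<xi> / 8 * n) + 4 ^ n * exp (- p * (\<delta>\<^sup>2 * real n ^ 2 - real n) / 8)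
     \<le> c * exp (- \<mu> * real n)"
proof -
  define \<alpha> where "\<alpha> = p * \<xi> / 8"
  define B where "B = p * \<delta>\<^sup>2 / 8"
  define A where "A = ln 4 + p / 8 + 1"
  have pos: "\<alpha> > 0" "B > 0" using assms by (auto simp: \<alpha>_def B_def)
  define \<mu> where "\<mu> = min (\<alpha> / 2) 1"
  define c where "c = 2 * q * exp (p / 4) * (2 / \<alpha>) + exp (A\<^sup>2 / (4 * B))"
  have "c > 0" using pos by (auto simp: c_def intro: add_nonneg_pos)
  moreover have "\<mu> > 0" using pos by (simp add: \<mu>_def)
  moreover have "2 * n * q * exp (p / 4 - p * \<xi> / 8 * n) + 4 ^ n * exp (- p * (\<delta>\<^sup>2 * real n ^ 2 - real n) / 8)
     \<le> c * exp (- \<mu> * real n)" for n :: nat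
  proof -
    have \<mu>n: "\<mu> * n \<le> \<alpha> / 2 * n" "\<mu> * n \<le> n"
      using mult_right_mono[of \<mu> "\<alpha> / 2" "real n"] mult_right_mono[of \<mu> 1 "real n"] by (simp_all add: \<mu>_def)
    have "\<alpha> * n / 2 \<le> exp (\<alpha> * n / 2)" using exp_ge_add_one_self[of "\<alpha> * n / 2"] by linarith
    then have n: "real n \<le> 2 / \<alpha> * exp (\<alpha> * n / 2)" using pos by (simp add: field_simps)
    have "2 * n * q * exp (p / 4 - p * \<xi> / 8 * n) = 2 * q * exp (p / 4) * (real n * exp (- \<alpha> * n))"
    proof -
      have "p / 4 - p * \<xi> / 8 * n = p / 4 + (- \<alpha> * n)" by (simp add: \<alpha>_def)
      then have "exp (p / 4 - p * \<xi> / 8 * n) = exp (p / 4) * exp (- \<alpha> * n)" by (simp only: exp_add)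
      then show ?thesis by (simp add: mult_ac)
    qed
    also have "\<dots> \<le> 2 * q * exp (p / 4) * (2 / \<alpha> * exp (\<alpha> * n / 2) * exp (- \<alpha> * n))"
      using n by (intro mult_left_mono mult_right_mono) auto
    also have "\<dots> = 2 * q * exp (p / 4) * (2 / \<alpha>) * exp (- (\<alpha> / 2) * n)"
      by (simp add: mult_exp_exp)
    also have "\<dots> \<le> 2 * q * exp (p / 4) * (2 / \<alpha>) * exp (- \<mu> * n)" using \<mu>n pos by (intro mult_left_mono) auto
    finally have 1: "2 * n * q * exp (p / 4 - p * \<xi> / 8 * n) \<le> 2 * q * exp (p / 4) * (2 / \<alpha>) * exp (- \<mu> * n)" .
    \<comment> \<open>completing the square: \<open>B n\<^sup>2\<close> beats \<open>A n\<close> up to a constant\<close>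
    have "0 \<le> (2 * B * n - A)\<^sup>2" by simp
    then have "4 * B * (A * n - B * n\<^sup>2) \<le> A\<^sup>2" by (simp add: power2_eq_square algebra_simps)
    then have q: "A * n - B * n\<^sup>2 \<le> A\<^sup>2 / (4 * B)" using pos by (simp add: field_simps)
    have "(4::real) ^ n = exp (ln 4 * n)" by (metis exp_ln exp_of_nat2_mult zero_less_numeral)
    then have "4 ^ n * exp (- p * (\<delta>\<^sup>2 * real n ^ 2 - real n) / 8) = exp (ln 4 * n - p * (\<delta>\<^sup>2 * real n ^ 2 - real n) / 8)"
      by (simp add: mult_exp_exp)
    also have "\<dots> = exp ((A * n - B * n\<^sup>2) + (- 1 * n))"
      by (rule arg_cong[where f = exp]) (simp add: A_def B_def field_simps)
    also have "\<dots> \<le> exp (A\<^sup>2 / (4 * B) + (- \<mu> * n))" using q \<mu>n by simp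
    also have "\<dots> = exp (A\<^sup>2 / (4 * B)) * exp (- \<mu> * n)" by (rule exp_add)
    finally have 2: "4 ^ n * exp (- p * (\<delta>\<^sup>2 * real n ^ 2 - real n) / 8) \<le> exp (A\<^sup>2 / (4 * B)) * exp (- \<mu> * n)" .
    show ?thesis using add_mono[OF 1 2] unfolding c_def distrib_right .
  qed
  ultimately show ?thesis by (intro exI conjI allI)
qed


section \<open>Cycle covers exist if the types satisfy Hall's condition\<close>

definition nbrs :: "'q set set \<Rightarrow> 'q set \<Rightarrow> 'q set" where
  "nbrs S T = {l. \<exists>k\<in>T. {k, l} \<in> S}"

text \<open>
  A fixed point is not an arc, and a cycle of length two would use an edge in both directions.
\<close>

lemma cycle_cover_of_arcs:
  assumes \<pi>: "bij_betw \<pi> {..<n} {..<n}" and has_arc: "\<And>v. v < n \<Longrightarrow> has_arc h v (\<pi> v)"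
  shows "has_cycle_cover {..<n} {{i, j} | i j. i < j \<and> j < n \<and> fst (h (i, j))}"
proof -
  let ?E = "{{i, j} | i j. i < j \<and> j < n \<and> fst (h (i, j))}"
  obtain C where C: "\<And>vs. vs \<in> set C \<Longrightarrow> vs \<noteq> [] \<and> (\<forall>i<length vs. vs ! (Suc i mod length vs) = \<pi> (vs ! i))"
    "distinct (concat C)" "set (concat C) = {..<n}"
    using permutation_in_cycle_lists[OF _ \<pi>] by auto
  have "is_cycle ?E vs" if vs: "vs \<in> set C" for vs
  proof -
    have ne: "vs \<noteq> []" and nxt: "\<And>i. i < length vs \<Longrightarrow> vs ! (Suc i mod length vs) = \<pi> (vs ! i)"
      using C(1)[OF vs] by auto
    have lt: "v < n" if "v \<in> set vs" for v using that vs C(3) by auto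
    have a: "has_arc h (vs ! i) (vs ! (Suc i mod length vs))" if "i < length vs" for i
      unfolding nxt[OF that] using that by (intro has_arc lt) auto
    have "length vs \<noteq> 0" using ne by simp
    moreover have "length vs \<noteq> 1"
    proof
      assume "length vs = 1"
      then have "has_arc h (vs ! 0) (vs ! 0)" using a[of 0] by simp
      then show False by (simp add: has_arc_def)
    qed
    moreover have "length vs \<noteq> 2"
    proof
      assume "length vs = 2"
      then have "has_arc h (vs ! 0) (vs ! 1)" "has_arc h (vs ! 1) (vs ! 0)" using a[of 0] a[of 1] by auto
      then show False by (auto simp: has_arc_def min.commute max.commute)
    qed
    ultimately have "3 \<le> length vs" by linarith
    moreover have "distinct vs" using C(2) vs by (auto simp: distinct_concat_iff)
    moreover have "{vs ! i, vs ! (Suc i mod length vs)} \<in> ?E" if i: "i < length vs" for i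
    proof -
      let ?u = "vs ! i" and ?v = "vs ! (Suc i mod length vs)"
      have "Suc i mod length vs < length vs" using i by (intro mod_less_divisor) auto
      then have uv: "?u < n" "?v < n" using i by (auto intro: lt)
      have "?u \<noteq> ?v" "h (min ?u ?v, max ?u ?v) = (True, ?u < ?v)" using a[OF i] by (auto simp: has_arc_def)
      moreover have "{?u, ?v} = {min ?u ?v, max ?u ?v}" by (auto simp: min_def max_def)
      moreover have "{x, y} \<in> ?E" if "x < y" "y < n" "fst (h (x, y))" for x y using that by blast
      from this[of "min ?u ?v" "max ?u ?v"]
      have "?u \<noteq> ?v \<Longrightarrow> h (min ?u ?v, max ?u ?v) = (True, ?u < ?v) \<Longrightarrow> {min ?u ?v, max ?u ?v} \<in> ?E"
        using uv by simp
      ultimately show ?thesis by simp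
    qed
    ultimately show ?thesis unfolding is_cycle_def by blast
  qed
  then show ?thesis using C unfolding has_cycle_cover_def by blast
qed

text \<open>
  The constants are chosen from the slack of the inequalities for \<open>x\<close>: \<open>\<gamma>\<close> is a lower bound for the positive
  values of \<open>x(\<Gamma> T) - x(T)\<close>, and \<open>d n\<close> is a lower bound for the degrees. Then \<open>\<delta>\<close> and \<open>\<epsilon>\<close> are so small that all
  errors in \<open>pseudo_random_permutation\<close> stay below \<open>\<gamma> n\<close> and \<open>d n\<close>.
\<close>

lemma cycle_cover_whp_of_types:
  fixes S :: "'q::finite set set" and x :: "'q \<Rightarrow> real" and p :: real
  assumes p: "p > 0" and x: "\<And>k. x k > 0" and hall: "\<And>T. sum x T \<le> sum x (nbrs S T)"
  shows "\<exists>\<epsilon>>0. \<exists>c>0. \<exists>\<mu>>0. \<forall>n W r b.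
     (\<forall>u v. u < v \<and> v < n \<and> {b u, b v} \<in> S \<longrightarrow> p \<le> W (r u) (r v) \<and> W (r u) (r v) \<le> 1) \<longrightarrow>
     (\<forall>k. \<bar>real (card (nodes_of n b k)) - n * x k\<bar> \<le> \<epsilon> * n) \<longrightarrow>
     (\<forall>T. sum x T = sum x (nbrs S T) \<longrightarrow> card {v\<in>{..<n}. b v \<in> T} \<le> card {v\<in>{..<n}. b v \<in> nbrs S T}) \<longrightarrow>
     measure_pmf.prob (edges_given W n r) {E. \<not> has_cycle_cover {..<n} E} \<le> c * exp (- \<mu> * real n)"
proof -
  define q where "q = real (CARD('q))"
  have q: "q \<ge> 1" unfolding q_def by (simp add: Suc_leI)
  \<comment> \<open>each type has at least \<open>\<xi> n\<close> nodes if the counts are close to \<open>n x\<close>\<close>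
  define \<xi> where "\<xi> = Min (range x) / 2"
  have \<xi>: "\<xi> > 0" "\<And>k. 2 * \<xi> \<le> x k" using x by (auto simp: \<xi>_def)
  define d where "d = p * \<xi> / 8"
  have d: "d > 0" using p \<xi> by (simp add: d_def)
  define gaps where "gaps = insert 1 ((\<lambda>T. sum x (nbrs S T) - sum x T) ` {T. sum x T < sum x (nbrs S T)})"
  define \<gamma> where "\<gamma> = Min gaps"
  have fin: "finite gaps" by (simp add: gaps_def)
  have \<gamma>: "\<gamma> > 0" unfolding \<gamma>_def using fin by (subst Min_gr_iff) (auto simp: gaps_def)
  have gap: "\<gamma> \<le> sum x (nbrs S T) - sum x T" if "sum x T < sum x (nbrs S T)" for T
    unfolding \<gamma>_def using fin that by (intro Min_le) (auto simp: gaps_def)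
  define \<delta> where "\<delta> = min (d / (2 * q)) (\<gamma> / (4 * q))"
  define \<epsilon> where "\<epsilon> = min \<xi> (\<gamma> / (4 * q))"
  have \<delta>: "\<delta> > 0" "\<delta> \<le> d / (2 * q)" "\<delta> \<le> \<gamma> / (4 * q)" using d q \<gamma> by (auto simp: \<delta>_def)
  have \<epsilon>: "\<epsilon> > 0" "\<epsilon> \<le> \<xi>" "\<epsilon> \<le> \<gamma> / (4 * q)" using \<xi> q \<gamma> by (auto simp: \<epsilon>_def)
  have q\<delta>: "2 * q * \<delta> \<le> d" "4 * q * \<delta> \<le> \<gamma>" using \<delta> q by (simp_all add: field_simps)
  have q\<epsilon>: "4 * q * \<epsilon> \<le> \<gamma>" using \<epsilon> q by (simp add: field_simps)
  obtain c \<mu> where c: "c > 0" "\<mu> > 0" and bound: "\<And>n::nat. 2 * n * CARD('q) * exp (p / 4 - p * \<xi> / 8 * n)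
      + 4 ^ n * exp (- p * (\<delta>\<^sup>2 * real n ^ 2 - real n) / 8) \<le> c * exp (- \<mu> * real n)"
    using pseudo_random_whp_bound[OF p \<xi>(1) \<delta>(1), of "CARD('q)"] by blast
  define adj where "adj = (\<lambda>k l. {k, l} \<in> S)"
  have nbrs: "nbrs S T = {l. \<exists>k\<in>T. adj k l}" for T by (simp add: nbrs_def adj_def)
  have main: "measure_pmf.prob (edges_given W n r) {E. \<not> has_cycle_cover {..<n} E} \<le> c * exp (- \<mu> * real n)"
    if W: "\<forall>u v. u < v \<and> v < n \<and> {b u, b v} \<in> S \<longrightarrow> p \<le> W (r u) (r v) \<and> W (r u) (r v) \<le> 1"
    and close: "\<forall>k. \<bar>real (card (nodes_of n b k)) - n * x k\<bar> \<le> \<epsilon> * n"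
    and tight: "\<forall>T. sum x T = sum x (nbrs S T) \<longrightarrow> card {v\<in>{..<n}. b v \<in> T} \<le> card {v\<in>{..<n}. b v \<in> nbrs S T}"
    for n W r b
  proof -
    have W': "p \<le> W (r (min u v)) (r (max u v)) \<and> W (r (min u v)) (r (max u v)) \<le> 1"
      if "u < n" "v < n" "u \<noteq> v" "adj (b u) (b v)" for u v
    proof (cases "u < v")
      case True then show ?thesis using W that by (auto simp: adj_def)
    next
      case False
      then have "{b v, b u} \<in> S" "v < u" using that by (auto simp: adj_def insert_commute)
      then show ?thesis using W that by auto
    qed
    have size: "\<xi> * n \<le> card (nodes_of n b k)" for k
    proof -
      have "\<epsilon> * n \<le> \<xi> * n" "2 * \<xi> * n \<le> x k * n" using \<epsilon>(2) \<xi>(2)[of k] by (intro mult_right_mono; simp)+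
      then have "\<epsilon> * n \<le> \<xi> * n" "2 * (\<xi> * n) \<le> n * x k" by (simp_all add: mult_ac)
      then show ?thesis using close[rule_format, of k] by linarith
    qed
    have count: "\<bar>real (card {v\<in>{..<n}. b v \<in> T}) - n * sum x T\<bar> \<le> q * \<epsilon> * n" for T
    proof -
      have "{v\<in>{..<n}. b v \<in> T} = (\<Union>k\<in>T. (nodes_of n b k))" by auto
      then have "card {v\<in>{..<n}. b v \<in> T} = (\<Sum>k\<in>T. card (nodes_of n b k))"
        by (simp only:) (subst card_UN_disjoint, auto)
      then have "\<bar>real (card {v\<in>{..<n}. b v \<in> T}) - n * sum x T\<bar> = \<bar>\<Sum>k\<in>T. real (card (nodes_of n b k)) - n * x k\<bar>"
        by (simp add: sum_subtractf sum_distrib_left)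
      also have "\<dots> \<le> (\<Sum>k\<in>T. \<bar>real (card (nodes_of n b k)) - n * x k\<bar>)" by (rule sum_abs)
      also have "\<dots> \<le> (\<Sum>k\<in>T. \<epsilon> * n)" using close by (intro sum_mono) auto
      also have "\<dots> = card T * (\<epsilon> * n)" by simp
      also have "\<dots> \<le> q * (\<epsilon> * n)" unfolding q_def using \<epsilon> by (intro mult_right_mono) (auto intro: card_mono)
      finally show ?thesis by simp
    qed
    have slack: "card {v\<in>{..<n}. b v \<in> T} + 2 * CARD('q) * \<delta> * n \<le> card {v\<in>{..<n}. b v \<in> {l. \<exists>k\<in>T. adj k l}} \<or>
      card {v\<in>{..<n}. b v \<in> T} \<le> card {v\<in>{..<n}. b v \<in> {l. \<exists>k\<in>T. adj k l}} \<and> (\<forall>k. k \<notin> T \<longrightarrow> (\<exists>l. adj k l \<and> l \<notin> {l. \<exists>k\<in>T. adj k l}))"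
      for T
    proof (cases "sum x T < sum x (nbrs S T)")
      case True
      have "n * \<gamma> \<le> n * (sum x (nbrs S T) - sum x T)" using gap[OF True] by (intro mult_left_mono) auto
      moreover have "4 * q * \<delta> * n \<le> \<gamma> * n" "4 * q * \<epsilon> * n \<le> \<gamma> * n" using q\<delta> q\<epsilon> by (intro mult_right_mono; simp)+
      ultimately have "card {v\<in>{..<n}. b v \<in> T} + 2 * q * \<delta> * n \<le> card {v\<in>{..<n}. b v \<in> nbrs S T}"
        using count[of T] count[of "nbrs S T"] by (simp add: algebra_simps abs_le_iff)
      then show ?thesis unfolding nbrs q_def by simp
    next
      case False
      then have eq: "sum x T = sum x (nbrs S T)" using hall[of T] by simp
      have "\<exists>l. adj k l \<and> l \<notin> nbrs S T" if k: "k \<notin> T" for k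
      proof (rule ccontr)
        assume "\<not> ?thesis"
        \<comment> \<open>adding \<open>k\<close> to the tight set \<open>T\<close> would violate the inequality for \<open>x\<close>\<close>
        then have "nbrs S (insert k T) = nbrs S T" by (auto simp: nbrs)
        then have "sum x (insert k T) \<le> sum x T" using hall[of "insert k T"] eq by simp
        then show False using k x[of k] by simp
      qed
      then show ?thesis using tight eq unfolding nbrs by blast
    qed
    have "measure_pmf.prob (edges_given W n r) {E. \<not> has_cycle_cover {..<n} E} =
      measure_pmf.prob (oriented_edges W n r) {h. \<not> has_cycle_cover {..<n} {{i, j} | i j. i < j \<and> j < n \<and> fst (h (i, j))}}"
      unfolding edges_given_eq_oriented by (simp add: vimage_def)
    also have "\<dots> \<le> measure_pmf.prob (oriented_edges W n r) {h. \<not> pseudo_random adj n b d \<delta> h}"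
    proof (intro measure_pmf.finite_measure_mono subsetI CollectI notI)
      fix h assume h: "h \<in> {h. \<not> has_cycle_cover {..<n} {{i, j} | i j. i < j \<and> j < n \<and> fst (h (i, j))}}"
        and pr: "pseudo_random adj n b d \<delta> h"
      have "\<exists>\<pi>. bij_betw \<pi> {..<n} {..<n} \<and> (\<forall>v\<in>{..<n}. has_arc h v (\<pi> v))"
      proof (rule pseudo_random_permutation[where b = b and adj = adj and n = n and d = d and \<delta> = \<delta>])
        show "d * real n \<le> card {w \<in> {..<n}. b w = l \<and> has_arc h v w}" if "v \<in> {..<n}" "adj (b v) l" for v l
          using pr that unfolding pseudo_random_def by blast
        show "d * real n \<le> card {w \<in> {..<n}. b w = k \<and> has_arc h w v}" if "v \<in> {..<n}" "adj k (b v)" for v k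
          using pr that unfolding pseudo_random_def by blast
        show "\<exists>u\<in>U. \<exists>w\<in>U'. has_arc h u w" if "U \<subseteq> (nodes_of n b k)" "U' \<subseteq> (nodes_of n b l)" "adj k l"
          "\<delta> * real n \<le> card U" "\<delta> * real n \<le> card U'" for U U' k l
        proof -
          have "U \<subseteq> {..<n}" "U' \<subseteq> {..<n}" "\<forall>u\<in>U. \<forall>v\<in>U'. adj (b u) (b v)" using that by auto
          then show ?thesis using pr that(4,5) unfolding pseudo_random_def by blast
        qed
        show "2 * CARD('q) * \<delta> \<le> d" using q\<delta> unfolding q_def by simp
      qed (use \<delta> slack in auto)
      then show False using h cycle_cover_of_arcs[of _ n h] by blast
    qed simp
    also have "\<dots> \<le> 2 * n * CARD('q) * exp (p / 4 - p * \<xi> / 8 * n) + 4 ^ n * exp (- p * (\<delta>\<^sup>2 * real n ^ 2 - real n) / 8)"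
      unfolding d_def using W' p \<delta> size \<xi> by (intro prob_not_pseudo_random) auto
    also have "\<dots> \<le> c * exp (- \<mu> * real n)" by (rule bound)
    finally show ?thesis .
  qed
  show ?thesis
    by (intro exI[of _ \<epsilon>] exI[of _ c] exI[of _ \<mu>] conjI allI impI)
      (rule \<epsilon>(1) | rule c | (rule main; assumption))+
qed


section \<open>The edge cone and the skeleton graph\<close>

lemma inner_edge_vector: "inner a (edge_vector {k, l}) = (a $ k + a $ l) / 2"
  by (simp add: edge_vector_doubleton inner_axis inner_add_right)

lemma edge_cone_add: "u \<in> edge_cone S \<Longrightarrow> v \<in> edge_cone S \<Longrightarrow> u + v \<in> edge_cone S"
proof -
  assume "u \<in> edge_cone S" "v \<in> edge_cone S"
  then obtain c d where "\<forall>f\<in>S. c f \<ge> 0" "u = (\<Sum>f\<in>S. c f *\<^sub>R edge_vector f)"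
    "\<forall>f\<in>S. d f \<ge> 0" "v = (\<Sum>f\<in>S. d f *\<^sub>R edge_vector f)"
    unfolding edge_cone_def by auto
  then show ?thesis unfolding edge_cone_def
    by (intro CollectI exI[of _ "\<lambda>f. c f + d f"]) (auto simp: scaleR_add_left sum.distrib)
qed

lemma edge_cone_scale: "u \<in> edge_cone S \<Longrightarrow> t \<ge> 0 \<Longrightarrow> t *\<^sub>R u \<in> edge_cone S"
proof -
  assume t: "t \<ge> 0" and "u \<in> edge_cone S"
  then obtain c where "\<forall>f\<in>S. c f \<ge> 0" "u = (\<Sum>f\<in>S. c f *\<^sub>R edge_vector f)"
    unfolding edge_cone_def by auto
  then show ?thesis unfolding edge_cone_def using t
    by (intro CollectI exI[of _ "\<lambda>f. t * c f"]) (auto simp: scaleR_sum_right)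
qed

lemma zero_in_edge_cone: "0 \<in> edge_cone S"
  unfolding edge_cone_def by (intro CollectI exI[of _ "\<lambda>_. 0"]) auto

lemma edge_cone_sum: "(\<And>i. i \<in> I \<Longrightarrow> u i \<in> edge_cone S) \<Longrightarrow> (\<Sum>i\<in>I. u i) \<in> edge_cone S"
  by (induction I rule: infinite_finite_induct) (auto intro: zero_in_edge_cone edge_cone_add)

lemma edge_vector_in_edge_cone: "f \<in> S \<Longrightarrow> edge_vector f \<in> edge_cone S"
proof -
  assume f: "f \<in> S"
  have "(\<Sum>g\<in>S. (if g = f then 1 else 0) *\<^sub>R edge_vector g) = (\<Sum>g\<in>S. if g = f then edge_vector g else 0)"
    by (intro sum.cong) auto
  then have "(\<Sum>g\<in>S. (if g = f then 1 else 0) *\<^sub>R edge_vector g) = edge_vector f"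
    using f by (simp add: sum.delta)
  then show ?thesis unfolding edge_cone_def
    by (intro CollectI exI[of _ "\<lambda>g. if g = f then 1 else 0"]) auto
qed

lemma convex_edge_cone: "convex (edge_cone S)"
  by (auto simp: convex_def intro!: edge_cone_add edge_cone_scale)

lemma convex_cone_edge_cone: "convex_cone (edge_cone S)"
  unfolding convex_cone_def cone_def using zero_in_edge_cone[of S] edge_cone_scale[of _ S]
  by (auto simp: convex_edge_cone conic_def)

text \<open>
  The edge cone is the convex cone hull of finitely many vectors.
\<close>

lemma closed_edge_cone: "closed (edge_cone (S :: 'q::{finite,linorder} set set))"
proof -
  have "edge_cone S = convex_cone hull (edge_vector ` S)"
  proof (rule antisym)
    show "convex_cone hull (edge_vector ` S) \<subseteq> edge_cone S"
      by (intro hull_minimal convex_cone_edge_cone) (auto intro: edge_vector_in_edge_cone)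
    show "edge_cone S \<subseteq> convex_cone hull (edge_vector ` S)"
    proof
      fix u assume "u \<in> edge_cone S"
      then obtain c where c: "\<forall>f\<in>S. c f \<ge> 0" "u = (\<Sum>f\<in>S. c f *\<^sub>R edge_vector f)"
        unfolding edge_cone_def by auto
      have cc: "convex_cone (convex_cone hull (edge_vector ` S))" by (rule convex_cone_convex_cone_hull)
      have "(\<Sum>f\<in>F. c f *\<^sub>R edge_vector f) \<in> convex_cone hull (edge_vector ` S)" if "F \<subseteq> S" for F
        using finite[of F] that
      proof (induction F rule: finite_induct)
        case empty
        then show ?case using cc by (simp add: convex_cone_contains_0)
      next
        case (insert f F)
        have "c f *\<^sub>R edge_vector f \<in> convex_cone hull (edge_vector ` S)"
          using c insert.prems cc by (intro convex_cone_scaleR) (auto intro: hull_inc)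
        then show ?case using insert cc by (auto intro: convex_cone_add)
      qed
      then show "u \<in> convex_cone hull (edge_vector ` S)" using c by blast
    qed
  qed
  then show ?thesis by (simp add: closed_convex_cone_hull)
qed

lemma edge_cone_functional_nonneg:
  fixes a :: "real ^ 'q::{finite,linorder}"
  assumes S: "\<forall>f\<in>S. \<exists>k l. f = {k, l}" and a: "\<And>k l. {k, l} \<in> S \<Longrightarrow> a $ k + a $ l \<ge> 0"
    and y: "y \<in> edge_cone S"
  shows "inner a y \<ge> 0"
proof -
  obtain c where c: "\<forall>f\<in>S. c f \<ge> 0" "y = (\<Sum>f\<in>S. c f *\<^sub>R edge_vector f)"
    using y unfolding edge_cone_def by auto
  have "inner a (edge_vector f) \<ge> 0" if fS: "f \<in> S" for f
  proof -
    obtain k l where f: "f = {k, l}" using S fS by blast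
    then have "a $ k + a $ l \<ge> 0" using a[of k l] fS by simp
    then show ?thesis unfolding f inner_edge_vector by simp
  qed
  then show ?thesis unfolding c(2) inner_sum_right using c(1) by (auto intro!: sum_nonneg)
qed

text \<open>
  The functional \<open>y \<mapsto> y(\<Gamma> T) - y(T)\<close>. It is nonnegative on edge vectors, because an edge with an end point
  in \<open>T\<close> has its other end point in \<open>\<Gamma> T\<close>.
\<close>

definition hall_functional :: "'q::finite set set \<Rightarrow> 'q set \<Rightarrow> real ^ 'q" where
  "hall_functional S T = (\<chi> k. indicator (nbrs S T) k - indicator T k)"

lemma hall_functional_edge:
  "{k, l} \<in> S \<Longrightarrow> hall_functional S T $ k + hall_functional S T $ l \<ge> 0"
proof -
  assume e: "{k, l} \<in> S"
  then have "{l, k} \<in> S" by (simp add: insert_commute)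
  then show ?thesis using e by (auto simp: hall_functional_def indicator_def nbrs_def)
qed

lemma inner_hall_functional:
  fixes y :: "real ^ 'q::finite"
  shows "inner (hall_functional S T) y = (\<Sum>k\<in>nbrs S T. y $ k) - (\<Sum>k\<in>T. y $ k)"
proof -
  have "inner (hall_functional S T) y = (\<Sum>k\<in>UNIV. indicator (nbrs S T) k * y $ k) - (\<Sum>k\<in>UNIV. indicator T k * y $ k)"
    by (simp add: inner_vec_def hall_functional_def left_diff_distrib sum_subtractf)
  then show ?thesis by (simp add: indicator_def if_distrib[of "\<lambda>z. z * _"] sum.If_cases)
qed

definition type_counts :: "nat \<Rightarrow> (nat \<Rightarrow> 'q::finite) \<Rightarrow> real ^ 'q" where
  "type_counts n b = (\<chi> k. real (card (nodes_of n b k)))"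

lemma type_counts_eq_sum: "type_counts n b = (\<Sum>v<n. axis (b v) 1)"
proof -
  have "real (card (nodes_of n b k)) = (\<Sum>v<n. axis (b v) 1 $ k)" for k
  proof -
    have "(\<Sum>v<n. axis (b v) (1::real) $ k) = (\<Sum>v<n. if b v = k then 1 else 0)"
      by (intro sum.cong) (auto simp: axis_def)
    also have "\<dots> = real (card (nodes_of n b k))" by (simp add: sum.If_cases Int_def)
    finally show ?thesis ..
  qed
  then show ?thesis by (simp add: type_counts_def vec_eq_iff)
qed

lemma inner_type_counts: "inner a (type_counts n b) = (\<Sum>v<n. a $ b v)"
  by (simp add: type_counts_eq_sum inner_sum_right inner_axis)

lemma sum_type_counts: "(\<Sum>k\<in>T. type_counts n b $ k) = real (card {v\<in>{..<n}. b v \<in> T})"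
proof -
  have "{v\<in>{..<n}. b v \<in> T} = (\<Union>k\<in>T. (nodes_of n b k))" by auto
  then have "card {v\<in>{..<n}. b v \<in> T} = (\<Sum>k\<in>T. card (nodes_of n b k))"
    by (simp only:) (subst card_UN_disjoint, auto)
  then show ?thesis by (simp add: type_counts_def)
qed

text \<open>
  Along a cycle each node is an end point of two edges, so the sum of the unit vectors of its nodes is the sum
  of the edge vectors of its edges.
\<close>

lemma type_counts_in_edge_cone:
  fixes b :: "nat \<Rightarrow> 'q::{finite,linorder}"
  assumes cover: "has_cycle_cover {..<n} E" and E: "\<And>u v. {u, v} \<in> E \<Longrightarrow> {b u, b v} \<in> S"
  shows "type_counts n b \<in> edge_cone S"
proof -
  obtain C where C: "\<And>vs. vs \<in> set C \<Longrightarrow> is_cycle E vs" "distinct (concat C)" "set (concat C) = {..<n}"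
    using cover unfolding has_cycle_cover_def by auto
  let ?x = "\<lambda>v. axis (b v) (1::real)"
  have cyc: "(\<Sum>v\<leftarrow>vs. ?x v) \<in> edge_cone S" if "vs \<in> set C" for vs
  proof -
    define L where "L = length vs"
    \<comment> \<open>the successor along the cycle\<close>
    define s where "s = (\<lambda>i. Suc i mod L)"
    have L: "L \<ge> 3" and e: "\<And>i. i < L \<Longrightarrow> {vs ! i, vs ! s i} \<in> E"
      using C(1)[OF that] unfolding is_cycle_def L_def s_def by auto
    have "s ` {..<L} = {..<L}"
    proof
      show "s ` {..<L} \<subseteq> {..<L}" using L by (auto simp: s_def)
      show "{..<L} \<subseteq> s ` {..<L}"
      proof
        fix j assume j: "j \<in> {..<L}"
        show "j \<in> s ` {..<L}"
        proof (cases j)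
          case 0
          then show ?thesis using L by (intro image_eqI[of _ _ "L - 1"]) (auto simp: s_def)
        next
          case (Suc i)
          then show ?thesis using j by (intro image_eqI[of _ _ i]) (auto simp: s_def)
        qed
      qed
    qed
    then have bij: "bij_betw s {..<L} {..<L}"
      unfolding bij_betw_def by (auto intro: eq_card_imp_inj_on)
    have "(\<Sum>v\<leftarrow>vs. ?x v) = (\<Sum>i<L. ?x (vs ! i))"
      by (simp add: sum_list_sum_nth L_def atLeast0LessThan)
    also have "\<dots> = (1/2) *\<^sub>R ((\<Sum>i<L. ?x (vs ! i)) + (\<Sum>i<L. ?x (vs ! s i)))"
      using sum.reindex_bij_betw[OF bij, of "\<lambda>i. ?x (vs ! i)"] by (simp flip: scaleR_2)
    also have "\<dots> = (\<Sum>i<L. edge_vector {b (vs ! i), b (vs ! s i)})"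
      by (simp add: edge_vector_doubleton scaleR_sum_right sum.distrib scaleR_add_right)
    also have "\<dots> \<in> edge_cone S"
      using e by (intro edge_cone_sum edge_vector_in_edge_cone E) auto
    finally show ?thesis .
  qed
  have "(\<Sum>v<n. ?x v) = (\<Sum>v\<leftarrow>concat C. ?x v)"
    unfolding sum_list_distinct_conv_sum_set[OF C(2)] C(3) ..
  also have "\<dots> = (\<Sum>vs\<leftarrow>C. \<Sum>v\<leftarrow>vs. ?x v)" by (induction C) simp_all
  also have "\<dots> \<in> edge_cone S" using cyc
    by (induction C) (auto intro: zero_in_edge_cone edge_cone_add)
  finally show ?thesis by (simp add: type_counts_eq_sum)
qed

text \<open>
  Going once around the odd cycle changes the sign; connectivity spreads the value zero.
\<close>

lemma alternating_functional_zero: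
  fixes a :: "'q::finite \<Rightarrow> real"
  assumes conn: "graph_connected UNIV S" and odd: "has_odd_cycle S"
    and a: "\<And>k l. {k, l} \<in> S \<Longrightarrow> a k + a l = 0"
  shows "a k = 0"
proof -
  have "\<exists>v. a v = 0"
  proof (cases "\<exists>v. {v} \<in> S")
    case True
    then obtain v where "{v, v} \<in> S" by auto
    from a[OF this] show ?thesis by auto
  next
    case False
    then obtain vs where vs: "is_cycle S vs" "odd (length vs)" using odd unfolding has_odd_cycle_def by auto
    define L where "L = length vs"
    have L: "L \<ge> 3" "odd L" and e: "\<And>i. i < L \<Longrightarrow> a (vs ! (Suc i mod L)) = - a (vs ! i)"
      using vs a unfolding is_cycle_def L_def by (auto simp: eq_neg_iff_add_eq_0 add.commute)
    have p: "i < L \<Longrightarrow> a (vs ! i) = (-1) ^ i * a (vs ! 0)" for i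
    proof (induction i)
      case (Suc i)
      then show ?case using e[of i] by simp
    qed simp
    have "a (vs ! 0) = - a (vs ! (L - 1))" using e[of "L - 1"] L by simp
    also have "\<dots> = - a (vs ! 0)" using p[of "L - 1"] L by simp
    finally show ?thesis by auto
  qed
  then obtain v where v: "a v = 0" by auto
  have "(v, k) \<in> {(x, y). x \<in> UNIV \<and> y \<in> UNIV \<and> {x, y} \<in> S}\<^sup>*"
    using conn unfolding graph_connected_def by blast
  then show ?thesis
  proof (induction rule: rtrancl_induct)
    case (step y z)
    then show ?case using a[of y z] by auto
  qed (rule v)
qed

text \<open>
  A closed walk that visits a node twice splits there into two shorter closed walks, one of which is odd.
\<close>

lemma odd_closed_walk_imp_odd_cycle:
  assumes "c \<noteq> []" "odd (length c)" "successively (\<lambda>u v. {u, v} \<in> S) (c @ [hd c])"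
  shows "has_odd_cycle S"
  using assms
proof (induction "length c" arbitrary: c rule: less_induct)
  case less
  let ?A = "\<lambda>u v. {u, v} \<in> S"
  show ?case
  proof (cases "distinct c")
    case True
    have step: "{c ! i, c ! (Suc i mod length c)} \<in> S" if i: "i < length c" for i
    proof -
      have "?A ((c @ [hd c]) ! i) ((c @ [hd c]) ! Suc i)"
        using less.prems(3) i by (simp only: successively_conv_nth) simp
      moreover have "(c @ [hd c]) ! Suc i = c ! (Suc i mod length c)"
      proof (cases "Suc i = length c")
        case True then show ?thesis using less.prems(1) by (simp add: nth_append hd_conv_nth)
      next
        case False then show ?thesis using i by (simp add: nth_append)
      qed
      ultimately show ?thesis using i by (simp add: nth_append)
    qed
    show ?thesis
    proof (cases "length c = 1")
      case True
      then have "{c ! 0} \<in> S" using step[of 0] by simp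
      then show ?thesis unfolding has_odd_cycle_def by blast
    next
      case False
      then have "length c \<ge> 3" using less.prems(2) by (cases "length c"; cases "length c = 2") auto
      then show ?thesis using True step less.prems(2) unfolding has_odd_cycle_def is_cycle_def by blast
    qed
  next
    case False
    then obtain xs ys zs y where c: "c = xs @ [y] @ ys @ [y] @ zs" using not_distinct_decomp by blast
    define c1 where "c1 = y # ys"
    define c2 where "c2 = xs @ [y] @ zs"
    have hd: "hd c2 = hd c" by (cases xs) (auto simp: c c2_def)
    have s: "successively ?A (xs @ y # ys @ y # zs @ [hd c])" using less.prems(3) by (simp add: c)
    have "successively ?A (c1 @ [hd c1])"
      using s by (auto simp: c1_def successively_append_iff successively_Cons hd_append split: if_splits)
    moreover have "successively ?A (c2 @ [hd c2])"
      unfolding hd using s by (auto simp: c2_def successively_append_iff successively_Cons)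
    moreover have "length c1 < length c" "length c2 < length c" "c1 \<noteq> []" "c2 \<noteq> []"
      "odd (length c1) \<or> odd (length c2)" using less.prems(2) by (auto simp: c c1_def c2_def)
    ultimately show ?thesis using less.hyps by blast
  qed
qed

text \<open>
  Colour each node by the parity of the length of a walk to a fixed root \<open>r\<close>.
\<close>

lemma two_colouring_if_no_odd_cycle:
  fixes S :: "'q::finite set set"
  assumes conn: "graph_connected UNIV S" and noodd: "\<not> has_odd_cycle S"
  shows "\<exists>a :: 'q \<Rightarrow> real. (\<forall>k. a k = 1 \<or> a k = -1) \<and> (\<forall>k l. {k, l} \<in> S \<longrightarrow> a k + a l = 0)"
proof -
  define R where "R = {(x, y). {x, y} \<in> S}"
  obtain r :: 'q where True by simp
  have reach: "\<exists>n. (r, v) \<in> R ^^ n" for v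
  proof -
    have "(r, v) \<in> R\<^sup>*" using conn unfolding graph_connected_def R_def by simp
    then show ?thesis using rtrancl_power by blast
  qed
  have symR: "(x, y) \<in> R \<Longrightarrow> (y, x) \<in> R" for x y by (simp add: R_def insert_commute)
  have sym: "(x, y) \<in> R ^^ n \<Longrightarrow> (y, x) \<in> R ^^ n" for x y n
  proof (induction n arbitrary: y)
    case (Suc n)
    then obtain z where "(x, z) \<in> R ^^ n" "(z, y) \<in> R" by auto
    then show ?case using Suc.IH symR by (meson relpow_Suc_I2)
  qed auto
  have closed: "even n" if rr: "(r, r) \<in> R ^^ n" for n
  proof (rule ccontr)
    assume odd: "odd n"
    obtain f where f: "f 0 = r" "f n = r" "\<And>i. i < n \<Longrightarrow> (f i, f (Suc i)) \<in> R"
      using rr unfolding relpow_fun_conv by blast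
    define c where "c = map f [0..<n]"
    have n: "n > 0" using odd by (cases n) auto
    then have hd: "hd c = r" unfolding c_def using f(1) by (simp add: hd_map)
    have "c @ [hd c] = map f [0..<Suc n]" unfolding hd using f(2) by (simp add: c_def)
    then have "successively (\<lambda>u v. {u, v} \<in> S) (c @ [hd c])"
      using f(3) by (simp only: successively_conv_nth) (auto simp: R_def nth_append less_Suc_eq)
    then have "has_odd_cycle S" using odd n by (intro odd_closed_walk_imp_odd_cycle[of c]) (auto simp: c_def)
    then show False using noodd by simp
  qed
  have parity: "even m \<longleftrightarrow> even n" if "(r, v) \<in> R ^^ m" "(r, v) \<in> R ^^ n" for v m n
  proof -
    have "(r, r) \<in> R ^^ (m + n)" using that(1) sym[OF that(2)] unfolding relpow_add by blast
    then show ?thesis using closed by fastforce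
  qed
  define a where "a = (\<lambda>v. if even (SOME n. (r, v) \<in> R ^^ n) then 1 else -1 :: real)"
  have a: "a v = (if even n then 1 else -1)" if "(r, v) \<in> R ^^ n" for v n
    unfolding a_def using parity[OF that someI[of "\<lambda>n. (r, v) \<in> R ^^ n", OF that]] by simp
  have "a k + a l = 0" if "{k, l} \<in> S" for k l
  proof -
    obtain n where n: "(r, k) \<in> R ^^ n" using reach by auto
    then have "(r, l) \<in> R ^^ Suc n" using that by (auto simp: R_def)
    then show ?thesis using a[OF n] a[of l "Suc n"] by auto
  qed
  moreover have "a k = 1 \<or> a k = -1" for k by (auto simp: a_def)
  ultimately show ?thesis by blast
qed

text \<open>
  From \<open>y\<close> one can go beyond \<open>x\<close> and stay in \<open>X\<close>; there a functional that is positive at \<open>y\<close> and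
  zero at \<open>x\<close> would be negative.
\<close>

lemma functional_zero_at_rel_interior:
  fixes X :: "'a::euclidean_space set"
  assumes X: "convex X" "x \<in> rel_interior X" and a: "\<And>y. y \<in> X \<Longrightarrow> inner a y \<ge> 0" and "inner a x = 0"
    and y: "y \<in> X"
  shows "inner a y = 0"
proof -
  have "\<exists>e>1. (1 - e) *\<^sub>R y + e *\<^sub>R x \<in> X"
    using convex_rel_interior_iff[OF X(1)] X y rel_interior_eq_empty by blast
  then obtain e where e: "e > 1" "(1 - e) *\<^sub>R y + e *\<^sub>R x \<in> X" by auto
  have "0 \<le> (1 - e) * inner a y" using a[OF e(2)] assms(4) by (simp add: inner_add_right)
  then have "inner a y \<le> 0" using e(1) by (simp add: zero_le_mult_iff)
  then show ?thesis using a[OF y] by simp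
qed

text \<open>
  Take a supporting functional \<open>a\<close> at \<open>x\<close>, and let \<open>T\<close> be the set where \<open>a\<close> attains its minimum \<open>m\<close>,
  which is negative. Then \<open>a\<close> is at least \<open>- m\<close> on \<open>\<Gamma> T\<close>, and all other values exceed \<open>m\<close>. Hence
  \<open>a\<close> remains nonnegative on the edge cone if a small multiple of the Hall functional of \<open>T\<close> is subtracted, which
  forces the latter to be nonpositive at \<open>x\<close>.
\<close>

lemma tight_set_at_boundary:
  fixes x :: "real ^ 'q::{finite,linorder}"
  assumes S: "\<forall>f\<in>S. \<exists>k l. f = {k, l}" and x: "\<And>k. x $ k > 0"
    and xX: "x \<in> edge_cone S" "x \<notin> rel_interior (edge_cone S)"
  shows "\<exists>T k. (\<Sum>k\<in>T. x $ k) = (\<Sum>k\<in>nbrs S T. x $ k) \<and> hall_functional S T $ k \<noteq> 0"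
proof -
  obtain a where a: "\<And>y. y \<in> edge_cone S \<Longrightarrow> inner a x \<le> inner a y" "a \<noteq> 0"
    using supporting_hyperplane_rel_boundary[OF convex_edge_cone xX] by metis
  have "inner a x \<le> 0" using a(1)[OF zero_in_edge_cone] by simp
  moreover have "inner a x \<le> inner a (2 *\<^sub>R x)" by (intro a edge_cone_scale xX) auto
  ultimately have ax: "inner a x = 0" by simp
  have edge: "a $ k + a $ l \<ge> 0" if "{k, l} \<in> S" for k l
    using a(1)[OF edge_vector_in_edge_cone[OF that]] ax by (simp add: inner_edge_vector)
  define m where "m = Min (range (($) a))"
  have m: "m \<le> a $ k" for k unfolding m_def by (intro Min_le) auto
  have "m \<in> range (($) a)" unfolding m_def by (intro Min_in) auto
  then obtain k0 where k0: "a $ k0 = m" by auto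
  have m0: "m < 0"
  proof (rule ccontr)
    assume "\<not> m < 0"
    then have nn: "a $ k \<ge> 0" for k using m[of k] by linarith
    have "(\<Sum>k\<in>UNIV. a $ k * x $ k) = 0" using ax by (simp add: inner_vec_def)
    then have "\<forall>k\<in>UNIV. a $ k * x $ k = 0"
      using nn less_imp_le[OF x] by (subst (asm) sum_nonneg_eq_0_iff) (auto intro!: mult_nonneg_nonneg)
    then have "a = 0" using x by (auto simp: vec_eq_iff) (metis less_irrefl)
    then show False using a(2) by simp
  qed
  define T where "T = {k. a $ k = m}"
  have \<Gamma>: "a $ l \<ge> - m" if "l \<in> nbrs S T" for l
    using that edge by (fastforce simp: nbrs_def T_def)
  have disj: "T \<inter> nbrs S T = {}" using \<Gamma> m0 by (fastforce simp: T_def)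
  \<comment> \<open>\<open>\<eta>\<close> is a positive lower bound for the gap between the minimum and the other values of \<open>a\<close>\<close>
  define G where "G = insert 1 ((\<lambda>k. a $ k - m) ` (- T))"
  define \<eta> where "\<eta> = Min G"
  have finG: "finite G" by (simp add: G_def)
  have "\<forall>g\<in>G. g > 0" using m by (auto simp: G_def T_def order.strict_iff_order)
  then have \<eta>: "\<eta> > 0" "\<And>k. k \<notin> T \<Longrightarrow> \<eta> \<le> a $ k - m"
    unfolding \<eta>_def using finG by (auto simp: Min_gr_iff G_def intro!: Min_le)
  define s where "s = \<eta> / 2"
  define a' where "a' = a - s *\<^sub>R hall_functional S T"
  have "inner a' x \<ge> 0"
  proof (rule edge_cone_functional_nonneg[OF S _ xX(1)])
    fix k l assume kl: "{k, l} \<in> S"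
    then have lk: "{l, k} \<in> S" by (simp add: insert_commute)
    have h: "hall_functional S T $ i = (if i \<in> T then -1 else if i \<in> nbrs S T then 1 else 0)" for i
      using disj by (auto simp: hall_functional_def indicator_def)
    show "a' $ k + a' $ l \<ge> 0"
    proof (cases "k \<in> T \<or> l \<in> T")
      case True
      then have "k \<in> T \<and> l \<in> nbrs S T \<or> l \<in> T \<and> k \<in> nbrs S T" using kl lk by (auto simp: nbrs_def)
      then have "hall_functional S T $ k + hall_functional S T $ l = 0" using disj by (auto simp: h)
      then have "s * (hall_functional S T $ k + hall_functional S T $ l) = 0" by simp
      then show ?thesis using edge[OF kl] by (simp add: a'_def algebra_simps)
    next
      case F: False
      show ?thesis
      proof (cases "k \<in> nbrs S T \<or> l \<in> nbrs S T")
        case True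
        then have "a $ k + a $ l \<ge> 2 * s"
          using \<Gamma>[of k] \<Gamma>[of l] \<eta>(2)[of k] \<eta>(2)[of l] F by (auto simp: s_def)
        moreover have "s > 0" using \<eta> by (simp add: s_def)
        ultimately show ?thesis by (simp add: a'_def h)
      next
        case False
        then show ?thesis using F edge[OF kl] by (simp add: a'_def h)
      qed
    qed
  qed
  then have "inner (hall_functional S T) x \<le> 0"
    using ax \<eta>(1) by (simp add: a'_def inner_diff_left s_def mult_le_0_iff)
  moreover have "inner (hall_functional S T) x \<ge> 0"
    by (rule edge_cone_functional_nonneg[OF S _ xX(1)]) (rule hall_functional_edge)
  ultimately have "(\<Sum>k\<in>T. x $ k) = (\<Sum>k\<in>nbrs S T. x $ k)" by (simp add: inner_hall_functional)
  moreover have "hall_functional S T $ k0 \<noteq> 0"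
    using k0 disj by (auto simp: hall_functional_def indicator_def T_def)
  ultimately show ?thesis by blast
qed


section \<open>Reduction to independent types\<close>

lemma pos_strict_mono: "k < l \<Longrightarrow> pos (k :: 'q::{finite,linorder}) < pos l"
  unfolding pos_def by (intro psubset_card_mono) auto

lemma pos_bij: "bij_betw (pos :: 'q::{finite,linorder} \<Rightarrow> nat) UNIV {..<CARD('q)}"
proof -
  have inj: "inj (pos :: 'q \<Rightarrow> nat)"
    using pos_strict_mono by (metis injI linorder_neqE nat_neq_iff)
  have "range (pos :: 'q \<Rightarrow> nat) \<subseteq> {..<CARD('q)}"
  proof safe
    fix k :: 'q
    have "{j. j < k} \<subset> UNIV" by auto
    then show "pos k < CARD('q)" unfolding pos_def by (intro psubset_card_mono) auto
  qed
  moreover have "card (range (pos :: 'q \<Rightarrow> nat)) = card {..<CARD('q)}" using inj by (simp add: card_image)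
  ultimately have "range (pos :: 'q \<Rightarrow> nat) = {..<CARD('q)}" by (intro card_subset_eq) auto
  then show ?thesis using inj by (simp add: bij_betw_def)
qed

text \<open>
  The parameter \<open>q_type\<close> only fixes the index type of the parts.
\<close>

locale step_graphon =
  fixes W :: "real \<Rightarrow> real \<Rightarrow> real" and \<sigma> :: "nat \<Rightarrow> real" and q_type :: "'q::{finite,linorder} itself"
  assumes W: "is_graphon W" and \<sigma>: "is_partition W CARD('q) \<sigma>"
begin

definition type_of :: "real \<Rightarrow> 'q" where
  "type_of t = (SOME k. t \<in> part_interval \<sigma> k)"

text \<open>
  A representative point of each part, so that \<open>W (rep k) (rep l)\<close> is the value of \<open>W\<close> on the
  rectangle of \<open>k\<close> and \<open>l\<close>.
\<close>

definition rep :: "'q \<Rightarrow> real" where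
  "rep k = \<sigma> (pos k)"

definition mass :: "'q \<Rightarrow> real" where
  "mass k = \<sigma> (Suc (pos k)) - \<sigma> (pos k)"

lemma pos_less: "pos (k :: 'q) < CARD('q)"
  using pos_bij bij_betwE by blast

lemma mass_pos: "mass k > 0"
  using \<sigma> pos_less[of k] unfolding mass_def is_partition_def by simp

lemma \<sigma>_mono: "i \<le> j \<Longrightarrow> j \<le> CARD('q) \<Longrightarrow> \<sigma> i \<le> \<sigma> j"
proof (induction j rule: dec_induct)
  case (step j)
  then have "\<sigma> j < \<sigma> (Suc j)" using \<sigma> unfolding is_partition_def by simp
  then show ?case using step by simp
qed simp

lemma part_interval_subset: "part_interval \<sigma> (k :: 'q) \<subseteq> {0..<1}"
proof -
  have "\<sigma> 0 \<le> \<sigma> (pos k)" "\<sigma> (Suc (pos k)) \<le> \<sigma> CARD('q)" using pos_less[of k] by (auto intro!: \<sigma>_mono)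
  then show ?thesis using \<sigma> unfolding is_partition_def part_interval_def by auto
qed

lemma part_interval_disjoint: "t \<in> part_interval \<sigma> (k :: 'q) \<Longrightarrow> t \<in> part_interval \<sigma> l \<Longrightarrow> k = l"
proof -
  have *: "t \<notin> part_interval \<sigma> l" if "t \<in> part_interval \<sigma> (k :: 'q)" "k < l" for k l
  proof -
    have "Suc (pos k) \<le> pos l" using pos_strict_mono[OF that(2)] by simp
    then have "\<sigma> (Suc (pos k)) \<le> \<sigma> (pos l)" using pos_less[of l] by (intro \<sigma>_mono) auto
    then show ?thesis using that(1) by (auto simp: part_interval_def)
  qed
  assume "t \<in> part_interval \<sigma> (k :: 'q)" "t \<in> part_interval \<sigma> l"
  then show "k = l" using * by (cases k l rule: linorder_cases) auto
qed

lemma part_interval_cover: "0 \<le> t \<Longrightarrow> t < 1 \<Longrightarrow> \<exists>k :: 'q. t \<in> part_interval \<sigma> k"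
proof -
  assume t: "0 \<le> t" "t < 1"
  have "\<exists>i<CARD('q). \<sigma> i \<le> t \<and> t < \<sigma> (Suc i)"
  proof (rule ccontr)
    assume no: "\<not> ?thesis"
    have "i \<le> CARD('q) \<Longrightarrow> \<sigma> i \<le> t" for i
    proof (induction i)
      case 0 then show ?case using \<sigma> t unfolding is_partition_def by simp
    next
      case (Suc i) then show ?case using no by (meson Suc_le_lessD less_imp_le linorder_not_less)
    qed
    then have "\<sigma> CARD('q) \<le> t" by simp
    then show False using \<sigma> t unfolding is_partition_def by simp
  qed
  then obtain i where i: "i < CARD('q)" "\<sigma> i \<le> t" "t < \<sigma> (Suc i)" by auto
  then obtain k :: 'q where "pos k = i" using pos_bij unfolding bij_betw_def by (metis imageE lessThan_iff)
  then show ?thesis using i by (auto simp: part_interval_def)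
qed

lemma type_of_eq: "t \<in> part_interval \<sigma> k \<Longrightarrow> type_of t = k"
  unfolding type_of_def by (rule some_equality) (auto intro: part_interval_disjoint)

lemma rep_in: "rep k \<in> part_interval \<sigma> k"
  using mass_pos[of k] by (auto simp: rep_def part_interval_def mass_def)

lemma type_of_in: "0 \<le> t \<Longrightarrow> t < 1 \<Longrightarrow> t \<in> part_interval \<sigma> (type_of t)"
  using part_interval_cover type_of_eq by blast

lemma type_of_measurable: "type_of \<in> borel \<rightarrow>\<^sub>M count_space UNIV"
proof (subst measurable_count_space_eq2, simp, intro conjI ballI)
  fix k :: 'q
  have "type_of -` {k} = part_interval \<sigma> k \<union> (if k = (SOME k. False) then - (\<Union>k :: 'q. part_interval \<sigma> k) else {})"
    (is "?A = ?B")
  proof (intro set_eqI)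
    fix t show "t \<in> ?A \<longleftrightarrow> t \<in> ?B"
    proof (cases "\<exists>k :: 'q. t \<in> part_interval \<sigma> k")
      case True
      then show ?thesis using type_of_eq part_interval_disjoint by auto
    next
      case False
      then have "type_of t = (SOME k. False)" unfolding type_of_def by simp
      then show ?thesis using False by auto
    qed
  qed
  moreover have "part_interval \<sigma> k \<in> sets borel" for k :: 'q by (simp add: part_interval_def)
  ultimately show "type_of -` {k} \<inter> space borel \<in> sets borel" by auto
qed auto

lemma W_eq_rep:
  assumes "0 \<le> s" "s < 1" "0 \<le> t" "t < 1"
  shows "W s t = W (rep (type_of s)) (rep (type_of t))"
proof -
  define k where "k = type_of s"
  define l where "l = type_of t"
  have "case_prod W constant_on (part_interval \<sigma> k \<times> part_interval \<sigma> l)"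
    using \<sigma> pos_less[of k] pos_less[of l] unfolding is_partition_def part_interval_def by blast
  moreover have "(s, t) \<in> part_interval \<sigma> k \<times> part_interval \<sigma> l" "(rep k, rep l) \<in> part_interval \<sigma> k \<times> part_interval \<sigma> l"
    using type_of_in assms rep_in by (auto simp: k_def l_def)
  ultimately show ?thesis unfolding constant_on_def k_def l_def by (metis case_prod_conv)
qed

lemma W_range: "W (rep k) (rep l) \<in> {0..1}" and W_sym: "W (rep k) (rep l) = W (rep l) (rep k)"
proof -
  have "rep k \<in> {0..1}" for k using rep_in[of k] part_interval_subset[of k] by auto
  then show "W (rep k) (rep l) \<in> {0..1}" "W (rep k) (rep l) = W (rep l) (rep k)"
    using W unfolding is_graphon_def by blast+
qed

lemma skeleton_edge_iff: "{k, l :: 'q} \<in> skeleton W \<sigma> \<longleftrightarrow> W (rep k) (rep l) > 0"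
proof -
  have eq: "W x y = W (rep k) (rep l)" if "x \<in> part_interval \<sigma> k" "y \<in> part_interval \<sigma> l" for x y and k l :: 'q
  proof -
    have "x \<in> {0..<1}" "y \<in> {0..<1}" using that part_interval_subset by blast+
    then show ?thesis using W_eq_rep[of x y] type_of_eq[OF that(1)] type_of_eq[OF that(2)] by simp
  qed
  have nz: "W (rep k) (rep l) \<noteq> 0 \<longleftrightarrow> W (rep k) (rep l) > 0" for k l using W_range[of k l] by auto
  show ?thesis
  proof
    assume "{k, l} \<in> skeleton W \<sigma>"
    then obtain k' l' where e: "{k, l} = {k', l'}" and
      "\<forall>x\<in>part_interval \<sigma> k'. \<forall>y\<in>part_interval \<sigma> l'. W x y \<noteq> 0" unfolding skeleton_def by blast
    then have "W (rep k') (rep l') > 0" using rep_in nz by blast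
    then show "W (rep k) (rep l) > 0" using e W_sym by (metis doubleton_eq_iff)
  next
    assume "W (rep k) (rep l) > 0"
    then have "\<forall>x\<in>part_interval \<sigma> k. \<forall>y\<in>part_interval \<sigma> l. W x y \<noteq> 0" using eq[of _ k _ l] by simp
    then show "{k, l} \<in> skeleton W \<sigma>" unfolding skeleton_def by blast
  qed
qed

lemma skeleton_doubletons: "\<forall>f\<in>skeleton W \<sigma>. \<exists>k l :: 'q. f = {k, l}"
  unfolding skeleton_def by auto

lemma sum_mass: "(\<Sum>k\<in>UNIV. mass (k :: 'q)) = 1"
proof -
  have "(\<Sum>k\<in>UNIV. mass (k :: 'q)) = (\<Sum>i<CARD('q). \<sigma> (Suc i) - \<sigma> i)"
    unfolding mass_def by (rule sum.reindex_bij_betw[OF pos_bij])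
  also have "\<dots> = \<sigma> CARD('q) - \<sigma> 0" by (rule sum_lessThan_telescope)
  finally show ?thesis using \<sigma> unfolding is_partition_def by simp
qed

definition type_pmf :: "'q pmf" where
  "type_pmf = embed_pmf mass"

lemma pmf_type: "pmf type_pmf k = mass k"
  unfolding type_pmf_def using mass_pos sum_mass
  by (intro pmf_embed_pmf) (auto simp: nn_integral_count_space_finite less_imp_le sum_ennreal)

definition U :: "real measure" where
  "U = uniform_measure lborel {0..1}"

lemma prob_space_U: "prob_space U"
  unfolding U_def by (intro prob_space_uniform_measure) auto

lemma sets_U [measurable_cong]: "sets U = sets borel" and space_U: "space U = UNIV"
  by (simp_all add: U_def)

lemma AE_U: "AE t in U. 0 \<le> t \<and> t < 1"
proof -
  have "AE t in lborel. t \<noteq> (1::real)" by (rule AE_lborel_singleton)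
  then have "AE t in lborel. t \<in> {0..1} \<longrightarrow> 0 \<le> t \<and> t < (1::real)" by eventually_elim auto
  then show ?thesis unfolding U_def by (intro AE_uniform_measureI) auto
qed

lemma emeasure_type_of: "emeasure U {t. type_of t = k} = ennreal (mass k)"
proof -
  interpret prob_space U by (rule prob_space_U)
  have "emeasure U {t. type_of t = k} = emeasure U (part_interval \<sigma> k)"
  proof (rule emeasure_eq_AE)
    show "AE t in U. t \<in> {t. type_of t = k} \<longleftrightarrow> t \<in> part_interval \<sigma> k"
      using AE_U by eventually_elim (use type_of_in type_of_eq in auto)
    show "{t. type_of t = k} \<in> sets U"
      using measurable_sets[OF type_of_measurable, of "{k}"] by (simp add: sets_U vimage_def)
    show "part_interval \<sigma> k \<in> sets U" by (simp add: sets_U part_interval_def)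
  qed
  also have "\<dots> = emeasure lborel ({0..1} \<inter> part_interval \<sigma> k) / emeasure lborel {0..1::real}"
    unfolding U_def by (intro emeasure_uniform_measure) (auto simp: part_interval_def)
  also have "{0..1} \<inter> part_interval \<sigma> k = part_interval \<sigma> k" using part_interval_subset[of k] by auto
  also have "emeasure lborel (part_interval \<sigma> k) = ennreal (mass k)"
    using mass_pos[of k] by (simp add: part_interval_def mass_def)
  finally show ?thesis by (simp add: divide_ennreal_def)
qed

definition types :: "nat \<Rightarrow> (nat \<Rightarrow> real) \<Rightarrow> (nat \<Rightarrow> 'q)" where
  "types n r = (\<lambda>i. if i < n then type_of (r i) else undefined)"

lemma types_event: "{r \<in> space (Pi\<^sub>M {..<n} (\<lambda>_. U)). types n r = b} =
    (if b \<in> PiE_dflt {..<n} undefined (\<lambda>_. UNIV) then Pi\<^sub>E {..<n} (\<lambda>i. {t. type_of t = b i}) else {})"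
proof -
  have 1: "types n r = b \<longleftrightarrow> (\<forall>i\<ge>n. b i = undefined) \<and> (\<forall>i<n. type_of (r i) = b i)" for r
    unfolding types_def fun_eq_iff by (metis linorder_not_less)
  have 2: "b \<in> PiE_dflt {..<n} undefined (\<lambda>_. UNIV) \<longleftrightarrow> (\<forall>i\<ge>n. b i = undefined)"
    by (auto simp: PiE_dflt_def)
  have 3: "r \<in> Pi\<^sub>E {..<n} (\<lambda>i. {t. type_of t = b i}) \<longleftrightarrow>
      r \<in> space (Pi\<^sub>M {..<n} (\<lambda>_. U)) \<and> (\<forall>i<n. type_of (r i) = b i)" for r
    unfolding space_PiM space_U PiE_iff by blast
  show ?thesis
  proof (cases "b \<in> PiE_dflt {..<n} undefined (\<lambda>_. UNIV)")
    case True
    have "r \<in> {r \<in> space (Pi\<^sub>M {..<n} (\<lambda>_. U)). types n r = b} \<longleftrightarrow> r \<in> Pi\<^sub>E {..<n} (\<lambda>i. {t. type_of t = b i})" for r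
      unfolding mem_Collect_eq 1 3 using True[unfolded 2] by blast
    then show ?thesis unfolding if_P[OF True] by blast
  next
    case False
    then show ?thesis unfolding if_not_P[OF False] using 1 2 by blast
  qed
qed

lemma type_of_sets: "{t. type_of t = k} \<in> sets U"
  using measurable_sets[OF type_of_measurable, of "{k}"] by (simp add: sets_U vimage_def)

lemma emeasure_types:
  assumes b: "b \<in> PiE_dflt {..<n} undefined (\<lambda>_. UNIV)"
  shows "{r \<in> space (Pi\<^sub>M {..<n} (\<lambda>_. U)). types n r = b} \<in> sets (Pi\<^sub>M {..<n} (\<lambda>_. U))"
   "emeasure (Pi\<^sub>M {..<n} (\<lambda>_. U)) {r \<in> space (Pi\<^sub>M {..<n} (\<lambda>_. U)). types n r = b}
    = ennreal (pmf (Pi_pmf {..<n} undefined (\<lambda>_. type_pmf)) b)"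
proof -
  interpret product_sigma_finite "\<lambda>_::nat. U"
    by (simp add: product_sigma_finite_def prob_space_U prob_space_imp_sigma_finite)
  show "{r \<in> space (Pi\<^sub>M {..<n} (\<lambda>_. U)). types n r = b} \<in> sets (Pi\<^sub>M {..<n} (\<lambda>_. U))"
    unfolding types_event using b by (auto intro!: sets_PiM_I_finite type_of_sets)
  have "emeasure (Pi\<^sub>M {..<n} (\<lambda>_. U)) {r \<in> space (Pi\<^sub>M {..<n} (\<lambda>_. U)). types n r = b} =
    (\<Prod>i<n. emeasure U {t. type_of t = b i})"
    unfolding types_event using b type_of_sets by (simp, intro emeasure_PiM) auto
  also have "\<dots> = (\<Prod>i<n. ennreal (mass (b i)))" by (simp add: emeasure_type_of)
  also have "\<dots> = ennreal (\<Prod>i<n. mass (b i))" using mass_pos by (intro prod_ennreal) (auto intro: less_imp_le)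
  also have "(\<Prod>i<n. mass (b i)) = pmf (Pi_pmf {..<n} undefined (\<lambda>_. type_pmf)) b"
    using b by (subst pmf_Pi') (auto simp: pmf_type PiE_dflt_def)
  finally show "emeasure (Pi\<^sub>M {..<n} (\<lambda>_. U)) {r \<in> space (Pi\<^sub>M {..<n} (\<lambda>_. U)). types n r = b}
    = ennreal (pmf (Pi_pmf {..<n} undefined (\<lambda>_. type_pmf)) b)" .
qed

lemma edges_given_types:
  assumes "\<And>i. i < n \<Longrightarrow> 0 \<le> r i \<and> r i < 1"
  shows "edges_given W n r = edges_given W n (rep \<circ> types n r)"
proof -
  have "W (r i) (r j) = W (rep (types n r i)) (rep (types n r j))" if "i < j" "j < n" for i j
    using W_eq_rep[of "r i" "r j"] assms that by (simp add: types_def)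
  then show ?thesis unfolding edges_given_def
    by (intro arg_cong2[where f = map_pmf] refl Pi_pmf_cong) auto
qed

lemma AE_edges_given_types:
  "AE r in Pi\<^sub>M {..<n} (\<lambda>_. U). edges_given W n r = edges_given W n (rep \<circ> types n r)"
proof -
  interpret product_prob_space "\<lambda>_::nat. U" "{..<n}"
    by (simp add: product_prob_space_def product_prob_space_axioms_def product_sigma_finite_def prob_space_U prob_space_imp_sigma_finite)
  have "AE r in Pi\<^sub>M {..<n} (\<lambda>_. U). \<forall>i\<in>{..<n}. 0 \<le> r i \<and> r i < 1"
    by (intro AE_finite_allI AE_component AE_U) auto
  then show ?thesis by eventually_elim (auto intro!: edges_given_types)
qed

lemma types_measurable: "types n \<in> Pi\<^sub>M {..<n} (\<lambda>_. U) \<rightarrow>\<^sub>M count_space (PiE_dflt {..<n} undefined (\<lambda>_. UNIV))"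
proof (subst measurable_count_space_eq2)
  show "finite (PiE_dflt {..<n} undefined (\<lambda>_. UNIV :: 'q set))" by auto
  have "types n -` {b} \<inter> space (Pi\<^sub>M {..<n} (\<lambda>_. U)) = {r \<in> space (Pi\<^sub>M {..<n} (\<lambda>_. U)). types n r = b}" for b
    by auto
  then show "types n \<in> space (Pi\<^sub>M {..<n} (\<lambda>_. U)) \<rightarrow> PiE_dflt {..<n} undefined (\<lambda>_. UNIV) \<and>
    (\<forall>b\<in>PiE_dflt {..<n} undefined (\<lambda>_. UNIV). types n -` {b} \<inter> space (Pi\<^sub>M {..<n} (\<lambda>_. U)) \<in> sets (Pi\<^sub>M {..<n} (\<lambda>_. U)))"
    using emeasure_types(1) by (auto simp: types_def PiE_dflt_def)
qed

text \<open>
  The sampling kernel \<open>r \<mapsto> edges_given W n r\<close> depends on the values of \<open>W\<close> outside the half-open unit square,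
  where \<open>W\<close> need not be a step function; it agrees almost everywhere with a measurable function of the types.
\<close>

lemma measurable_completion_AE:
  assumes g: "g \<in> M \<rightarrow>\<^sub>M N" and f: "\<And>x. x \<in> space M \<Longrightarrow> f x \<in> space N" and ae: "AE x in M. f x = g x"
  shows "f \<in> completion M \<rightarrow>\<^sub>M N"
proof (rule measurableI)
  show "x \<in> space (completion M) \<Longrightarrow> f x \<in> space N" for x using f by simp
  fix A assume A: "A \<in> sets N"
  obtain Z where Z: "Z \<in> null_sets M" "{x\<in>space M. f x \<noteq> g x} \<subseteq> Z" using ae
    by (auto elim!: AE_E simp: null_sets_def)
  have "f -` A \<inter> space M = ((g -` A \<inter> space M) - Z) \<union> (f -` A \<inter> space M \<inter> Z)" using Z by auto
  moreover have "(g -` A \<inter> space M) - Z \<in> sets M" using g A Z by (auto intro: measurable_sets)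
  ultimately show "f -` A \<inter> space (completion M) \<in> sets (completion M)"
    using Z by (intro sets_completionI[of _ "(g -` A \<inter> space M) - Z" "f -` A \<inter> space M \<inter> Z" Z]) auto
qed

text \<open>
  The coordinates enter only through the types, which are independent with law \<open>type_pmf\<close>.
\<close>

lemma cycle_cover_prob_eq:
  "cycle_cover_prob W n = measure_pmf.expectation (Pi_pmf {..<n} undefined (\<lambda>_. type_pmf))
     (\<lambda>b. measure_pmf.prob (edges_given W n (rep \<circ> b)) {E. has_cycle_cover {..<n} E})"
proof -
  let ?M = "Pi\<^sub>M {..<n} (\<lambda>_. U)" and ?B = "PiE_dflt {..<n} undefined (\<lambda>_. UNIV :: 'q set)"
  let ?C = "{E. has_cycle_cover {..<n} E}"
  interpret product_prob_space "\<lambda>_::nat. U" "{..<n}"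
    by (simp add: product_prob_space_def product_prob_space_axioms_def product_sigma_finite_def prob_space_U prob_space_imp_sigma_finite)
  define K where "K = (\<lambda>r. measure_pmf (edges_given W n r))"
  define K' where "K' = (\<lambda>b. measure_pmf (edges_given W n (rep \<circ> b)))"
  have sp: "measure_pmf p \<in> space (subprob_algebra (count_space UNIV))" for p :: "nat set set pmf"
    by (simp add: space_subprob_algebra measure_pmf.subprob_space_axioms)
  have "(\<lambda>r. K' (types n r)) \<in> ?M \<rightarrow>\<^sub>M subprob_algebra (count_space UNIV)"
    by (rule measurable_compose[OF types_measurable]) (auto simp: K'_def sp)
  then have Km: "K \<in> completion ?M \<rightarrow>\<^sub>M subprob_algebra (count_space UNIV)"
    by (rule measurable_completion_AE) (use AE_edges_given_types[of n] in \<open>auto simp: K_def K'_def sp\<close>)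
  have "space ?M \<noteq> {}" using P.not_empty by (simp add: prob_space.not_empty prob_space_PiM prob_space_U)
  then have "emeasure (sample_graph W n) ?C = (\<integral>\<^sup>+ r. emeasure (K r) ?C \<partial>completion ?M)"
    unfolding sample_graph_def U_def[symmetric] K_def[symmetric]
    by (intro emeasure_bind[OF _ Km]) auto
  also have "\<dots> = (\<integral>\<^sup>+ r. emeasure (K' (types n r)) ?C \<partial>completion ?M)"
    using AE_completion[OF AE_edges_given_types[of n]]
    by (intro nn_integral_cong_AE) (auto simp: K_def K'_def)
  also have "\<dots> = (\<integral>\<^sup>+ r. emeasure (K' (types n r)) ?C \<partial>?M)"
    by (rule nn_integral_completion)
  also have "\<dots> = (\<integral>\<^sup>+ r. (\<Sum>b\<in>?B. emeasure (K' b) ?C * indicator {r\<in>space ?M. types n r = b} r) \<partial>?M)"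
  proof (rule nn_integral_cong)
    fix r assume r: "r \<in> space ?M"
    have "types n r \<in> ?B" by (auto simp: types_def PiE_dflt_def)
    moreover have "(\<Sum>b\<in>?B. emeasure (K' b) ?C * indicator {r\<in>space ?M. types n r = b} r) =
      (\<Sum>b\<in>?B. if b = types n r then emeasure (K' b) ?C else 0)"
      using r by (intro sum.cong) (auto simp: indicator_def)
    ultimately show "emeasure (K' (types n r)) ?C = (\<Sum>b\<in>?B. emeasure (K' b) ?C * indicator {r\<in>space ?M. types n r = b} r)"
      by (simp add: finite_PiE_dflt)
  qed
  also have "\<dots> = (\<Sum>b\<in>?B. emeasure (K' b) ?C * emeasure ?M {r\<in>space ?M. types n r = b})"
    using emeasure_types(1) by (subst nn_integral_sum) (auto simp: nn_integral_cmult_indicator)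
  also have "\<dots> = (\<Sum>b\<in>?B. ennreal (pmf (Pi_pmf {..<n} undefined (\<lambda>_. type_pmf)) b * measure (K' b) ?C))"
    unfolding K'_def by (intro sum.cong refl)
      (simp add: emeasure_types(2) measure_pmf.emeasure_eq_measure mult.commute flip: ennreal_mult')
  also have "\<dots> = ennreal (\<Sum>b\<in>?B. pmf (Pi_pmf {..<n} undefined (\<lambda>_. type_pmf)) b * measure (K' b) ?C)"
    by (intro sum_ennreal) auto
  also have "(\<Sum>b\<in>?B. pmf (Pi_pmf {..<n} undefined (\<lambda>_. type_pmf)) b * measure (K' b) ?C) =
    measure_pmf.expectation (Pi_pmf {..<n} undefined (\<lambda>_. type_pmf)) (\<lambda>b. measure (K' b) ?C)"
  proof (subst integral_measure_pmf_real[where A = ?B])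
    show "b \<in> ?B" if "b \<in> set_pmf (Pi_pmf {..<n} undefined (\<lambda>_. type_pmf))" for b
      using that set_Pi_pmf_subset'[of "{..<n}" undefined "\<lambda>_. type_pmf"] by (auto simp: PiE_dflt_def)
  qed (auto simp: mult.commute)
  finally have "emeasure (sample_graph W n) ?C = ennreal (measure_pmf.expectation (Pi_pmf {..<n} undefined (\<lambda>_. type_pmf)) (\<lambda>b. measure (K' b) ?C))" .
  then show ?thesis unfolding cycle_cover_prob_def measure_def K'_def
    by (simp add: integral_nonneg_AE)
qed

end


section \<open>Gaussian limits of sums of signs\<close>

text \<open>
  The factors are exchanged one after the other. By Fubini's theorem the change at coordinate \<open>i\<close> is an
  average, over the other coordinates, of the change of the measure of a section, which is an interval.
\<close>

lemma product_measure_interval_change: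
  fixes F :: "'f set" and M N :: "'f \<Rightarrow> real measure" and d :: "'f \<Rightarrow> real"
  assumes F: "finite F"
    and prob: "\<And>i. prob_space (M i)" "\<And>i. prob_space (N i)"
    and sets: "\<And>i. sets (M i) = sets borel" "\<And>i. sets (N i) = sets borel"
    and K: "K \<in> sets (Pi\<^sub>M F (\<lambda>_. borel))"
    and sections: "\<And>i y. i \<in> F \<Longrightarrow> is_interval {t. y(i := t) \<in> K}"
    and d: "\<And>i I. i \<in> F \<Longrightarrow> is_interval I \<Longrightarrow> \<bar>measure (M i) I - measure (N i) I\<bar> \<le> d i"
  shows "\<bar>measure (Pi\<^sub>M F M) K - measure (Pi\<^sub>M F N) K\<bar> \<le> (\<Sum>i\<in>F. d i)"
proof -
  \<comment> \<open>the product after exchanging the factors in \<open>G\<close>\<close>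
  define H where "H = (\<lambda>G i. if i \<in> G then N i else M i)"
  have pH: "prob_space (H G i)" and sH: "sets (H G i) = sets borel" for G i
    using prob sets by (auto simp: H_def)
  have "\<bar>measure (Pi\<^sub>M F M) K - measure (Pi\<^sub>M F (H G)) K\<bar> \<le> (\<Sum>i\<in>G. d i)" if "G \<subseteq> F" for G
    using finite_subset[OF that F] that
  proof (induction G rule: finite_induct)
    case empty
    then show ?case by (simp add: H_def)
  next
    case (insert g G)
    define F' where "F' = F - {g}"
    have F': "F = insert g F'" "g \<notin> F'" "finite F'" using insert F by (auto simp: F'_def)
    have marg: "measure (Pi\<^sub>M F P) K = (\<integral>y. measure (P g) {t. y(g := t) \<in> K} \<partial>Pi\<^sub>M F' P)"
      and meas: "(\<lambda>y. measure (P g) {t. y(g := t) \<in> K}) \<in> borel_measurable (Pi\<^sub>M F' P)"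
      if P: "\<And>i. prob_space (P i)" "\<And>i. sets (P i) = sets borel" for P
    proof -
      interpret product_sigma_finite P using P by (simp add: product_sigma_finite_def prob_space_imp_sigma_finite)
      have sP: "sets (Pi\<^sub>M I P) = sets (Pi\<^sub>M I (\<lambda>_. borel))" for I by (intro sets_PiM_cong P refl)
      have KP: "K \<in> sets (Pi\<^sub>M F P)" using K sP by simp
      interpret PF: prob_space "Pi\<^sub>M F P" by (intro prob_space_PiM P)
      have "measure (Pi\<^sub>M F P) K = (\<integral>y. indicator K y \<partial>Pi\<^sub>M (insert g F') P)"
        using KP F' by simp
      also have "\<dots> = (\<integral>y. (\<integral>t. indicator K (y(g := t)) \<partial>P g) \<partial>Pi\<^sub>M F' P)"
        using F' KP PF.emeasure_eq_measure by (intro product_integral_insert) auto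
      also have "\<dots> = (\<integral>y. measure (P g) {t. y(g := t) \<in> K} \<partial>Pi\<^sub>M F' P)"
      proof (intro Bochner_Integration.integral_cong refl)
        fix y assume y: "y \<in> space (Pi\<^sub>M F' P)"
        have "(\<lambda>t. y(g := t)) \<in> P g \<rightarrow>\<^sub>M Pi\<^sub>M F P" unfolding F'(1) using y
          by (intro measurable_fun_upd[where J = F']) auto
        from measurable_sets[OF this KP] have "{t. y(g := t) \<in> K} \<in> sets (P g)"
          using sets_eq_imp_space_eq[OF P(2)] by (simp add: vimage_def)
        moreover have "indicator K (y(g := t)) = (indicator {t. y(g := t) \<in> K} t :: real)" for t by (simp add: indicator_def)
        ultimately show "(\<integral>t. indicator K (y(g := t)) \<partial>P g) = measure (P g) {t. y(g := t) \<in> K}" by simp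
      qed
      finally show "measure (Pi\<^sub>M F P) K = (\<integral>y. measure (P g) {t. y(g := t) \<in> K} \<partial>Pi\<^sub>M F' P)" .
      interpret Pg: prob_space "P g" by (rule P)
      have ev: "(\<lambda>(y, t). y(g := t)) \<in> Pi\<^sub>M F' P \<Otimes>\<^sub>M P g \<rightarrow>\<^sub>M Pi\<^sub>M F P"
        unfolding F'(1) by (rule measurable_add_dim)
      have "{yt \<in> space (Pi\<^sub>M F' P \<Otimes>\<^sub>M P g). (fst yt)(g := snd yt) \<in> K} \<in> sets (Pi\<^sub>M F' P \<Otimes>\<^sub>M P g)"
        using measurable_sets[OF ev KP] by (simp add: vimage_def case_prod_unfold Int_def conj_commute)
      from borel_measurable_enn2real[OF measurable_emeasure_Pair[OF this]]
      have m0: "(\<lambda>y. measure (P g) (Pair y -` {yt \<in> space (Pi\<^sub>M F' P \<Otimes>\<^sub>M P g). (fst yt)(g := snd yt) \<in> K})) \<in> borel_measurable (Pi\<^sub>M F' P)"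
        unfolding measure_def .
      have "Pair y -` {yt \<in> space (Pi\<^sub>M F' P \<Otimes>\<^sub>M P g). (fst yt)(g := snd yt) \<in> K} = {t. y(g := t) \<in> K}"
        if "y \<in> space (Pi\<^sub>M F' P)" for y
        using that sets_eq_imp_space_eq[OF P(2)[of g]] by (auto simp: space_pair_measure)
      then show "(\<lambda>y. measure (P g) {t. y(g := t) \<in> K}) \<in> borel_measurable (Pi\<^sub>M F' P)"
        using m0 by (simp cong: measurable_cong)
    qed
    have eqF': "Pi\<^sub>M F' (H (insert g G)) = Pi\<^sub>M F' (H G)"
      using F'(2) by (intro PiM_cong) (auto simp: H_def)
    interpret P': prob_space "Pi\<^sub>M F' (H G)" by (intro prob_space_PiM pH)
    have Hg: "H G g = M g" "H (insert g G) g = N g" using insert by (auto simp: H_def)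
    define u where "u = (\<lambda>y. measure (M g) {t. y(g := t) \<in> K})"
    define v where "v = (\<lambda>y. measure (N g) {t. y(g := t) \<in> K})"
    have uv: "0 \<le> u y" "u y \<le> 1" "0 \<le> v y" "v y \<le> 1" for y
      using prob by (auto simp: u_def v_def prob_space.prob_le_1)
    have "u \<in> borel_measurable (Pi\<^sub>M F' (H G))"
      unfolding u_def using meas[of "H G", OF pH sH] by (simp add: Hg)
    moreover have "v \<in> borel_measurable (Pi\<^sub>M F' (H G))"
      unfolding v_def using meas[of "H (insert g G)", OF pH sH] by (simp add: Hg eqF')
    ultimately have int: "integrable (Pi\<^sub>M F' (H G)) u" "integrable (Pi\<^sub>M F' (H G)) v"
      using uv by (auto intro!: P'.integrable_const_bound[where B = 1])
    have "\<bar>measure (Pi\<^sub>M F (H G)) K - measure (Pi\<^sub>M F (H (insert g G))) K\<bar> = \<bar>\<integral>y. u y - v y \<partial>Pi\<^sub>M F' (H G)\<bar>"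
      unfolding marg[of "H G", OF pH sH] marg[of "H (insert g G)", OF pH sH] eqF' Hg u_def[symmetric] v_def[symmetric]
      using int by simp
    also have "\<dots> \<le> (\<integral>y. \<bar>u y - v y\<bar> \<partial>Pi\<^sub>M F' (H G))" by (rule integral_abs_bound)
    also have "\<dots> \<le> (\<integral>y. d g \<partial>Pi\<^sub>M F' (H G))"
      using int insert.prems unfolding u_def v_def
      by (intro integral_mono) (auto intro!: d sections)
    also have "\<dots> = d g" using P'.prob_space by simp
    finally show ?case using insert by simp
  qed
  from this[of F] have "\<bar>measure (Pi\<^sub>M F M) K - measure (Pi\<^sub>M F (H F)) K\<bar> \<le> (\<Sum>i\<in>F. d i)" by simp
  moreover have "Pi\<^sub>M F (H F) = Pi\<^sub>M F N" by (intro PiM_cong) (auto simp: H_def)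
  ultimately show ?thesis by simp
qed

definition gauss :: "real \<Rightarrow> real measure" where
  "gauss c = density lborel (normal_density 0 (sqrt c))"

lemma prob_space_gauss: "c > 0 \<Longrightarrow> prob_space (gauss c)"
  unfolding gauss_def by (intro prob_space_normal_density) auto

lemma sets_gauss [simp, measurable_cong]: "sets (gauss c) = sets borel" and space_gauss [simp]: "space (gauss c) = UNIV"
  by (simp_all add: gauss_def)

lemma gauss_scale:
  assumes c: "c > 0" and n: "n > (0::real)" and A: "A \<in> sets borel"
  shows "measure (gauss (n * c)) {t. t / sqrt n \<in> A} = measure (gauss c) A"
proof -
  interpret prob_space "gauss c" using c by (rule prob_space_gauss)
  have "distributed (gauss c) lborel (\<lambda>x. x) (normal_density 0 (sqrt c))"
    unfolding distributed_def gauss_def by (auto simp: distr_id2)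
  from normal_density_affine[OF this, of "sqrt n" 0]
  have "distributed (gauss c) lborel (\<lambda>x. sqrt n * x) (normal_density 0 (sqrt (n * c)))"
    using c n by (simp add: real_sqrt_mult)
  then have D: "distr (gauss c) lborel (\<lambda>x. sqrt n * x) = gauss (n * c)"
    unfolding distributed_def gauss_def[of "n * c"] by simp
  have m: "{t. t / sqrt n \<in> A} \<in> sets borel"
    using measurable_sets[OF _ A, of "\<lambda>t. t / sqrt n" borel] by (simp add: vimage_def)
  have "measure (gauss (n * c)) {t. t / sqrt n \<in> A} = measure (gauss c) ((\<lambda>x. sqrt n * x) -` {t. t / sqrt n \<in> A} \<inter> space (gauss c))"
    unfolding D[symmetric] using m by (intro measure_distr) auto
  also have "(\<lambda>x. sqrt n * x) -` {t. t / sqrt n \<in> A} \<inter> space (gauss c) = A" using n by auto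
  finally show ?thesis .
qed

lemma gauss_interval_pos:
  assumes "a < b" "c > 0" shows "measure (gauss c) {a..b} > 0"
proof -
  interpret prob_space "gauss c" using assms(2) by (rule prob_space_gauss)
  have "measure (gauss c) {a..b} \<noteq> 0"
  proof
    assume "measure (gauss c) {a..b} = 0"
    then have "{a..b} \<in> null_sets (gauss c)" by (auto simp: emeasure_eq_measure)
    then have ae: "AE t in lborel. t \<in> {a..b} \<longrightarrow> ennreal (normal_density 0 (sqrt c) t) = 0"
      unfolding gauss_def by (subst (asm) null_sets_density_iff) auto
    have nz: "ennreal (normal_density 0 (sqrt c) t) \<noteq> 0" for t
      using assms normal_density_pos[of "sqrt c" 0 t] by (simp add: ennreal_eq_0_iff not_le)
    from ae have "AE t in lborel. t \<notin> {a..b}" by eventually_elim (use nz in blast)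
    then have "{a..b} \<in> null_sets lborel" by (subst AE_iff_null_sets) auto
    then show False using assms by auto
  qed
  then show ?thesis by (simp add: zero_less_measure_iff)
qed

definition signed_sum :: "nat \<Rightarrow> (nat \<Rightarrow> 'f) \<Rightarrow> 'f \<Rightarrow> (nat \<Rightarrow> bool) \<Rightarrow> real" where
  "signed_sum n \<phi> f s = (\<Sum>v\<in>(nodes_of n \<phi> f). if s v then 1 else -1)"

definition coins :: "nat \<Rightarrow> (nat \<Rightarrow> bool) pmf" where
  "coins n = Pi_pmf {..<n} False (\<lambda>_. bernoulli_pmf (1/2))"

lemma count_true_coins:
  assumes G: "G \<subseteq> {..<n}"
  shows "map_pmf (\<lambda>s. card {v\<in>G. s v}) (coins n) = binomial_pmf (card G) (1/2)"
proof -
  have fG: "finite G" using G finite_subset by blast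
  have "binomial_pmf (card G) (1/2) = map_pmf (\<lambda>s. card {v\<in>G. s v}) (Pi_pmf G False (\<lambda>_. bernoulli_pmf (1/2)))"
    using fG by (intro binomial_pmf_altdef') auto
  also have "Pi_pmf G False (\<lambda>_. bernoulli_pmf (1/2)) = map_pmf (\<lambda>s v. if v \<in> G then s v else False) (coins n)"
    unfolding coins_def using G by (intro Pi_pmf_subset) auto
  also have "map_pmf (\<lambda>s. card {v\<in>G. s v}) (map_pmf (\<lambda>s v. if v \<in> G then s v else False) (coins n)) =
    map_pmf (\<lambda>s. card {v\<in>G. s v}) (coins n)"
  proof -
    have "{v\<in>G. if v \<in> G then s v else False} = {v\<in>G. s v}" for s by auto
    then show ?thesis unfolding map_pmf_comp by simp
  qed
  finally show ?thesis ..
qed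

lemma signed_sum_eq: "signed_sum n \<phi> f s = 2 * real (card {v\<in>(nodes_of n \<phi> f). s v}) - real (card (nodes_of n \<phi> f))"
proof -
  let ?G = "(nodes_of n \<phi> f)"
  have "signed_sum n \<phi> f s = (\<Sum>v\<in>?G. 2 * (if s v then 1 else 0) - 1)"
    unfolding signed_sum_def by (intro sum.cong) auto
  also have "\<dots> = 2 * (\<Sum>v\<in>?G. if s v then 1 else 0) - real (card ?G)"
    by (simp add: sum_subtractf sum_distrib_left)
  also have "(\<Sum>v\<in>?G. if s v then 1 else (0::real)) = real (card {v\<in>?G. s v})"
    by (subst sum.inter_filter[symmetric]) auto
  finally show ?thesis .
qed

lemma signed_sum_gauss:
  fixes n :: nat and c :: real and \<phi> :: "nat \<Rightarrow> 'f" and f :: 'f and I :: "real set"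
  assumes n: "n \<ge> 1" and c: "c > 0" and I: "is_interval I"
  defines "m \<equiv> real (card (nodes_of n \<phi> f))"
  shows "\<bar>measure (distr (measure_pmf (coins n)) borel (\<lambda>s. signed_sum n \<phi> f s / sqrt (real n))) I - measure (gauss c) I\<bar>
     \<le> 2 * 10^6 * (1 / sqrt (real n * c) + \<bar>m + 1 - real n * c\<bar> / (real n * c))"
proof -
  let ?G = "(nodes_of n \<phi> f)"
  define I' where "I' = {t. t / sqrt (real n) \<in> I}"
  have Ib: "I \<in> sets borel" using I by (rule interval_borel)
  have I': "is_interval I'"
    unfolding is_interval_1 I'_def
  proof safe
    fix a b x assume ab: "a / sqrt (real n) \<in> I" "b / sqrt (real n) \<in> I" "a \<le> x" "x \<le> b"
    then have "a / sqrt (real n) \<le> x / sqrt (real n)" "x / sqrt (real n) \<le> b / sqrt (real n)" by (auto intro: divide_right_mono)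
    then show "x / sqrt (real n) \<in> I" using ab I unfolding is_interval_1 by blast
  qed
  have "measure (distr (measure_pmf (coins n)) borel (\<lambda>s. signed_sum n \<phi> f s / sqrt (real n))) I =
    measure_pmf.prob (coins n) {s. signed_sum n \<phi> f s \<in> I'}"
    using Ib by (subst measure_distr) (auto simp: I'_def vimage_def)
  also have "\<dots> = measure_pmf.prob (map_pmf (\<lambda>s. card {v\<in>?G. s v}) (coins n)) {j. 2 * real j - real (card ?G) \<in> I'}"
    by (simp add: signed_sum_eq vimage_def)
  also have "\<dots> = measure_pmf.prob (binomial_pmf (card ?G) (1/2)) {j. 2 * real j - real (card ?G) \<in> I'}"
    by (subst count_true_coins) auto
  finally have 1: "measure (distr (measure_pmf (coins n)) borel (\<lambda>s. signed_sum n \<phi> f s / sqrt (real n))) I = \<dots>" .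
  have 2: "measure (gauss c) I = measure (gauss (real n * c)) I'"
    unfolding I'_def using gauss_scale[of c "real n" I] n c Ib by simp
  show ?thesis unfolding 1 2 m_def unfolding gauss_def using I' n c by (intro binomial_normal_interval) auto
qed

text \<open>
  For fixed labels \<open>\<phi>\<close> the sums of distinct labels use disjoint sets of coins, hence are independent.
\<close>

lemma signed_sums_gauss:
  fixes \<phi> :: "nat \<Rightarrow> 'f" and c :: "'f \<Rightarrow> real"
  assumes n: "n \<ge> 1" and F: "finite F" "F \<noteq> {}" and c: "\<And>f. c f > 0"
    and K: "K \<in> sets (Pi\<^sub>M F (\<lambda>_. borel))"
    and sections: "\<And>i y. i \<in> F \<Longrightarrow> is_interval {t. y(i := t) \<in> K}"
  shows "\<bar>measure_pmf.prob (coins n) {s. (\<lambda>f\<in>F. signed_sum n \<phi> f s / sqrt (real n)) \<in> K} - measure (Pi\<^sub>M F (\<lambda>f. gauss (c f))) K\<bar>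
     \<le> (\<Sum>f\<in>F. 2 * 10^6 * (1 / sqrt (real n * c f) + \<bar>real (card (nodes_of n \<phi> f)) + 1 - real n * c f\<bar> / (real n * c f)))"
proof -
  define X where "X = (\<lambda>f s. signed_sum n \<phi> f s / sqrt (real n))"
  define G where "G = (\<lambda>f. (nodes_of n \<phi> f))"
  let ?indep = "prob_space.indep_vars (measure_pmf (coins n))"
  note ps = measure_pmf.prob_space_axioms[of "coins n"]
  have "?indep (\<lambda>_. count_space UNIV) (\<lambda>v s. s v) {..<n}"
    unfolding coins_def by (rule indep_vars_Pi_pmf) auto
  then have "?indep (\<lambda>f. Pi\<^sub>M (G f) (\<lambda>_. count_space UNIV)) (\<lambda>f s. restrict (\<lambda>v. s v) (G f)) F"
    by (rule prob_space.indep_vars_restrict[OF ps]) (auto simp: G_def disjoint_family_on_def)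
  then have "?indep (\<lambda>_. borel) (\<lambda>f s. (\<lambda>z. (\<Sum>v\<in>G f. if z v then 1 else -1 :: real) / sqrt (real n)) (restrict (\<lambda>v. s v) (G f))) F"
    by (rule prob_space.indep_vars_compose2[OF ps]) (auto intro!: borel_measurable_divide borel_measurable_sum measurable_If)
  moreover have "(\<lambda>f s. (\<lambda>z. (\<Sum>v\<in>G f. if z v then 1 else -1 :: real) / sqrt (real n)) (restrict (\<lambda>v. s v) (G f))) = X"
    unfolding X_def signed_sum_def G_def by (intro ext arg_cong2[where f = "(/)"] sum.cong) auto
  ultimately have "?indep (\<lambda>_. borel) X F" by simp
  then have eq: "distr (measure_pmf (coins n)) (Pi\<^sub>M F (\<lambda>_. borel)) (\<lambda>s. \<lambda>f\<in>F. X f s) = Pi\<^sub>M F (\<lambda>f. distr (measure_pmf (coins n)) borel (X f))"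
    using F(2) by (subst (asm) prob_space.indep_vars_iff_distr_eq_PiM[OF ps]) auto
  have "measure_pmf.prob (coins n) {s. (\<lambda>f\<in>F. X f s) \<in> K} = measure (distr (measure_pmf (coins n)) (Pi\<^sub>M F (\<lambda>_. borel)) (\<lambda>s. \<lambda>f\<in>F. X f s)) K"
    using K by (subst measure_distr) (auto simp: vimage_def space_PiM)
  also have "\<dots> = measure (Pi\<^sub>M F (\<lambda>f. distr (measure_pmf (coins n)) borel (X f))) K" unfolding eq ..
  finally have e: "measure_pmf.prob (coins n) {s. (\<lambda>f\<in>F. X f s) \<in> K} = \<dots>" .
  have "\<bar>measure (Pi\<^sub>M F (\<lambda>f. distr (measure_pmf (coins n)) borel (X f))) K - measure (Pi\<^sub>M F (\<lambda>f. gauss (c f))) K\<bar>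
     \<le> (\<Sum>f\<in>F. 2 * 10^6 * (1 / sqrt (real n * c f) + \<bar>real (card (nodes_of n \<phi> f)) + 1 - real n * c f\<bar> / (real n * c f)))"
  proof (rule product_measure_interval_change[OF F(1) _ _ _ _ K sections])
    show "prob_space (distr (measure_pmf (coins n)) borel (X i))" for i by (intro prob_space.prob_space_distr[OF ps]) auto
    show "prob_space (gauss (c i))" for i using c by (rule prob_space_gauss)
    show "\<bar>measure (distr (measure_pmf (coins n)) borel (X i)) I - measure (gauss (c i)) I\<bar> \<le>
      2 * 10^6 * (1 / sqrt (real n * c i) + \<bar>real (card (nodes_of n \<phi> i)) + 1 - real n * c i\<bar> / (real n * c i))"
      if "is_interval I" for i I
      unfolding X_def using signed_sum_gauss[OF n c that] by simp
  qed auto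
  then show ?thesis using e unfolding X_def by simp
qed

text \<open>
  Having label \<open>k\<close> is a Bernoulli variable with parameter \<open>pmf p k\<close>.
\<close>

lemma count_binomial:
  "map_pmf (\<lambda>b. card (nodes_of n b k)) (Pi_pmf {..<n} d (\<lambda>_. p)) = binomial_pmf n (pmf p k)"
proof -
  have "map_pmf (\<lambda>y. y = k) p = bernoulli_pmf (pmf p k)"
  proof (rule pmf_eqI)
    fix i
    have "pmf (map_pmf (\<lambda>y. y = k) p) True = pmf p k"
      by (subst pmf_map) (simp add: vimage_def measure_pmf_single)
    moreover have "pmf (map_pmf (\<lambda>y. y = k) p) False = 1 - pmf p k"
    proof -
      have "pmf (map_pmf (\<lambda>y. y = k) p) False = measure_pmf.prob p (- {k})"
        by (subst pmf_map) (simp add: vimage_def Compl_eq)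
      then show ?thesis by (subst (asm) measure_pmf.prob_compl[of "{k}" p, unfolded space_measure_pmf, folded Compl_eq_Diff_UNIV]) (auto simp: measure_pmf_single)
    qed
    ultimately show "pmf (map_pmf (\<lambda>y. y = k) p) i = pmf (bernoulli_pmf (pmf p k)) i"
      by (cases i) (auto simp: pmf_le_1)
  qed
  moreover have "Pi_pmf {..<n} (d = k) (\<lambda>_. map_pmf (\<lambda>y. y = k) p) = map_pmf (\<lambda>h. (\<lambda>y. y = k) \<circ> h) (Pi_pmf {..<n} d (\<lambda>_. p))"
    by (rule Pi_pmf_map) auto
  moreover have "binomial_pmf n (pmf p k) = map_pmf (\<lambda>s. card {v\<in>{..<n}. s v}) (Pi_pmf {..<n} (d = k) (\<lambda>_. bernoulli_pmf (pmf p k)))"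
    by (rule binomial_pmf_altdef') (auto simp: pmf_le_1)
  ultimately show ?thesis by (simp add: map_pmf_comp)
qed

lemma prob_counts_not_close:
  fixes p :: "'q::finite pmf"
  assumes "n \<ge> 1" "\<epsilon> > 0"
  shows "measure_pmf.prob (Pi_pmf {..<n} d (\<lambda>_. p)) {b. \<not> (\<forall>k. \<bar>real (card (nodes_of n b k)) - n * pmf p k\<bar> \<le> \<epsilon> * n)}
     \<le> 2 * CARD('q) * exp (- (2 * \<epsilon>\<^sup>2) * real n)"
proof -
  let ?M = "Pi_pmf {..<n} d (\<lambda>_. p)"
  define B where "B = (\<lambda>k. {b. \<bar>real (card (nodes_of n b k)) - n * pmf p k\<bar> \<ge> \<epsilon> * n})"
  have "measure_pmf.prob ?M (B k) \<le> 2 * exp (- (2 * \<epsilon>\<^sup>2) * real n)" for k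
  proof -
    interpret binomial_distribution n "pmf p k" by unfold_locales (auto simp: pmf_le_1)
    have "measure_pmf.prob ?M (B k) = measure_pmf.prob (map_pmf (\<lambda>b. card (nodes_of n b k)) ?M) {x. \<bar>x - n * pmf p k\<bar> \<ge> \<epsilon> * n}"
      by (simp add: B_def vimage_def)
    also have "\<dots> \<le> 2 * exp (-2 * (\<epsilon> * n)\<^sup>2 / n)"
      unfolding count_binomial using assms by (intro prob_abs_ge) auto
    also have "-2 * (\<epsilon> * n)\<^sup>2 / n = - (2 * \<epsilon>\<^sup>2) * real n" using assms by (simp add: power2_eq_square)
    finally show ?thesis .
  qed
  then have "(\<Sum>k\<in>UNIV. measure_pmf.prob ?M (B k)) \<le> (\<Sum>k\<in>(UNIV :: 'q set). 2 * exp (- (2 * \<epsilon>\<^sup>2) * real n))"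
    by (intro sum_mono)
  moreover have "measure_pmf.prob ?M (\<Union>k. B k) \<le> (\<Sum>k\<in>UNIV. measure_pmf.prob ?M (B k))"
    by (intro measure_pmf.finite_measure_subadditive_finite) auto
  moreover have "measure_pmf.prob ?M {b. \<not> (\<forall>k. \<bar>real (card (nodes_of n b k)) - n * pmf p k\<bar> \<le> \<epsilon> * n)} \<le> measure_pmf.prob ?M (\<Union>k. B k)"
    by (intro measure_pmf.finite_measure_mono) (auto simp: B_def not_le intro: less_imp_le)
  ultimately show ?thesis by simp
qed

text \<open>
  The variance \<open>n p (1 - p)\<close> is known from the Bernstein polynomials, and \<open>z \<le> (z\<^sup>2 / sqrt n + sqrt n) / 2\<close>.
\<close>

lemma binomial_mean_deviation:
  assumes p: "0 \<le> p" "p \<le> 1" and n: "n \<ge> 1"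
  shows "measure_pmf.expectation (binomial_pmf n p) (\<lambda>j. \<bar>real j - n * p\<bar>) \<le> sqrt n"
proof -
  have pm: "pmf (binomial_pmf n p) k = Bernstein n k p" for k
    using p by (simp add: pmf_binomial Bernstein_def)
  have "set_pmf (binomial_pmf n p) \<subseteq> {..n}"
  proof
    fix k assume "k \<in> set_pmf (binomial_pmf n p)"
    then have "n choose k \<noteq> 0" by (auto simp: set_pmf_eq pm Bernstein_def)
    then show "k \<in> {..n}" using binomial_eq_0[of n k] by (auto simp: not_le[symmetric])
  qed
  then have "measure_pmf.expectation (binomial_pmf n p) (\<lambda>j. \<bar>real j - n * p\<bar>) = (\<Sum>k\<le>n. \<bar>real k - n * p\<bar> * Bernstein n k p)"
    by (subst integral_measure_pmf_real[where A = "{..n}"]) (auto simp: pm)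
  also have "\<dots> \<le> (\<Sum>k\<le>n. ((real k - n * p)\<^sup>2 / sqrt n + sqrt n) / 2 * Bernstein n k p)"
  proof (intro sum_mono mult_right_mono)
    show "0 \<le> Bernstein n k p" for k using p by (simp add: Bernstein_def)
    fix k
    define z where "z = \<bar>real k - n * p\<bar>"
    have s: "sqrt n > 0" using n by simp
    have "0 \<le> (z - sqrt n)\<^sup>2" by simp
    then have "2 * z * sqrt n \<le> z\<^sup>2 + sqrt n * sqrt n" by (simp add: power2_eq_square algebra_simps)
    then have "z \<le> (z\<^sup>2 / sqrt n + sqrt n) / 2" using s by (simp add: field_simps)
    then show "\<bar>real k - n * p\<bar> \<le> ((real k - n * p)\<^sup>2 / sqrt n + sqrt n) / 2" by (simp add: z_def)
  qed
  also have "\<dots> = ((\<Sum>k\<le>n. (real k - n * p)\<^sup>2 * Bernstein n k p) / sqrt n + sqrt n * (\<Sum>k\<le>n. Bernstein n k p)) / 2"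
    by (simp add: sum_divide_distrib sum_distrib_left sum.distrib add_divide_distrib algebra_simps del: sum_Bernstein)
  also have "(\<Sum>k\<le>n. (real k - n * p)\<^sup>2 * Bernstein n k p) = n * p * (1 - p)"
  proof -
    have "(real k - n * p)\<^sup>2 * B = real k * (real k - 1) * B + (1 - 2 * n * p) * (real k * B) + (n * p)\<^sup>2 * B" for k B
      by (simp add: power2_eq_square algebra_simps)
    then have "(\<Sum>k\<le>n. (real k - n * p)\<^sup>2 * Bernstein n k p) =
      (\<Sum>k\<le>n. real k * (real k - 1) * Bernstein n k p) + (1 - 2 * n * p) * (\<Sum>k\<le>n. real k * Bernstein n k p) + (n * p)\<^sup>2 * (\<Sum>k\<le>n. Bernstein n k p)"
      by (simp only: sum.distrib sum_distrib_left)
    then show ?thesis unfolding sum_kk_Bernstein sum_k_Bernstein sum_Bernstein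
      by (simp only:) (simp add: power2_eq_square algebra_simps)
  qed
  also have "(n * p * (1 - p) / sqrt n + sqrt n * (\<Sum>k\<le>n. Bernstein n k p)) / 2 \<le> sqrt n"
  proof -
    have "p * (1 - p) \<le> 1" using p by (simp add: mult_le_one)
    then have "n * p * (1 - p) \<le> sqrt n * sqrt n" using n by (simp add: mult_left_le mult.assoc)
    then have "n * p * (1 - p) / sqrt n \<le> sqrt n" using n by (simp add: divide_le_eq)
    then show ?thesis by simp
  qed
  finally show ?thesis .
qed

text \<open>
  A polyhedral cone in the space of functions on \<open>F\<close>, given by its homogeneous inequalities.
\<close>

definition half_spaces :: "'f set \<Rightarrow> ('t \<Rightarrow> 'f \<Rightarrow> real) \<Rightarrow> 't set \<Rightarrow> ('f \<Rightarrow> real) set" where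
  "half_spaces F \<alpha> I = {y \<in> extensional F. \<forall>i\<in>I. 0 \<le> (\<Sum>f\<in>F. \<alpha> i f * y f)}"

lemma half_spaces_sets:
  assumes "finite F" "finite I" shows "half_spaces F \<alpha> I \<in> sets (Pi\<^sub>M F (\<lambda>_. borel))"
proof -
  have "half_spaces F \<alpha> I = {y \<in> space (Pi\<^sub>M F (\<lambda>_. borel)). \<forall>i\<in>I. 0 \<le> (\<Sum>f\<in>F. \<alpha> i f * y f)}"
    by (auto simp: half_spaces_def space_PiM PiE_def)
  moreover have "\<dots> \<in> sets (Pi\<^sub>M F (\<lambda>_. borel))"
    using assms by (intro sets.sets_Collect_finite_All) (auto intro!: borel_measurable_le borel_measurable_sum borel_measurable_times measurable_component_singleton simp: pred_def[symmetric])
  ultimately show ?thesis by simp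
qed

lemma half_spaces_section:
  assumes F: "finite F" and g: "g \<in> F"
  shows "is_interval {t. y(g := t) \<in> half_spaces F \<alpha> I}"
proof -
  have ext: "y(g := t) \<in> extensional F \<longleftrightarrow> (\<forall>f. f \<notin> F \<longrightarrow> y f = undefined)" for t
    using g by (auto simp: extensional_def)
  have sum: "(\<Sum>f\<in>F. \<alpha> i f * (y(g := t)) f) = \<alpha> i g * t + (\<Sum>f\<in>F - {g}. \<alpha> i f * y f)" for i t
    using F g by (subst sum.remove[of _ g]) (auto intro!: sum.cong)
  show ?thesis
    unfolding is_interval_1
  proof safe
    fix s t u assume st: "y(g := s) \<in> half_spaces F \<alpha> I" "y(g := t) \<in> half_spaces F \<alpha> I" "s \<le> u" "u \<le> t"
    have s0: "0 \<le> \<alpha> i g * s + (\<Sum>f\<in>F - {g}. \<alpha> i f * y f)"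
      and t0: "0 \<le> \<alpha> i g * t + (\<Sum>f\<in>F - {g}. \<alpha> i f * y f)" if "i \<in> I" for i
      using st(1,2) that unfolding half_spaces_def mem_Collect_eq sum by auto
    have "0 \<le> \<alpha> i g * u + (\<Sum>f\<in>F - {g}. \<alpha> i f * y f)" if "i \<in> I" for i
    proof (cases "\<alpha> i g \<ge> 0")
      case True
      then have "\<alpha> i g * s \<le> \<alpha> i g * u" using st(3) by (rule mult_left_mono[rotated])
      then show ?thesis using s0[OF that] by linarith
    next
      case False
      then have "\<alpha> i g * t \<le> \<alpha> i g * u" using st(4) by (intro mult_left_mono_neg) auto
      then show ?thesis using t0[OF that] by linarith
    qed
    then show "y(g := u) \<in> half_spaces F \<alpha> I"
      using st(1) unfolding half_spaces_def mem_Collect_eq sum ext by blast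
  qed
qed

lemma gauss_box_pos:
  fixes F :: "'f set" and c y :: "'f \<Rightarrow> real" and \<eta> :: real
  assumes F: "finite F" and c: "\<And>f. f \<in> F \<Longrightarrow> c f > 0" and \<eta>: "\<eta> > 0"
  shows "Pi\<^sub>E F (\<lambda>f. {y f - \<eta>..y f + \<eta>}) \<in> sets (Pi\<^sub>M F (\<lambda>f. gauss (c f)))"
    "measure (Pi\<^sub>M F (\<lambda>f. gauss (c f))) (Pi\<^sub>E F (\<lambda>f. {y f - \<eta>..y f + \<eta>})) > 0"
proof -
  let ?B = "Pi\<^sub>E F (\<lambda>f. {y f - \<eta>..y f + \<eta>})"
  define c' where "c' = (\<lambda>f. if f \<in> F then c f else 1)"
  have c': "c' f > 0" for f using c by (simp add: c'_def)
  have eq: "Pi\<^sub>M F (\<lambda>f. gauss (c f)) = Pi\<^sub>M F (\<lambda>f. gauss (c' f))" by (intro PiM_cong) (auto simp: c'_def)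
  interpret product_sigma_finite "\<lambda>f. gauss (c' f)"
    using prob_space_gauss[OF c'] by (simp add: product_sigma_finite_def prob_space_imp_sigma_finite)
  interpret P: prob_space "Pi\<^sub>M F (\<lambda>f. gauss (c' f))" using prob_space_gauss[OF c'] by (intro prob_space_PiM)
  show "?B \<in> sets (Pi\<^sub>M F (\<lambda>f. gauss (c f)))" using F by (intro sets_PiM_I_finite) auto
  have "emeasure (Pi\<^sub>M F (\<lambda>f. gauss (c' f))) ?B = (\<Prod>f\<in>F. emeasure (gauss (c' f)) {y f - \<eta>..y f + \<eta>})"
    using F by (intro emeasure_PiM) auto
  also have "\<dots> \<noteq> 0"
  proof -
    have "emeasure (gauss (c' f)) {y f - \<eta>..y f + \<eta>} \<noteq> 0" for f
      using gauss_interval_pos[of "y f - \<eta>" "y f + \<eta>" "c' f"] \<eta> c' by (auto simp: measure_def)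
    then show ?thesis using F by simp
  qed
  finally have "measure (Pi\<^sub>M F (\<lambda>f. gauss (c' f))) ?B \<noteq> 0" by (simp add: P.emeasure_eq_measure)
  then show "measure (Pi\<^sub>M F (\<lambda>f. gauss (c f))) ?B > 0" unfolding eq by (simp add: zero_less_measure_iff)
qed

text \<open>
  A small box around \<open>y\<close> lies inside the cone and a small box around \<open>- y\<close> outside; both have positive
  Gaussian measure.
\<close>

lemma half_spaces_gauss_strictly_between:
  fixes \<alpha> :: "'t \<Rightarrow> 'f \<Rightarrow> real" and y :: "'f \<Rightarrow> real"
  assumes F: "finite F" and I: "finite I" and c: "\<And>f. f \<in> F \<Longrightarrow> c f > 0"
    and \<alpha>: "\<And>i f. \<bar>\<alpha> i f\<bar> \<le> 1"
    and y: "\<And>i. i \<in> I \<Longrightarrow> 0 < (\<Sum>f\<in>F. \<alpha> i f * y f) \<or> (\<forall>f\<in>F. \<alpha> i f = 0)"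
    and i0: "i0 \<in> I" "0 < (\<Sum>f\<in>F. \<alpha> i0 f * y f)"
  shows "0 < measure (Pi\<^sub>M F (\<lambda>f. gauss (c f))) (half_spaces F \<alpha> I)"
    and "measure (Pi\<^sub>M F (\<lambda>f. gauss (c f))) (half_spaces F \<alpha> I) < 1"
proof -
  let ?P = "Pi\<^sub>M F (\<lambda>f. gauss (c f))"
  have eq: "?P = Pi\<^sub>M F (\<lambda>f. gauss (if f \<in> F then c f else 1))" by (intro PiM_cong) auto
  interpret P: prob_space ?P unfolding eq using c by (intro prob_space_PiM prob_space_gauss) auto
  have sP: "sets ?P = sets (Pi\<^sub>M F (\<lambda>_. borel))" by (intro sets_PiM_cong) auto
  have K: "half_spaces F \<alpha> I \<in> sets ?P" unfolding sP using F I by (rule half_spaces_sets)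
  define s where "s = (\<lambda>i. \<Sum>f\<in>F. \<alpha> i f * y f)"
  define \<eta> where "\<eta> = Min (s ` {i\<in>I. s i > 0}) / (real (card F) + 1)"
  have fin: "finite (s ` {i\<in>I. s i > 0})" "s ` {i\<in>I. s i > 0} \<noteq> {}" using I i0 by (auto simp: s_def)
  then have "0 < Min (s ` {i\<in>I. s i > 0})" by (subst Min_gr_iff) auto
  then have \<eta>: "\<eta> > 0" by (simp add: \<eta>_def)
  have \<eta>s: "card F * \<eta> < s i" if "i \<in> I" "s i > 0" for i
  proof -
    have "Min (s ` {i\<in>I. s i > 0}) \<le> s i" using that fin by (intro Min_le) auto
    then have "(real (card F) + 1) * \<eta> \<le> s i" by (simp add: \<eta>_def)
    then show ?thesis using \<eta> by (simp add: distrib_right)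
  qed
  have dev: "\<bar>(\<Sum>f\<in>F. \<alpha> i f * z f) - (\<Sum>f\<in>F. \<alpha> i f * y' f)\<bar> \<le> card F * \<eta>"
    if z: "z \<in> Pi\<^sub>E F (\<lambda>f. {y' f - \<eta>..y' f + \<eta>})" for i z and y' :: "'f \<Rightarrow> real"
  proof -
    have "\<bar>(\<Sum>f\<in>F. \<alpha> i f * z f) - (\<Sum>f\<in>F. \<alpha> i f * y' f)\<bar> = \<bar>\<Sum>f\<in>F. \<alpha> i f * (z f - y' f)\<bar>"
      by (simp add: sum_subtractf right_diff_distrib)
    also have "\<dots> \<le> (\<Sum>f\<in>F. \<bar>\<alpha> i f * (z f - y' f)\<bar>)" by (rule sum_abs)
    also have "\<dots> \<le> (\<Sum>f\<in>F. 1 * \<eta>)"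
    proof (rule sum_mono)
      fix f assume f: "f \<in> F"
      then have "\<bar>z f - y' f\<bar> \<le> \<eta>" using PiE_mem[OF z f] by auto
      then show "\<bar>\<alpha> i f * (z f - y' f)\<bar> \<le> 1 * \<eta>" unfolding abs_mult using \<alpha> by (intro mult_mono) auto
    qed
    finally show ?thesis by simp
  qed
  have "Pi\<^sub>E F (\<lambda>f. {y f - \<eta>..y f + \<eta>}) \<subseteq> half_spaces F \<alpha> I"
  proof
    fix z assume z: "z \<in> Pi\<^sub>E F (\<lambda>f. {y f - \<eta>..y f + \<eta>})"
    have "0 \<le> (\<Sum>f\<in>F. \<alpha> i f * z f)" if i: "i \<in> I" for i
      using y[OF i]
    proof
      assume "0 < (\<Sum>f\<in>F. \<alpha> i f * y f)"
      then show ?thesis using \<eta>s[OF i] dev[OF z, of i] by (simp add: s_def)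
    qed simp
    then show "z \<in> half_spaces F \<alpha> I" using z by (auto simp: half_spaces_def PiE_def)
  qed
  then have "measure ?P (Pi\<^sub>E F (\<lambda>f. {y f - \<eta>..y f + \<eta>})) \<le> measure ?P (half_spaces F \<alpha> I)"
    using K by (intro P.finite_measure_mono)
  then show "0 < measure ?P (half_spaces F \<alpha> I)" using gauss_box_pos(2)[where y = y and c = c, OF F c \<eta>] by linarith
  let ?B = "Pi\<^sub>E F (\<lambda>f. {- y f - \<eta>..- y f + \<eta>})"
  have "?B \<inter> half_spaces F \<alpha> I = {}"
  proof (rule ccontr)
    assume "\<not> ?thesis"
    then obtain z where z: "z \<in> ?B" "z \<in> half_spaces F \<alpha> I" by auto
    have "0 \<le> (\<Sum>f\<in>F. \<alpha> i0 f * z f)" using z(2) i0 by (simp add: half_spaces_def)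
    moreover have "\<bar>(\<Sum>f\<in>F. \<alpha> i0 f * z f) - (\<Sum>f\<in>F. \<alpha> i0 f * - y f)\<bar> \<le> card F * \<eta>" by (rule dev[OF z(1)])
    moreover have "(\<Sum>f\<in>F. \<alpha> i0 f * - y f) = - s i0" by (simp add: s_def sum_negf)
    ultimately show False using \<eta>s[of i0] i0 by (simp add: s_def)
  qed
  then have "measure ?P ?B + measure ?P (half_spaces F \<alpha> I) = measure ?P (?B \<union> half_spaces F \<alpha> I)"
    using K gauss_box_pos(1)[where y = "\<lambda>f. - y f" and c = c, OF F c \<eta>] by (intro P.finite_measure_Union[symmetric])
  also have "\<dots> \<le> 1" by (rule P.prob_le_1)
  finally show "measure ?P (half_spaces F \<alpha> I) < 1" using gauss_box_pos(2)[where y = "\<lambda>f. - y f" and c = c, OF F c \<eta>] by linarith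
qed

lemma prob_bind_pmf: "measure_pmf.prob (bind_pmf p f) A = measure_pmf.expectation p (\<lambda>x. measure_pmf.prob (f x) A)"
proof -
  have "ennreal (measure_pmf.prob (bind_pmf p f) A) = (\<integral>\<^sup>+x. ennreal (measure_pmf.prob (f x) A) \<partial>p)"
    by (simp flip: measure_pmf.emeasure_eq_measure)
  also have "\<dots> = ennreal (measure_pmf.expectation p (\<lambda>x. measure_pmf.prob (f x) A))"
    by (intro nn_integral_eq_integral measure_pmf.integrable_const_bound[where B = 1]) auto
  finally show ?thesis by (simp add: integral_nonneg_AE)
qed

text \<open>
  A type with law \<open>tp\<close> is drawn by choosing an edge with law \<open>ep\<close> and one of its end points \<open>u f\<close> and \<open>w f\<close>
  by a fair coin. Functionals that alternate along the edges then sum up to fair signs times their values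
  at \<open>u f\<close>. Given the edges, these signed sums are nearly Gaussian; the error depends on the deviation of the
  number of nodes with edge \<open>f\<close> from its mean, which is of order \<open>sqrt n\<close>. As the limiting set is a cone,
  the sums may be divided by \<open>sqrt n\<close>.
\<close>

lemma alternating_sums_gauss_limit:
  fixes ep :: "'f::finite pmf" and u w :: "'f \<Rightarrow> 'q" and a :: "'t \<Rightarrow> 'q \<Rightarrow> real" and I :: "'t set"
  assumes I: "finite I" and alt: "\<And>i f. i \<in> I \<Longrightarrow> f \<in> set_pmf ep \<Longrightarrow> a i (u f) + a i (w f) = 0"
  defines "tp \<equiv> bind_pmf ep (\<lambda>f. map_pmf (\<lambda>s. if s then u f else w f) (bernoulli_pmf (1/2)))"
  defines "P \<equiv> measure (Pi\<^sub>M (set_pmf ep) (\<lambda>f. gauss (pmf ep f))) (half_spaces (set_pmf ep) (\<lambda>i f. a i (u f)) I)"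
  shows "\<exists>C>0. \<forall>n\<ge>1. \<bar>measure_pmf.prob (Pi_pmf {..<n} d (\<lambda>_. tp)) {b. \<forall>i\<in>I. 0 \<le> (\<Sum>v<n. a i (b v))} - P\<bar> \<le> C / sqrt (real n)"
proof -
  define F where "F = set_pmf ep"
  \<comment> \<open>variances that are positive for all labels, also for those outside \<open>F\<close>\<close>
  define c where "c = (\<lambda>f. if f \<in> F then pmf ep f else 1)"
  define K where "K = half_spaces F (\<lambda>i f. a i (u f)) I"
  have F: "finite F" "F \<noteq> {}" by (auto simp: F_def set_pmf_not_empty)
  have c: "c f > 0" for f by (simp add: c_def F_def pmf_positive)
  have P: "P = measure (Pi\<^sub>M F (\<lambda>f. gauss (c f))) K"
    unfolding P_def F_def[symmetric] K_def[symmetric]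
    by (intro arg_cong2[where f = measure] PiM_cong) (auto simp: c_def)
  have K: "K \<in> sets (Pi\<^sub>M F (\<lambda>_. borel))" unfolding K_def using F I by (intro half_spaces_sets)
  have Ksec: "is_interval {t. y(g := t) \<in> K}" if "g \<in> F" for g y
    unfolding K_def using F that by (intro half_spaces_section)
  define C where "C = (\<Sum>f\<in>F. 2 * 10^6 * (1 / sqrt (c f) + 2 / c f))"
  have C: "C > 0" unfolding C_def using F c by (intro sum_pos) (auto intro!: add_pos_pos)
  have "\<bar>measure_pmf.prob (Pi_pmf {..<n} d (\<lambda>_. tp)) {b. \<forall>i\<in>I. 0 \<le> (\<Sum>v<n. a i (b v))} - P\<bar> \<le> C / sqrt (real n)"
    if n: "n \<ge> 1" for n
  proof -
    define Ep where "Ep = Pi_pmf {..<n} undefined (\<lambda>_. ep)"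
    let ?A = "{b. \<forall>i\<in>I. 0 \<le> (\<Sum>v<n. a i (b v))}"
    define T where "T = (\<lambda>\<phi> s v. if v < n then (if s v then u (\<phi> v) else w (\<phi> v)) else d)"
    have law: "Pi_pmf {..<n} d (\<lambda>_. tp) = bind_pmf Ep (\<lambda>\<phi>. map_pmf (T \<phi>) (coins n))"
    proof -
      have "Pi_pmf {..<n} d (\<lambda>_. tp) = bind_pmf Ep (\<lambda>\<phi>. Pi_pmf {..<n} d (\<lambda>v. map_pmf (\<lambda>s. if s then u (\<phi> v) else w (\<phi> v)) (bernoulli_pmf (1/2))))"
        unfolding tp_def Ep_def by (rule Pi_pmf_bind) auto
      also have "\<dots> = bind_pmf Ep (\<lambda>\<phi>. map_pmf (T \<phi>) (coins n))"
      proof (intro bind_pmf_cong refl)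
        fix \<phi>
        have "Pi_pmf {..<n} d (\<lambda>v. map_pmf (\<lambda>s. if s then u (\<phi> v) else w (\<phi> v)) (bernoulli_pmf (1/2))) =
          Pi_pmf {..<n} d (\<lambda>v. bind_pmf (bernoulli_pmf (1/2)) (\<lambda>s. return_pmf (if s then u (\<phi> v) else w (\<phi> v))))"
          by (simp add: map_pmf_def)
        also have "\<dots> = bind_pmf (coins n) (\<lambda>s. Pi_pmf {..<n} d (\<lambda>v. return_pmf (if s v then u (\<phi> v) else w (\<phi> v))))"
          unfolding coins_def by (rule Pi_pmf_bind) auto
        also have "\<dots> = map_pmf (T \<phi>) (coins n)"
          by (simp add: map_pmf_def T_def[abs_def])
        finally show "Pi_pmf {..<n} d (\<lambda>v. map_pmf (\<lambda>s. if s then u (\<phi> v) else w (\<phi> v)) (bernoulli_pmf (1/2))) = map_pmf (T \<phi>) (coins n)" .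
      qed
      finally show ?thesis .
    qed
    define pr where "pr = (\<lambda>\<phi>. measure_pmf.prob (map_pmf (T \<phi>) (coins n)) ?A)"
    define err where "err = (\<lambda>\<phi>. \<Sum>f\<in>F. 2 * 10^6 * (1 / sqrt (real n * c f) + \<bar>real (card (nodes_of n \<phi> f)) + 1 - real n * c f\<bar> / (real n * c f)))"
    have fE: "finite (set_pmf Ep)" unfolding Ep_def
      by (rule finite_subset[OF set_Pi_pmf_subset']) (auto intro!: finite_PiE_dflt)
    have cond: "\<bar>pr \<phi> - P\<bar> \<le> err \<phi>" if \<phi>: "\<phi> \<in> set_pmf Ep" for \<phi>
    proof -
      have \<phi>F: "\<phi> v \<in> F" if "v < n" for v
        using \<phi> that unfolding Ep_def F_def by (subst (asm) set_Pi_pmf) (auto simp: PiE_dflt_def)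
      have "T \<phi> s \<in> ?A \<longleftrightarrow> (\<lambda>f\<in>F. signed_sum n \<phi> f s / sqrt (real n)) \<in> K" for s
      proof -
        have "(\<Sum>v<n. a i (T \<phi> s v)) = (\<Sum>f\<in>F. a i (u f) * signed_sum n \<phi> f s)" if i: "i \<in> I" for i
        proof -
          have "(\<Sum>v<n. a i (T \<phi> s v)) = (\<Sum>v<n. a i (u (\<phi> v)) * (if s v then 1 else -1))"
            using alt[OF i] \<phi>F by (intro sum.cong) (auto simp: T_def F_def eq_neg_iff_add_eq_0 add.commute)
          also have "\<dots> = (\<Sum>f\<in>F. \<Sum>v\<in>(nodes_of n \<phi> f). a i (u (\<phi> v)) * (if s v then 1 else -1))"
            using F \<phi>F by (intro sum.group[symmetric]) auto
          also have "\<dots> = (\<Sum>f\<in>F. a i (u f) * signed_sum n \<phi> f s)"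
            unfolding signed_sum_def sum_distrib_left by (intro sum.cong) auto
          finally show ?thesis .
        qed
        moreover have "(\<Sum>f\<in>F. a i (u f) * (\<lambda>f\<in>F. signed_sum n \<phi> f s / sqrt (real n)) f) = (\<Sum>f\<in>F. a i (u f) * signed_sum n \<phi> f s) / sqrt (real n)" for i
          unfolding sum_divide_distrib by (intro sum.cong) auto
        ultimately show ?thesis using n by (auto simp: K_def half_spaces_def zero_le_divide_iff)
      qed
      then have "pr \<phi> = measure_pmf.prob (coins n) {s. (\<lambda>f\<in>F. signed_sum n \<phi> f s / sqrt (real n)) \<in> K}"
        unfolding pr_def by (simp add: vimage_def)
      then show ?thesis unfolding P err_def using signed_sums_gauss[OF n F c K Ksec, of \<phi>] by simp
    qed
    have int: "integrable (measure_pmf Ep) g" for g :: "_ \<Rightarrow> real" using fE by (rule integrable_measure_pmf_finite)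
    let ?dev = "\<lambda>f. measure_pmf.expectation Ep (\<lambda>\<phi>. \<bar>real (card (nodes_of n \<phi> f)) + 1 - real n * c f\<bar>)"
    have dev: "?dev f \<le> sqrt n + 1" if f: "f \<in> F" for f
    proof -
      have cf: "c f = pmf ep f" using f by (simp add: c_def)
      have "?dev f \<le>
        measure_pmf.expectation Ep (\<lambda>\<phi>. \<bar>real (card (nodes_of n \<phi> f)) - real n * c f\<bar> + 1)"
        by (intro integral_mono int) auto
      also have "\<dots> = measure_pmf.expectation Ep (\<lambda>\<phi>. \<bar>real (card (nodes_of n \<phi> f)) - real n * c f\<bar>) + 1"
        by (subst Bochner_Integration.integral_add) (auto intro: int)
      also have "measure_pmf.expectation Ep (\<lambda>\<phi>. \<bar>real (card (nodes_of n \<phi> f)) - real n * c f\<bar>) =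
        measure_pmf.expectation (map_pmf (\<lambda>\<phi>. card (nodes_of n \<phi> f)) Ep) (\<lambda>j. \<bar>real j - real n * c f\<bar>)"
        by simp
      also have "\<dots> \<le> sqrt n"
        unfolding Ep_def count_binomial cf using n by (intro binomial_mean_deviation) (auto simp: pmf_le_1)
      finally show ?thesis by simp
    qed
    have "measure_pmf.prob (Pi_pmf {..<n} d (\<lambda>_. tp)) ?A - P = measure_pmf.expectation Ep (\<lambda>\<phi>. pr \<phi> - P)"
      unfolding law prob_bind_pmf pr_def using int by simp
    then have "\<bar>measure_pmf.prob (Pi_pmf {..<n} d (\<lambda>_. tp)) ?A - P\<bar> = \<bar>measure_pmf.expectation Ep (\<lambda>\<phi>. pr \<phi> - P)\<bar>" by simp
    also have "\<dots> \<le> measure_pmf.expectation Ep (\<lambda>\<phi>. \<bar>pr \<phi> - P\<bar>)" by (rule integral_abs_bound)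
    also have "\<dots> \<le> measure_pmf.expectation Ep err"
      using cond by (intro integral_mono_AE int AE_pmfI)
    also have "\<dots> = (\<Sum>f\<in>F. 2 * 10^6 * (1 / sqrt (real n * c f) + ?dev f / (real n * c f)))"
      unfolding err_def using int by (subst Bochner_Integration.integral_sum) auto
    also have "\<dots> \<le> (\<Sum>f\<in>F. 2 * 10^6 * (1 / sqrt (c f) + 2 / c f) / sqrt (real n))"
    proof (rule sum_mono)
      fix f assume f: "f \<in> F"
      define s where "s = sqrt (real n)"
      have s: "s \<ge> 1" "real n = s * s" using n by (auto simp: s_def)
      have "?dev f / (real n * c f) \<le> (2 * s) / (real n * c f)"
        using dev[OF f] s c[of f] unfolding s_def[symmetric] by (intro divide_right_mono) auto
      also have "\<dots> = 2 / c f / s" using s c[of f] by (simp add: field_simps)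
      finally have e: "?dev f / (real n * c f) \<le> 2 / c f / s" .
      have "1 / sqrt (real n * c f) = 1 / sqrt (c f) / s" by (simp add: real_sqrt_mult s_def)
      then have "1 / sqrt (real n * c f) + ?dev f / (real n * c f)
         \<le> (1 / sqrt (c f) + 2 / c f) / s" unfolding add_divide_distrib using e by linarith
      from mult_left_mono[OF this, of "2 * 10^6"]
      show "2 * 10^6 * (1 / sqrt (real n * c f) + ?dev f / (real n * c f))
        \<le> 2 * 10^6 * (1 / sqrt (c f) + 2 / c f) / sqrt (real n)" unfolding s_def by simp
    qed
    also have "\<dots> = C / sqrt (real n)" by (simp add: C_def sum_divide_distrib)
    finally show ?thesis .
  qed
  then show ?thesis using C by blast
qed


section \<open>The four regimes\<close>

context step_graphon
begin

abbreviation S :: "'q set set" where "S \<equiv> skeleton W \<sigma>"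

abbreviation x :: "(real, 'q) vec" where "x \<equiv> concentration \<sigma>"

abbreviation types_pmf :: "nat \<Rightarrow> (nat \<Rightarrow> 'q) pmf" where
  "types_pmf n \<equiv> Pi_pmf {..<n} undefined (\<lambda>_. type_pmf)"

lemma x_eq_mass: "x $ k = mass k"
  by (simp add: concentration_def mass_def)

lemma finite_types_pmf: "finite (set_pmf (types_pmf n))"
  by (rule finite_subset[OF set_Pi_pmf_subset']) (auto intro!: finite_PiE_dflt)

lemma integrable_types_pmf: "integrable (measure_pmf (types_pmf n)) (g :: _ \<Rightarrow> real)"
  using finite_types_pmf by (rule integrable_measure_pmf_finite)

lemma sampled_edge_in_skeleton:
  assumes E: "E \<in> set_pmf (edges_given W n (rep \<circ> b))" and uv: "{u, v} \<in> E"
  shows "{b u, b v} \<in> S"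
proof -
  obtain h where h: "h \<in> set_pmf (Pi_pmf {(i, j). i < j \<and> j < n} False (\<lambda>(i, j). bernoulli_pmf (W ((rep \<circ> b) i) ((rep \<circ> b) j))))"
    and Eh: "E = {{i, j} | i j. i < j \<and> j < n \<and> h (i, j)}"
    using E unfolding edges_given_def by auto
  obtain i j where ij: "{u, v} = {i, j}" "i < j" "j < n" "h (i, j)" using uv unfolding Eh by auto
  have "h (i, j) \<in> set_pmf (bernoulli_pmf (W (rep (b i)) (rep (b j))))"
  proof -
    have "h \<in> PiE_dflt {(i, j). i < j \<and> j < n} False (set_pmf \<circ> (\<lambda>(i, j). bernoulli_pmf (W ((rep \<circ> b) i) ((rep \<circ> b) j))))"
      using h unfolding set_Pi_pmf[OF finite_pairs_below] .
    then show ?thesis using ij(2,3) unfolding PiE_dflt_def by (auto dest!: spec[of _ "(i, j)"])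
  qed
  then have "W (rep (b i)) (rep (b j)) \<noteq> 0" using ij(4) by (auto simp: set_pmf_iff pmf_bernoulli_True)
  then have "W (rep (b i)) (rep (b j)) > 0" using W_range[of "b i" "b j"] by auto
  then have "{b i, b j} \<in> S" by (simp add: skeleton_edge_iff)
  then show ?thesis using ij(1) by (metis doubleton_eq_iff insert_commute)
qed

lemma cycle_cover_prob_le:
  "cycle_cover_prob W n \<le> measure_pmf.prob (types_pmf n) {b. type_counts n b \<in> edge_cone S}"
proof -
  have z: "measure_pmf.prob (edges_given W n (rep \<circ> b)) {E. has_cycle_cover {..<n} E} = 0" if "type_counts n b \<notin> edge_cone S" for b
    using type_counts_in_edge_cone[of n _ b S] sampled_edge_in_skeleton[of _ n b] that
    by (subst measure_pmf_zero_iff) blast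
  have "cycle_cover_prob W n \<le> measure_pmf.expectation (types_pmf n) (indicator {b. type_counts n b \<in> edge_cone S})"
    unfolding cycle_cover_prob_eq
    by (intro integral_mono integrable_types_pmf) (auto simp: indicator_def z)
  then show ?thesis by simp
qed

lemma hall_functional_nonneg: "y \<in> edge_cone S \<Longrightarrow> inner (hall_functional S T) y \<ge> 0"
  by (rule edge_cone_functional_nonneg[OF skeleton_doubletons hall_functional_edge])

lemma inner_hall_x: "inner (hall_functional S T) x = sum mass (nbrs S T) - sum mass T"
  by (simp add: inner_hall_functional x_eq_mass)

lemma inner_hall_counts: "inner (hall_functional S T) (type_counts n b) =
    real (card {v\<in>{..<n}. b v \<in> nbrs S T}) - real (card {v\<in>{..<n}. b v \<in> T})"
  by (simp only: inner_hall_functional sum_type_counts)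

abbreviation far :: "nat \<Rightarrow> real \<Rightarrow> (nat \<Rightarrow> 'q) set" where
  "far n \<epsilon> \<equiv> {b. \<not> (\<forall>k. \<bar>real (card (nodes_of n b k)) - n * mass k\<bar> \<le> \<epsilon> * n)}"

lemma prob_far_le: "\<epsilon> > 0 \<Longrightarrow> n \<ge> 1 \<Longrightarrow>
   measure_pmf.prob (types_pmf n) (far n \<epsilon>)
     \<le> 2 * CARD('q) * exp (- (2 * \<epsilon>\<^sup>2) * real n)"
  using prob_counts_not_close[of n \<epsilon> undefined type_pmf] by (simp add: pmf_type)

abbreviation tight_sets :: "'q set set" where
  "tight_sets \<equiv> {T. inner (hall_functional S T) x = 0}"

abbreviation tight_event :: "nat \<Rightarrow> (nat \<Rightarrow> 'q) set" where
  "tight_event n \<equiv> {b. \<forall>T\<in>tight_sets. 0 \<le> inner (hall_functional S T) (type_counts n b)}"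

text \<open>
  If the tight inequalities hold, then a cycle cover can fail to exist only if the type counts are far from their
  means or the oriented graph is not pseudo-random.
\<close>

lemma cycle_cover_prob_ge:
  assumes xX: "x \<in> edge_cone S"
  shows "\<exists>c>0. \<exists>l>0. \<forall>n\<ge>1. measure_pmf.prob (types_pmf n) (tight_event n)
     \<le> cycle_cover_prob W n + c * exp (- l * real n)"
proof -
  \<comment> \<open>a lower bound for the edge probabilities; the \<open>1\<close> covers a graph without edges\<close>
  define p where "p = Min (insert 1 ((\<lambda>(k, l). W (rep k) (rep l)) ` {(k, l). {k, l} \<in> S}))"
  have p: "p > 0" unfolding p_def by (subst Min_gr_iff) (auto simp: skeleton_edge_iff)
  have pW: "p \<le> W (rep k) (rep l) \<and> W (rep k) (rep l) \<le> 1" if "{k, l} \<in> S" for k l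
  proof -
    have "p \<le> W (rep k) (rep l)" unfolding p_def using that by (intro Min_le) auto
    then show ?thesis using W_range[of k l] by simp
  qed
  have hall: "sum mass T \<le> sum mass (nbrs S T)" for T
    using hall_functional_nonneg[OF xX, of T] by (simp add: inner_hall_x)
  obtain \<epsilon> c \<mu> where \<epsilon>: "\<epsilon> > 0" and c: "c > 0" "\<mu> > 0" and whp: "\<forall>n W r b.
     (\<forall>u v. u < v \<and> v < n \<and> {b u, b v} \<in> S \<longrightarrow> p \<le> W (r u) (r v) \<and> W (r u) (r v) \<le> 1) \<longrightarrow>
     (\<forall>k. \<bar>real (card (nodes_of n b k)) - n * mass k\<bar> \<le> \<epsilon> * n) \<longrightarrow>
     (\<forall>T. sum mass T = sum mass (nbrs S T) \<longrightarrow> card {v\<in>{..<n}. b v \<in> T} \<le> card {v\<in>{..<n}. b v \<in> nbrs S T}) \<longrightarrow>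
     measure_pmf.prob (edges_given W n r) {E. \<not> has_cycle_cover {..<n} E} \<le> c * exp (- \<mu> * real n)"
    using cycle_cover_whp_of_types[where S = S and x = mass, OF p mass_pos hall] by blast
  define l where "l = min \<mu> (2 * \<epsilon>\<^sup>2)"
  have "measure_pmf.prob (types_pmf n) (tight_event n)
     \<le> cycle_cover_prob W n + (c + 2 * CARD('q)) * exp (- l * real n)" if n: "n \<ge> 1" for n
  proof -
    let ?H = "(tight_event n)"
    let ?far = "(far n \<epsilon>)"
    define g where "g = (\<lambda>b. measure_pmf.prob (edges_given W n (rep \<circ> b)) {E. has_cycle_cover {..<n} E})"
    have good: "1 - c * exp (- \<mu> * real n) \<le> g b" if "b \<in> ?H" "b \<notin> ?far" for b
    proof -
      have "measure_pmf.prob (edges_given W n (rep \<circ> b)) {E. \<not> has_cycle_cover {..<n} E} \<le> c * exp (- \<mu> * real n)"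
      proof (rule whp[rule_format])
        show "p \<le> W ((rep \<circ> b) u) ((rep \<circ> b) v) \<and> W ((rep \<circ> b) u) ((rep \<circ> b) v) \<le> 1"
          if "u < v \<and> v < n \<and> {b u, b v} \<in> S" for u v using that pW by simp
        show "\<bar>real (card (nodes_of n b k)) - n * mass k\<bar> \<le> \<epsilon> * n" for k using \<open>b \<notin> ?far\<close> by blast
        show "card {v\<in>{..<n}. b v \<in> T} \<le> card {v\<in>{..<n}. b v \<in> nbrs S T}" if T: "sum mass T = sum mass (nbrs S T)" for T
        proof -
          have "T \<in> tight_sets" using T by (simp add: inner_hall_x)
          then have "0 \<le> inner (hall_functional S T) (type_counts n b)" using \<open>b \<in> ?H\<close> by blast
          then show ?thesis unfolding inner_hall_counts by simp
        qed
      qed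
      moreover have "{E. \<not> has_cycle_cover {..<n} E} = UNIV - {E. has_cycle_cover {..<n} E}" by auto
      then have "measure_pmf.prob (edges_given W n (rep \<circ> b)) {E. \<not> has_cycle_cover {..<n} E} = 1 - g b"
        unfolding g_def using measure_pmf.prob_compl[of "{E. has_cycle_cover {..<n} E}" "edges_given W n (rep \<circ> b)"] by simp
      ultimately show ?thesis by simp
    qed
    have g: "0 \<le> g b" "g b \<le> 1" for b by (auto simp: g_def)
    have "measure_pmf.prob (types_pmf n) ?H = measure_pmf.expectation (types_pmf n) (indicator ?H)" by simp
    also have "\<dots> \<le> measure_pmf.expectation (types_pmf n) (\<lambda>b. (g b + c * exp (- \<mu> * real n)) + indicator ?far b)"
    proof (intro integral_mono integrable_types_pmf)
      fix b
      have "0 \<le> c * exp (- \<mu> * real n)" using c by simp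
      then have "indicator A b \<le> (g b + c * exp (- \<mu> * real n)) + (indicator B b :: real)"
        if "b \<in> A \<Longrightarrow> b \<notin> B \<Longrightarrow> 1 - c * exp (- \<mu> * real n) \<le> g b" for A B
        using that g[of b] by (cases "b \<in> A"; cases "b \<in> B") simp_all
      from this[OF good] show "indicator ?H b \<le> (g b + c * exp (- \<mu> * real n)) + (indicator ?far b :: real)" .
    qed
    also have "\<dots> = cycle_cover_prob W n + c * exp (- \<mu> * real n) + measure_pmf.prob (types_pmf n) ?far"
      unfolding cycle_cover_prob_eq g_def[symmetric]
      by (subst Bochner_Integration.integral_add, (rule integrable_types_pmf)+)+ simp
    also have "\<dots> \<le> cycle_cover_prob W n + c * exp (- \<mu> * real n) + 2 * CARD('q) * exp (- (2 * \<epsilon>\<^sup>2) * real n)"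
      using prob_far_le[OF \<epsilon> n] by simp
    also have "\<dots> \<le> cycle_cover_prob W n + c * exp (- l * real n) + 2 * CARD('q) * exp (- l * real n)"
    proof -
      have "l * real n \<le> \<mu> * real n" "l * real n \<le> 2 * \<epsilon>\<^sup>2 * real n" by (intro mult_right_mono; simp add: l_def)+
      then show ?thesis using c by (intro add_mono mult_left_mono) auto
    qed
    finally show ?thesis by (simp add: distrib_right)
  qed
  moreover have "c + 2 * CARD('q) > 0" "l > 0" using c \<epsilon> by (auto simp: l_def)
  ultimately show ?thesis by blast
qed

lemma exp_le_inverse_sqrt:
  assumes "l > (0::real)" shows "\<exists>C>0. \<forall>n\<ge>(1::nat). exp (- l * real n) \<le> C / sqrt (real n)"
proof (intro exI[of _ "1 / l"] conjI allI impI)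
  fix n :: nat assume n: "n \<ge> 1"
  have "l * n \<le> exp (l * n)" using exp_ge_add_one_self[of "l * n"] by linarith
  then have "exp (- l * n) * (l * n) \<le> exp (- l * n) * exp (l * n)" by (intro mult_left_mono) auto
  then have "exp (- l * n) * (l * n) \<le> 1" by (simp add: mult_exp_exp)
  moreover have "sqrt (real n) \<le> real n" using n by (intro real_le_lsqrt) (auto simp: power2_eq_square)
  then have "exp (- l * n) * (l * sqrt n) \<le> exp (- l * n) * (l * n)" using assms by (intro mult_left_mono) auto
  ultimately have "exp (- l * n) * (l * sqrt n) \<le> 1" by linarith
  then show "exp (- l * real n) \<le> 1 / l / sqrt (real n)" using assms n by (simp add: field_simps)
qed (use assms in simp)

lemma interior_case:
  assumes conn: "graph_connected UNIV S" and odd: "has_odd_cycle S" and x: "x \<in> rel_interior (edge_cone S)"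
  shows "\<exists>c>0. \<exists>l>0. \<forall>n\<ge>1. 1 - cycle_cover_prob W n \<le> c * exp (- l * real n)"
proof -
  have xX: "x \<in> edge_cone S" using x rel_interior_subset by blast
  have zero: "hall_functional S T $ k = 0" if T: "T \<in> tight_sets" for T k
  proof (rule alternating_functional_zero[OF conn odd])
    fix k l assume kl: "{k, l} \<in> S"
    have "inner (hall_functional S T) (edge_vector {k, l}) = 0"
      using functional_zero_at_rel_interior[OF convex_edge_cone x hall_functional_nonneg _ edge_vector_in_edge_cone[OF kl]] T by blast
    then show "hall_functional S T $ k + hall_functional S T $ l = 0" by (simp add: inner_edge_vector)
  qed
  have "(tight_event n) = UNIV" for n
    using zero by (auto simp: inner_vec_def)
  moreover obtain c l where "c > 0" "l > 0" "\<forall>n\<ge>1. measure_pmf.prob (types_pmf n) (tight_event n)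
     \<le> cycle_cover_prob W n + c * exp (- l * real n)" using cycle_cover_prob_ge[OF xX] by blast
  ultimately have "\<forall>n\<ge>1. 1 - cycle_cover_prob W n \<le> c * exp (- l * real n)" by (simp add: algebra_simps)
  then show ?thesis using \<open>c > 0\<close> \<open>l > 0\<close> by blast
qed

lemma exterior_case:
  assumes x: "x \<notin> edge_cone S"
  shows "\<exists>c>0. \<exists>l>0. \<forall>n\<ge>1. cycle_cover_prob W n \<le> c * exp (- l * real n)"
proof -
  have "open (- edge_cone S)" using closed_edge_cone by (rule open_Compl)
  then obtain e where e: "e > 0" "\<And>y. dist y x < e \<Longrightarrow> y \<notin> edge_cone S"
    using x unfolding open_dist by (metis ComplD ComplI)
  define \<epsilon> where "\<epsilon> = e / (2 * CARD('q))"
  have \<epsilon>: "\<epsilon> > 0" using e by (simp add: \<epsilon>_def)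
  have "cycle_cover_prob W n \<le> 2 * CARD('q) * exp (- (2 * \<epsilon>\<^sup>2) * real n)" if n: "n \<ge> 1" for n
  proof -
    have "{b. type_counts n b \<in> edge_cone S} \<subseteq> (far n \<epsilon>)"
    proof (intro subsetI CollectI notI)
      fix b assume b: "b \<in> {b. type_counts n b \<in> edge_cone S}"
        and close: "\<forall>k. \<bar>real (card (nodes_of n b k)) - n * mass k\<bar> \<le> \<epsilon> * n"
      define y where "y = (1 / real n) *\<^sub>R type_counts n b"
      have "y \<in> edge_cone S" unfolding y_def using b by (intro edge_cone_scale) auto
      moreover have "dist y x < e"
      proof -
        have comp: "\<bar>y $ k - x $ k\<bar> \<le> \<epsilon>" for k
        proof -
          have "y $ k - x $ k = (real (card (nodes_of n b k)) - n * mass k) / n"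
            using n by (simp add: y_def type_counts_def x_eq_mass field_simps)
          then have "\<bar>y $ k - x $ k\<bar> = \<bar>real (card (nodes_of n b k)) - n * mass k\<bar> / n" using n by simp
          also have "\<dots> \<le> \<epsilon>" using close n by (simp add: divide_le_eq)
          finally show ?thesis .
        qed
        have "dist y x \<le> (\<Sum>k\<in>UNIV. \<bar>(y - x) $ k\<bar>)" unfolding dist_norm by (rule norm_le_l1_cart)
        also have "\<dots> \<le> (\<Sum>k\<in>(UNIV :: 'q set). \<epsilon>)" using comp by (intro sum_mono) simp
        also have "\<dots> = e / 2" by (simp add: \<epsilon>_def)
        finally show ?thesis using e by simp
      qed
      ultimately show False using e by blast
    qed
    then have "measure_pmf.prob (types_pmf n) {b. type_counts n b \<in> edge_cone S} \<le>
      measure_pmf.prob (types_pmf n) (far n \<epsilon>)"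
      by (intro measure_pmf.finite_measure_mono) auto
    then show ?thesis using cycle_cover_prob_le[of n] prob_far_le[OF \<epsilon> n] by linarith
  qed
  then show ?thesis using \<epsilon>
    by (intro exI[of _ "2 * real CARD('q)"] exI[of _ "2 * \<epsilon>\<^sup>2"] conjI allI impI) simp_all
qed

lemma bipartite_case:
  assumes conn: "graph_connected UNIV S" and noodd: "\<not> has_odd_cycle S" and xX: "x \<in> edge_cone S"
  shows "\<exists>c>0. \<forall>n\<ge>1. cycle_cover_prob W n \<le> c / sqrt (real n)"
proof -
  obtain a :: "'q \<Rightarrow> real" where a: "\<And>k. a k = 1 \<or> a k = -1" "\<And>k l. {k, l} \<in> S \<Longrightarrow> a k + a l = 0"
    using two_colouring_if_no_odd_cycle[OF conn noodd] by blast
  define A where "A = (\<chi> k. a k)"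
  have zero: "inner A y = 0" if y: "y \<in> edge_cone S" for y
  proof -
    have "inner A y \<ge> 0" by (rule edge_cone_functional_nonneg[OF skeleton_doubletons _ y]) (simp add: A_def a)
    moreover have "inner (- A) y \<ge> 0"
    proof (rule edge_cone_functional_nonneg[OF skeleton_doubletons _ y])
      fix k l assume "{k, l} \<in> S" then show "(- A) $ k + (- A) $ l \<ge> 0" using a(2)[of k l] by (simp add: A_def)
    qed
    ultimately show ?thesis by simp
  qed
  have half: "pmf (map_pmf (\<lambda>k. a k = 1) type_pmf) True = 1 / 2"
  proof -
    have "(\<Sum>k\<in>UNIV. a k * mass k) = 0" using zero[OF xX] by (simp add: inner_vec_def A_def x_eq_mass)
    moreover have "a k * mass k = (if a k = 1 then 2 * mass k else 0) - mass k" for k using a(1)[of k] by auto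
    ultimately have "(\<Sum>k\<in>UNIV. (if a k = 1 then 2 * mass k else 0) - mass k) = 0" by simp
    then have "2 * (\<Sum>k\<in>UNIV. if a k = 1 then mass k else 0) = 1"
      using sum_mass by (simp add: sum_subtractf sum_distrib_left if_distrib[of "\<lambda>z. 2 * z"] cong: if_cong)
    moreover have "pmf (map_pmf (\<lambda>k. a k = 1) type_pmf) True = (\<Sum>k\<in>{k. a k = 1}. mass k)"
      by (simp add: pmf_map vimage_def measure_measure_pmf_finite pmf_type)
    ultimately show ?thesis by (simp add: sum.If_cases)
  qed
  have "cycle_cover_prob W n \<le> 2 * 10^6 / sqrt (real n)" if n: "n \<ge> 1" for n
  proof -
    have ev: "{b. type_counts n b \<in> edge_cone S} \<subseteq> {b. 2 * real (card {v\<in>{..<n}. a (b v) = 1}) - real n \<in> {0}}"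
    proof (intro subsetI CollectI)
      fix b assume "b \<in> {b. type_counts n b \<in> edge_cone S}"
      then have "type_counts n b \<in> edge_cone S" by simp
      then have "inner A (type_counts n b) = 0" by (rule zero)
      then have "0 = (\<Sum>v<n. a (b v))" by (simp add: inner_type_counts A_def)
      also have "\<dots> = (\<Sum>v<n. 2 * (if a (b v) = 1 then 1 else 0) - 1)"
        using a(1) by (intro sum.cong refl) (smt (verit))
      also have "\<dots> = 2 * (\<Sum>v<n. if a (b v) = 1 then 1 else 0) - real n" by (simp add: sum_subtractf sum_distrib_left)
      also have "(\<Sum>v<n. if a (b v) = 1 then 1 else 0 :: real) = real (card {v\<in>{..<n}. a (b v) = 1})"
        by (subst sum.inter_filter[symmetric]) auto
      finally show "2 * real (card {v\<in>{..<n}. a (b v) = 1}) - real n \<in> {0}" by simp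
    qed
    have law: "map_pmf (\<lambda>b. card {v\<in>{..<n}. a (b v) = 1}) (types_pmf n) = binomial_pmf n (1/2)"
    proof -
      have "map_pmf (\<lambda>b. card {v\<in>{..<n}. a (b v) = 1}) (types_pmf n) =
        map_pmf (\<lambda>h. card {v\<in>{..<n}. h v = True}) (map_pmf (\<lambda>b. (\<lambda>k. a k = 1) \<circ> b) (types_pmf n))"
        by (simp add: map_pmf_comp)
      also have "map_pmf (\<lambda>b. (\<lambda>k. a k = 1) \<circ> b) (types_pmf n) = Pi_pmf {..<n} (a undefined = 1) (\<lambda>_. map_pmf (\<lambda>k. a k = 1) type_pmf)"
        by (rule Pi_pmf_map[symmetric]) auto
      finally show ?thesis unfolding count_binomial half .
    qed
    have "cycle_cover_prob W n \<le> measure_pmf.prob (types_pmf n) {b. 2 * real (card {v\<in>{..<n}. a (b v) = 1}) - real n \<in> {0}}"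
      using cycle_cover_prob_le[of n] measure_pmf.finite_measure_mono[OF ev, of "types_pmf n"] by simp
    also have "\<dots> = measure_pmf.prob (map_pmf (\<lambda>b. card {v\<in>{..<n}. a (b v) = 1}) (types_pmf n)) {j. 2 * real j - real n \<in> {0}}"
      by (simp add: vimage_def)
    also have "\<dots> = measure_pmf.prob (binomial_pmf n (1/2)) {j. 2 * real j - real n \<in> {0}}" unfolding law ..
    also have "\<dots> \<le> measure (gauss (real n + 1)) {0} + 2 * 10^6 * (1 / sqrt (real n + 1) + \<bar>real n + 1 - (real n + 1)\<bar> / (real n + 1))"
      using binomial_normal_interval[of "{0}" "real n + 1" n] unfolding gauss_def by (simp add: is_interval_1)
    also have "measure (gauss (real n + 1)) {0} = 0"
    proof -
      have "{0} \<in> null_sets (gauss (real n + 1))"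
        unfolding gauss_def
      proof (subst null_sets_density_iff, simp, intro conjI)
        have "AE t in lborel. t \<noteq> (0 :: real)" by (rule AE_lborel_singleton)
        then show "AE t in lborel. t \<in> {0} \<longrightarrow> ennreal (normal_density 0 (sqrt (real n + 1)) t) = 0"
          by eventually_elim simp
      qed simp
      then show ?thesis by (rule measure_eq_0_null_sets)
    qed
    also have "0 + 2 * 10^6 * (1 / sqrt (real n + 1) + \<bar>real n + 1 - (real n + 1)\<bar> / (real n + 1)) = 2 * 10^6 / sqrt (real n + 1)" by simp
    also have "\<dots> \<le> 2 * 10^6 / sqrt (real n)" using n by (intro divide_left_mono) auto
    finally show ?thesis .
  qed
  then show ?thesis by (intro exI[of _ "2 * 10^6"]) auto
qed

text \<open>
  The edges that are used to write \<open>x\<close> as a combination of edge vectors serve as labels. For tight sets the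
  Hall functional vanishes on each of these edges, that is, it alternates.
\<close>

lemma boundary_case:
  assumes conn: "graph_connected UNIV S" and odd: "has_odd_cycle S"
    and xX: "x \<in> edge_cone S" "x \<notin> rel_interior (edge_cone S)"
  shows "\<exists>p. 0 < p \<and> p < 1 \<and> (\<exists>c>0. \<forall>n\<ge>1. \<bar>cycle_cover_prob W n - p\<bar> \<le> c / sqrt (real n))"
proof -
  obtain c where c: "\<forall>f\<in>S. c f \<ge> 0" and xc: "x = (\<Sum>f\<in>S. c f *\<^sub>R edge_vector f)"
    using xX(1) unfolding edge_cone_def by auto
  define c' where "c' = (\<lambda>f. if f \<in> S then c f else 0)"
  have c'0: "c' f \<ge> 0" for f using c by (simp add: c'_def)
  have xc': "x = (\<Sum>f\<in>UNIV. c' f *\<^sub>R edge_vector f)"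
    unfolding xc c'_def by (intro sum.mono_neutral_cong_left) auto
  have xk: "mass k = (\<Sum>f\<in>UNIV. c' f * (((if Min f = k then 1 else 0) + (if Max f = k then 1 else 0)) / 2))" for k
  proof -
    have "mass k = (\<Sum>f\<in>UNIV. c' f *\<^sub>R edge_vector f) $ k" unfolding xc'[symmetric] by (rule x_eq_mass[symmetric])
    also have "\<dots> = (\<Sum>f\<in>UNIV. c' f * (((if Min f = k then 1 else 0) + (if Max f = k then 1 else 0)) / 2))"
      by (simp add: edge_vector_def axis_def eq_commute)
    finally show ?thesis .
  qed
  have c'sum: "(\<Sum>f\<in>UNIV. c' f) = 1"
  proof -
    have "1 = (\<Sum>k\<in>UNIV. mass (k :: 'q))" by (rule sum_mass[symmetric])
    also have "\<dots> = (\<Sum>f\<in>UNIV. \<Sum>k\<in>UNIV. c' f * (((if Min f = k then 1 else 0) + (if Max f = k then 1 else 0)) / 2))"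
      unfolding xk by (rule sum.swap)
    also have "\<dots> = (\<Sum>f\<in>UNIV. c' f)"
      by (simp flip: sum_distrib_left sum_divide_distrib add: sum.distrib)
    finally show ?thesis ..
  qed
  define ep where "ep = embed_pmf c'"
  have ep: "pmf ep f = c' f" for f
    unfolding ep_def using c'0 c'sum
    by (intro pmf_embed_pmf) (auto simp: nn_integral_count_space_finite sum_ennreal)
  define F where "F = set_pmf ep"
  have FS: "f \<in> S" "c' f > 0" if "f \<in> F" for f
    using that c'0[of f] unfolding F_def set_pmf_iff ep by (auto simp: c'_def split: if_splits)
  have law: "type_pmf = bind_pmf ep (\<lambda>f. map_pmf (\<lambda>s. if s then Min f else Max f) (bernoulli_pmf (1/2)))"
  proof (rule pmf_eqI)
    fix k
    have e: "pmf (map_pmf (\<lambda>s. if s then Min f else Max f) (bernoulli_pmf (1/2))) k = ((if Min f = k then 1 else 0) + (if Max f = k then 1 else 0)) / 2" for f :: "'q set"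
    proof -
      have "pmf (map_pmf (\<lambda>s. if s then Min f else Max f) (bernoulli_pmf (1/2))) k =
         measure_pmf.prob (bernoulli_pmf (1/2)) {s. (if s then Min f else Max f) = k}"
        by (simp add: pmf_map vimage_def)
      also have "\<dots> = (\<Sum>s\<in>{s. (if s then Min f else Max f) = k}. 1 / 2)"
        by (subst measure_measure_pmf_finite) (auto simp: pmf_bernoulli_half)
      also have "{s. (if s then Min f else Max f) = k} = (if Min f = k then {True} else {}) \<union> (if Max f = k then {False} else {})"
        by (auto split: if_splits)
      finally show ?thesis by auto
    qed
    have "pmf (bind_pmf ep (\<lambda>f. map_pmf (\<lambda>s. if s then Min f else Max f) (bernoulli_pmf (1/2)))) k =
      (\<Sum>f\<in>UNIV. pmf ep f * pmf (map_pmf (\<lambda>s. if s then Min f else Max f) (bernoulli_pmf (1/2))) k)"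
      unfolding pmf_bind by (subst integral_measure_pmf_real[where A = UNIV]) (auto simp: mult.commute)
    also have "\<dots> = mass k" unfolding e ep xk ..
    finally show "pmf type_pmf k = pmf (bind_pmf ep (\<lambda>f. map_pmf (\<lambda>s. if s then Min f else Max f) (bernoulli_pmf (1/2)))) k"
      by (simp add: pmf_type)
  qed
  define a where "a = (\<lambda>T k. hall_functional S T $ k)"
  have edge0: "inner (hall_functional S T) (edge_vector f) \<ge> 0" if "f \<in> S" for T f
    using that by (intro hall_functional_nonneg edge_vector_in_edge_cone)
  have alt: "a T (Min f) + a T (Max f) = 0" if T: "T \<in> tight_sets" and f: "f \<in> F" for T f
  proof -
    have "(\<Sum>f\<in>UNIV. c' f * inner (hall_functional S T) (edge_vector f)) = 0"
      using T unfolding xc' by (simp add: inner_sum_right)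
    moreover have "c' f * inner (hall_functional S T) (edge_vector f) \<ge> 0" for f
      using edge0[of f T] c by (simp add: c'_def)
    ultimately have "c' f * inner (hall_functional S T) (edge_vector f) = 0"
      by (subst (asm) sum_nonneg_eq_0_iff) auto
    then have "inner (hall_functional S T) (edge_vector f) = 0" using FS(2)[OF f] by simp
    then show ?thesis by (simp add: edge_vector_def a_def inner_axis inner_add_right)
  qed
  define P where "P = measure (Pi\<^sub>M F (\<lambda>f. gauss (pmf ep f))) (half_spaces F (\<lambda>T f. a T (Min f)) tight_sets)"
  have "\<exists>C>0. \<forall>n\<ge>1. \<bar>measure_pmf.prob (types_pmf n) {b. \<forall>T\<in>tight_sets. 0 \<le> (\<Sum>v<n. a T (b v))} - P\<bar> \<le> C / sqrt (real n)"
    unfolding P_def F_def law by (rule alternating_sums_gauss_limit) (use alt in \<open>auto simp: F_def\<close>)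
  then obtain C where C: "C > 0" and lim: "\<And>n. n \<ge> 1 \<Longrightarrow>
      \<bar>measure_pmf.prob (types_pmf n) {b. \<forall>T\<in>tight_sets. 0 \<le> (\<Sum>v<n. a T (b v))} - P\<bar> \<le> C / sqrt (real n)"
    by blast
  have a1: "\<bar>a T k\<bar> \<le> 1" for T k by (auto simp: a_def hall_functional_def indicator_def)
  \<comment> \<open>a vector on which every nonzero Hall functional is positive\<close>
  define z where "z = (\<Sum>f\<in>S. edge_vector f)"
  have az: "(\<Sum>k\<in>UNIV. a T k * z $ k) > 0 \<or> (\<forall>k. a T k = 0)" for T
  proof -
    have eq: "(\<Sum>k\<in>UNIV. a T k * z $ k) = (\<Sum>f\<in>S. inner (hall_functional S T) (edge_vector f))"
      unfolding inner_sum_right[symmetric] z_def[symmetric] by (simp add: inner_vec_def a_def)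
    show ?thesis
    proof (cases "\<forall>f\<in>S. inner (hall_functional S T) (edge_vector f) = 0")
      case True
      have "a T k = 0" for k
      proof (rule alternating_functional_zero[OF conn odd])
        fix k l assume "{k, l} \<in> S"
        then show "a T k + a T l = 0" using True inner_edge_vector[of "hall_functional S T" k l] by (auto simp: a_def)
      qed
      then show ?thesis by blast
    next
      case False
      then obtain f where "f \<in> S" "inner (hall_functional S T) (edge_vector f) > 0" using edge0 by (metis less_eq_real_def)
      then show ?thesis unfolding eq using edge0 by (auto intro!: sum_pos2)
    qed
  qed
  \<comment> \<open>as \<open>x\<close> is positive, every type is an end point of an edge in \<open>F\<close>, so that \<open>z\<close> can be expressed by edges\<close>
  have "\<exists>f. f \<in> F \<and> (Min f = k \<or> Max f = k)" for k
  proof (rule ccontr)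
    assume "\<not> ?thesis"
    then have "c' f = 0" if "Min f = k \<or> Max f = k" for f
      using that unfolding F_def set_pmf_iff ep by blast
    then have "mass k = 0" unfolding xk by (intro sum.neutral) auto
    then show False using mass_pos[of k] by simp
  qed
  then have "\<exists>e. \<forall>k. e k \<in> F \<and> (Min (e k) = k \<or> Max (e k) = k)" by (intro choice allI)
  then obtain e where e: "\<And>k. e k \<in> F" "\<And>k. Min (e k) = k \<or> Max (e k) = k" by blast
  define sg where "sg = (\<lambda>k. if Min (e k) = k then 1 else -1 :: real)"
  define y where "y = (\<lambda>f. \<Sum>k\<in>{k. e k = f}. sg k * z $ k)"
  have ay: "(\<Sum>f\<in>F. a T (Min f) * y f) = (\<Sum>k\<in>UNIV. a T k * z $ k)" if T: "T \<in> tight_sets" for T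
  proof -
    have "a T (Min (e k)) * sg k = a T k" for k
      using e(2)[of k] alt[OF T e(1)[of k]] by (auto simp: sg_def eq_neg_iff_add_eq_0 add.commute)
    then have *: "a T (Min (e k)) * (sg k * z $ k) = a T k * z $ k" for k by (metis mult.assoc)
    have "(\<Sum>f\<in>F. a T (Min f) * y f) = (\<Sum>f\<in>F. \<Sum>k\<in>{k\<in>UNIV. e k = f}. a T (Min (e k)) * (sg k * z $ k))"
      unfolding y_def sum_distrib_left by (intro sum.cong) auto
    also have "\<dots> = (\<Sum>k\<in>UNIV. a T (Min (e k)) * (sg k * z $ k))"
      using e(1) by (intro sum.group) auto
    finally show ?thesis by (simp add: *)
  qed
  have "x $ k > 0" for k using mass_pos by (simp add: x_eq_mass)
  from tight_set_at_boundary[OF skeleton_doubletons this xX]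
  obtain T0 k0 where t: "(\<Sum>k\<in>T0. x $ k) = (\<Sum>k\<in>nbrs S T0. x $ k)" "hall_functional S T0 $ k0 \<noteq> 0" by blast
  then have T0: "T0 \<in> tight_sets" "a T0 k0 \<noteq> 0" by (simp_all add: inner_hall_functional a_def)
  have fin: "finite F" by (simp add: F_def)
  have cpos: "pmf ep f > 0" if "f \<in> F" for f using FS(2)[OF that] by (simp add: ep)
  have ysep: "0 < (\<Sum>f\<in>F. a T (Min f) * y f) \<or> (\<forall>f\<in>F. a T (Min f) = 0)" if "T \<in> tight_sets" for T
    using az[of T] ay[OF that] by auto
  have y0: "0 < (\<Sum>f\<in>F. a T0 (Min f) * y f)" using az[of T0] T0 ay[OF T0(1)] by auto
  have "0 < P"
    unfolding P_def by (rule half_spaces_gauss_strictly_between(1)[where \<alpha> = "\<lambda>T f. a T (Min f)" and y = y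
        and c = "pmf ep" and F = F and I = tight_sets and ?i0.0 = T0, OF fin finite cpos a1 ysep T0(1) y0])
  moreover have "P < 1"
    unfolding P_def by (rule half_spaces_gauss_strictly_between(2)[where \<alpha> = "\<lambda>T f. a T (Min f)" and y = y
        and c = "pmf ep" and F = F and I = tight_sets and ?i0.0 = T0, OF fin finite cpos a1 ysep T0(1) y0])
  ultimately have P01: "0 < P" "P < 1" by simp_all
  have ev: "{b. \<forall>T\<in>tight_sets. 0 \<le> (\<Sum>v<n. a T (b v))} = (tight_event n)" for n
    by (simp add: inner_type_counts a_def)
  obtain c1 l where c1: "c1 > 0" "l > 0" and lower: "\<And>n. n \<ge> 1 \<Longrightarrow> measure_pmf.prob (types_pmf n) (tight_event n)
     \<le> cycle_cover_prob W n + c1 * exp (- l * real n)" using cycle_cover_prob_ge[OF xX(1)] by blast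
  obtain C2 where C2: "C2 > 0" "\<And>n. n \<ge> (1::nat) \<Longrightarrow> exp (- l * real n) \<le> C2 / sqrt (real n)"
    using exp_le_inverse_sqrt[OF c1(2)] by blast
  have "\<bar>cycle_cover_prob W n - P\<bar> \<le> (C + c1 * C2) / sqrt (real n)" if n: "n \<ge> 1" for n
  proof -
    define h where "h = measure_pmf.prob (types_pmf n) (tight_event n)"
    have "cycle_cover_prob W n \<le> h"
      unfolding h_def using hall_functional_nonneg
      by (intro order_trans[OF cycle_cover_prob_le] measure_pmf.finite_measure_mono) auto
    moreover have "h \<le> cycle_cover_prob W n + c1 * exp (- l * real n)" unfolding h_def by (rule lower[OF n])
    moreover have "c1 * exp (- l * real n) \<le> c1 * (C2 / sqrt (real n))" using c1 C2(2)[OF n] by (intro mult_left_mono) auto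
    moreover have "\<bar>h - P\<bar> \<le> C / sqrt (real n)" unfolding h_def using lim[OF n] unfolding ev .
    ultimately have "\<bar>cycle_cover_prob W n - P\<bar> \<le> C / sqrt (real n) + c1 * (C2 / sqrt (real n))" by linarith
    then show ?thesis by (simp add: add_divide_distrib)
  qed
  moreover have "C + c1 * C2 > 0" using C c1 C2 by (simp add: add_pos_pos)
  ultimately show ?thesis using P01 by blast
qed

end

theorem theorem1:
  fixes W :: "real \<Rightarrow> real \<Rightarrow> real" and \<sigma> :: "nat \<Rightarrow> real"
    and S :: "'q::{finite,linorder} set set" and x :: "real ^ ('q::{finite,linorder})" and X :: "(real ^ ('q::{finite,linorder})) set"
  assumes "is_graphon W" and "is_partition W CARD('q) \<sigma>"
    and "x = concentration \<sigma>" and "S = skeleton W \<sigma>" and "X = edge_cone S"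
    and "graph_connected UNIV S"
  shows
    "(has_odd_cycle S \<and> x \<in> rel_interior X \<longrightarrow>
        (\<exists>c>0. \<exists>l>0. \<forall>n\<ge>1. 1 - cycle_cover_prob W n \<le> c * exp (- l * real n))) \<and>
     (x \<notin> X \<longrightarrow>
        (\<exists>c>0. \<exists>l>0. \<forall>n\<ge>1. cycle_cover_prob W n \<le> c * exp (- l * real n))) \<and>
     (x \<in> X \<and> \<not> has_odd_cycle S \<longrightarrow>
        (\<exists>c>0. \<forall>n\<ge>1. cycle_cover_prob W n \<le> c / sqrt (real n))) \<and>
     (has_odd_cycle S \<and> x \<in> X \<and> x \<notin> rel_interior X \<longrightarrow>
        (\<exists>p. 0 < p \<and> p < 1 \<and>
          (\<exists>c>0. \<forall>n\<ge>1. \<bar>cycle_cover_prob W n - p\<bar> \<le> c / sqrt (real n))))"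
proof -
  interpret step_graphon W \<sigma> "TYPE('q)" using assms(1,2) by unfold_locales
  show ?thesis
    using interior_case exterior_case bipartite_case boundary_case assms(6) unfolding assms(3-5) by blast
qed

end
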